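(* Let $\mathcal{M}$ be a quantum metric space, $d\in\mathbb{N}$ and $0<\varepsilon<1$. Suppose there is a sequence $\{\Phi_m\colon M_{n_m}\to M_{n_m}\}_{m\in\mathbb{N}}$ of $d$-regular $\varepsilon$-quantum expanders such that, for each $m$, the quantum metric on $M_{n_m}$ induced by $\Phi_m$ is reflexive, and such that there is an equi-coarse family of quantum coarse embeddings $\{\phi_m\colon\mathcal{M}\to M_{n_m}\}_{m\in\mathbb{N}}$. Then $\operatorname{asdim}(\mathcal{M})=\infty$. In particular, $\operatorname{asdim}(\mathcal{M})=\infty$ whenever $\mathcal{M}$ admits a sequence of reflexive $d$-regular $\varepsilon$-quantum expanders (with their induced quantum metrics) as metric quotients.
   Context: Von Neumann algebras are concrete: $\mathcal{M}\subseteq\mathcal{B}(\mathcal{H})$, with commutant $\mathcal{M}'$; "projection" means orthogonal projection; $\mathcal{M}\overline{\otimes}\mathcal{B}(\ell_2)$ is the weak*-closed spatial tensor product in $\mathcal{B}(\mathcal{H}\otimes_2\ell_2)$. $M_n$ is the algebra of complex $n\times n$ matrices, acting on $\mathbb{C}^n$. $\inf\emptyset=\infty$. A quantum metric on $\mathcal{M}\subseteq \mathcal{B}(\mathcal{H})$ is a family $\mathbb{V}=\{\mathcal{V}_t\}_{t\in[0,\infty)}$ of weak*-closed self-adjoint subspaces of $\mathcal{B}(\mathcal{H})$ with $\mathcal{V}_0=\mathcal{M}'$, $\mathcal{V}_s\mathcal{V}_t\subseteq \mathcal{V}_{s+t}$ for all $s,t\ge 0$, and $\mathcal{V}_t=\bigcap_{s>t}\mathcal{V}_s$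 for all $t\ge0$. A quantum metric space is a pair $(\mathcal{M},\mathbb{V})$. A subspace $\mathcal{V}\subseteq\mathcal{B}(\mathcal{H})$ is reflexive if $\mathcal{V}=\{B\in\mathcal{B}(\mathcal{H})\mid P\mathcal{V}Q=\{0\}\Rightarrow PBQ=0\}$, with $P,Q$ ranging over projections in $\mathcal{B}(\mathcal{H})$; the quantum metric (space) is reflexive if every $\mathcal{V}_t$ is reflexive. For projections $P,Q\in\mathcal{M}\overline{\otimes}\mathcal{B}(\ell_2)$, $\operatorname{dist}(P,Q)=\inf\{t \mid P(A\otimes \mathrm{Id})Q\ne0 \text{ for some } A\in\mathcal{V}_t\}$; for $P,Q\in\mathcal{M}$ (identified with $P\otimes\mathrm{Id}$, $Q\otimes \mathrm{Id}$) this is $\inf\{t\mid PAQ\neq0\text{ for some }A\in\mathcal{V}_t\}$. For a nonzero projection $P\in\mathcal{M}$, $\operatorname{diam}(P)=\sup\{\operatorname{dist}(Q,R)\mid Q(PAP\otimes\mathrm{Id})R\ne0\text{ for some }A\in\mathcal{B}(\mathcal{H})\}$, with $Q,R$ ranging over projections in $\mathcal{M}\overline{\otimes}\mathcal{B}(\ell_2)$; $\operatorname{diam}(0)=0$. The open $\delta$-neighborhood of a projection $P\in\mathcal{M}$ is $(P)_\delta=\mathrm{Id}-\bigvee\{Q\in\mathcal{M}\text{ projection}\mid \operatorname{dist}(P,Q)\ge\delta\}$. A quantum function $\phi\colon\mathcal{M}\to\mathcal{N}$ is a unital weak*-continuous $*$-homomorphism. For a quantum function between quantum metric spaces and $t\ge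 0$, with $P,Q$ ranging over projections in $\mathcal{M}$, put $\tilde\omega_\phi(t)=\inf\{\operatorname{dist}(\phi(P),\phi(Q))\mid\operatorname{dist}(P,Q)\ge t\}$ and $\tilde\rho_\phi(t)=\sup\{\operatorname{diam}(\phi(P))\mid\operatorname{diam}(P)\le t\}$. $\phi$ is a quantum coarse embedding if $\lim_{t\to\infty}\tilde\omega_\phi(t)=\infty$ and $\tilde\rho_\phi(t)<\infty$ for all $t\ge0$. A family $\{\phi_\alpha\colon\mathcal{M}\to\mathcal{N}_\alpha\}$ of quantum coarse embeddings is equi-coarse if there are functions $f,g$ on $[0,\infty)$ with $\lim_{t\to\infty}f(t)=\infty$ and $g(t)<\infty$ for all $t\ge0$ such that $f(t)\le\tilde\omega_{\phi_\alpha}(t)$ and $\tilde\rho_{\phi_\alpha}(t)\le g(t)$ for all $t\ge0$ and all $\alpha$. A family $\mathscr{P}$ of projections in $\mathcal{M}$ is a cover if $\bigvee_{P\in\mathscr{P}}P=\mathrm{Id}$; it is $r$-disjoint if $(P)_r(Q)_r=0$ for all distinct $P,Q\in\mathscr{P}$; it is uniformly bounded if $\sup_{P\in\mathscr{P}}\operatorname{diam}(P)\le R$ for some $R>0$. $\operatorname{asdim}(\mathcal{M})\le n$ ($n\in\mathbb{N}\cup\{0\}$) if for every $r>0$ there are uniformly bounded, $r$-disjoint families $\mathscr{P}^0,\dots,\mathscr{P}^n$ of projections in $\mathcal{M}$ whose union is a cover for $\mathcal{M}$; $\operatorname{asdim}(\mathcal{M})$ is the least such $n$, and $\infty$ if there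 is none. CPTP means completely positive and trace-preserving. Writing a CPTP map as $\Phi(X)=\sum_{j=1}^NK_jXK_j^*$, $K_j\in M_n$, the quantum metric on $M_n$ induced by $\Phi$ is $\mathcal{V}_0=\mathbb{C}I_n$, $\mathcal{V}_1=\operatorname{span}\{K_j^*K_i\}_{1\le i,j\le N}$, $\mathcal{V}_t=\mathcal{V}_1^{\lfloor t\rfloor}$ for $t>0$, where $\mathcal{V}_1^k$ is the span of $k$-fold products and $\mathcal{V}_1^0=\mathbb{C}I_n$. For $0<\varepsilon<1$, $\Phi$ has an $\varepsilon$-spectral gap if $\|\Phi(X)-\frac1n\operatorname{tr}(X)I_n\|_{\mathrm{HS}}\le(1-\varepsilon)\|X-\frac1n\operatorname{tr}(X)I_n\|_{\mathrm{HS}}$ for all $X\in M_n$ (Hilbert–Schmidt norm). $\Phi$ is a $d$-regular $\varepsilon$-quantum expander if it has an $\varepsilon$-spectral gap and there are unitaries $U_1,\dots,U_d\in M_n$ with $\Phi(X)=\frac1d\sum_{j=1}^dU_jXU_j^*$ for all $X\in M_n$. A sequence of $d$-regular $\varepsilon$-quantum expanders is a sequence $\{\Phi_m\colon M_{n_m}\to M_{n_m}\}$ of such maps (same $d,\varepsilon$) with $n_m\to\infty$. Metric quotient: given $(\mathcal{M},\{\mathcal{V}_t\})$ with $\mathcal{M}\subseteq\mathcal{B}(\mathcal{H})$ and a central projection $R\in\mathcal{M}$, the corresponding metric quotient is $R\mathcal{M}\subseteq\mathcal{B}(R\mathcal{H})$ with the quantum metric $\{R\mathcal{V}_tR\}_{t\ge0}$.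 Quantum metric spaces are identified when there is a weak*-homeomorphic $*$-isomorphism of the algebras whose amplification by $\mathrm{Id}_{\mathcal{B}(\ell_2)}$ preserves distances between projections. *)

theory Defs
  imports "HOL-Analysis.Analysis"
begin

section \<open>Complex Hilbert spaces\<close>

class complex_vector = real_vector +
  fixes scaleC :: "complex \<Rightarrow> 'a \<Rightarrow> 'a" (infixr \<open>*\<^sub>C\<close> 75)
  assumes scaleC_add_right: "c *\<^sub>C (x + y) = c *\<^sub>C x + c *\<^sub>C y"
    and scaleC_add_left: "(c + d) *\<^sub>C x = c *\<^sub>C x + d *\<^sub>C x"
    and scaleC_scaleC: "c *\<^sub>C (d *\<^sub>C x) = (c * d) *\<^sub>C x"
    and scaleC_of_real: "complex_of_real r *\<^sub>C x = r *\<^sub>R x"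

text \<open>The complex inner product is linear in the second argument; its real part is the
  library's real inner product, so norm, topology and completeness are the library's.\<close>

class chilbert = complex_vector + real_inner + complete_space +
  fixes cinner :: "'a \<Rightarrow> 'a \<Rightarrow> complex"
  assumes cinner_commute: "cinner x y = cnj (cinner y x)"
    and cinner_add_right: "cinner x (y + z) = cinner x y + cinner x z"
    and cinner_scaleC_right: "cinner x (c *\<^sub>C y) = c * cinner x y"
    and inner_eq_Re_cinner: "inner x y = Re (cinner x y)"

lemma cinner_scaleC_left: "cinner (c *\<^sub>C x) (y::'a::chilbert) = cnj c * cinner x y"
  by (metis cinner_commute cinner_scaleC_right complex_cnj_mult)

lemma cinner_add_left: "cinner (x + y) (z::'a::chilbert) = cinner x z + cinner y z"
  by (metis cinner_commute cinner_add_right complex_cnj_add)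

lemma cinner_self: "cinner x (x::'a::chilbert) = complex_of_real ((norm x)\<^sup>2)"
proof (rule complex_eqI)
  show "Re (cinner x x) = Re (complex_of_real ((norm x)\<^sup>2))"
    by (simp add: inner_eq_Re_cinner[symmetric] power2_norm_eq_inner)
  have "Im (cinner x x) = - Im (cinner x x)"
    by (metis cinner_commute cnj.simps(2))
  then show "Im (cinner x x) = Im (complex_of_real ((norm x)\<^sup>2))" by simp
qed

lemma norm_scaleC: "norm (c *\<^sub>C (x::'a::chilbert)) = cmod c * norm x"
proof -
  have "complex_of_real ((norm (c *\<^sub>C x))\<^sup>2) = complex_of_real ((cmod c * norm x)\<^sup>2)"
    unfolding cinner_self[symmetric] cinner_scaleC_left cinner_scaleC_right
    by (simp add: cinner_self power_mult_distrib complex_norm_square)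
       (metis complex_norm_square mult.assoc mult.commute of_real_power)
  then have "(norm (c *\<^sub>C x))\<^sup>2 = (cmod c * norm x)\<^sup>2"
    using of_real_eq_iff by blast
  then show ?thesis
    by (simp add: power2_eq_iff_nonneg)
qed

lemma norm_cinner_le: "cmod (cinner x (y::'a::chilbert)) \<le> norm x * norm y"
proof (cases "cinner x y = 0")
  case False
  define u where "u = cnj (cinner x y) / cmod (cinner x y)"
  have u: "cmod u = 1" using False by (simp add: u_def norm_divide)
  have "cmod (cinner x y) = Re (u * cinner x y)"
    using False unfolding u_def
    by (simp add: complex_norm_square[symmetric] power2_eq_square mult.commute)
  also have "\<dots> = inner x (u *\<^sub>C y)"
    by (simp add: inner_eq_Re_cinner cinner_scaleC_right)
  also have "\<dots> \<le> norm x * norm (u *\<^sub>C y)"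
    by (rule norm_cauchy_schwarz)
  finally show ?thesis by (simp add: norm_scaleC u)
qed simp

global_interpretation cvec: vector_space "scaleC :: complex \<Rightarrow> 'a \<Rightarrow> 'a::complex_vector"
proof
  fix x :: 'a
  show "1 *\<^sub>C x = x" using scaleC_of_real[of 1 x] by simp
qed (simp_all add: scaleC_add_right scaleC_add_left scaleC_scaleC)

instantiation complex :: chilbert
begin
definition scaleC_complex :: "complex \<Rightarrow> complex \<Rightarrow> complex" where "scaleC_complex c x = c * x"
definition cinner_complex :: "complex \<Rightarrow> complex \<Rightarrow> complex" where "cinner_complex x y = cnj x * y"
instance
  by standard
     (auto simp: scaleC_complex_def cinner_complex_def algebra_simps scaleR_conv_of_real
        inner_complex_def)
end

text \<open>The Hilbert space of square-summable sequences in \<open>H\<close>. It serves as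
  \<open>H \<otimes>\<^sub>2 \<ell>\<^sub>2\<close>, and \<^typ>\<open>complex\<close>-valued sequences give \<open>\<ell>\<^sub>2\<close> itself.\<close>

typedef (overloaded) 'a ell2 = "{f :: nat \<Rightarrow> 'a::chilbert. summable (\<lambda>i. (norm (f i))\<^sup>2)}"
  morphisms seq Abs_ell2
  by (rule exI[of _ "\<lambda>_. 0"]) simp

setup_lifting type_definition_ell2

lemma summable_sq_add:
  fixes f g :: "nat \<Rightarrow> 'a::real_normed_vector"
  assumes "summable (\<lambda>i. (norm (f i))\<^sup>2)" "summable (\<lambda>i. (norm (g i))\<^sup>2)"
  shows "summable (\<lambda>i. (norm (f i + g i))\<^sup>2)"
proof (rule summable_comparison_test')
  show "summable (\<lambda>i. 2 * (norm (f i))\<^sup>2 + 2 * (norm (g i))\<^sup>2)"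
    by (intro summable_add summable_mult assms)
  fix i :: nat
  have "(norm (f i + g i))\<^sup>2 \<le> (norm (f i) + norm (g i))\<^sup>2"
    by (simp add: norm_triangle_ineq power_mono)
  also have "\<dots> \<le> 2 * (norm (f i))\<^sup>2 + 2 * (norm (g i))\<^sup>2"
    using sum_squares_bound[of "norm (f i)" "norm (g i)"] by (simp add: power2_sum)
  finally show "norm ((norm (f i + g i))\<^sup>2) \<le> 2 * (norm (f i))\<^sup>2 + 2 * (norm (g i))\<^sup>2" by simp
qed

lemma summable_norm_mult:
  fixes f g :: "nat \<Rightarrow> 'a::real_normed_vector"
  assumes "summable (\<lambda>i. (norm (f i))\<^sup>2)" "summable (\<lambda>i. (norm (g i))\<^sup>2)"
  shows "summable (\<lambda>i. norm (f i) * norm (g i))"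
proof (rule summable_comparison_test')
  show "summable (\<lambda>i. (norm (f i))\<^sup>2 + (norm (g i))\<^sup>2)"
    by (intro summable_add assms)
  show "norm (norm (f i) * norm (g i)) \<le> (norm (f i))\<^sup>2 + (norm (g i))\<^sup>2" for i
    using sum_squares_bound[of "norm (f i)" "norm (g i)"]
    by (simp add: abs_mult) (metis mult_nonneg_nonneg norm_ge_zero order_trans
        mult_2 le_add_same_cancel1 mult.assoc)
qed

instantiation ell2 :: (chilbert) complex_vector
begin
lift_definition zero_ell2 :: "'a ell2" is "\<lambda>_. 0" by simp
lift_definition plus_ell2 :: "'a ell2 \<Rightarrow> 'a ell2 \<Rightarrow> 'a ell2" is "\<lambda>f g i. f i + g i"
  by (rule summable_sq_add)
lift_definition uminus_ell2 :: "'a ell2 \<Rightarrow> 'a ell2" is "\<lambda>f i. - f i" by simp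
lift_definition minus_ell2 :: "'a ell2 \<Rightarrow> 'a ell2 \<Rightarrow> 'a ell2" is "\<lambda>f g i. f i - g i"
  subgoal for f g using summable_sq_add[of f "\<lambda>i. - g i"] by simp
  done
lift_definition scaleR_ell2 :: "real \<Rightarrow> 'a ell2 \<Rightarrow> 'a ell2" is "\<lambda>r f i. r *\<^sub>R f i"
  by (simp add: power_mult_distrib summable_mult)
lift_definition scaleC_ell2 :: "complex \<Rightarrow> 'a ell2 \<Rightarrow> 'a ell2" is "\<lambda>c f i. c *\<^sub>C f i"
  by (simp add: power_mult_distrib norm_scaleC summable_mult)
instance
  by standard
     (transfer; simp add: fun_eq_iff algebra_simps scaleC_add_right scaleC_add_left
        scaleC_scaleC scaleC_of_real)+
end

instantiation ell2 :: (chilbert) real_inner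
begin
definition inner_ell2 :: "'a ell2 \<Rightarrow> 'a ell2 \<Rightarrow> real"
  where "inner_ell2 f g = (\<Sum>i. inner (seq f i) (seq g i))"
definition norm_ell2 :: "'a ell2 \<Rightarrow> real" where "norm_ell2 f = sqrt (inner f f)"
definition dist_ell2 :: "'a ell2 \<Rightarrow> 'a ell2 \<Rightarrow> real" where "dist_ell2 f g = norm (f - g)"
definition sgn_ell2 :: "'a ell2 \<Rightarrow> 'a ell2" where "sgn_ell2 f = f /\<^sub>R norm f"
definition uniformity_ell2 :: "('a ell2 \<times> 'a ell2) filter"
  where "uniformity_ell2 = (INF e\<in>{0 <..}. principal {(x, y). dist x y < e})"
definition open_ell2 :: "'a ell2 set \<Rightarrow> bool"
  where "open_ell2 U = (\<forall>x\<in>U. \<forall>\<^sub>F (x', y) in uniformity. x' = x \<longrightarrow> y \<in> U)"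

lemma summable_inner_ell2: "summable (\<lambda>i. inner (seq f i) (seq g i))"
  for f g :: "'a ell2"
proof (rule summable_comparison_test')
  show "summable (\<lambda>i. norm (seq f i) * norm (seq g i))"
    using seq[of f] seq[of g] by (intro summable_norm_mult) auto
  show "norm (inner (seq f i) (seq g i)) \<le> norm (seq f i) * norm (seq g i)" for i
    by (simp add: Cauchy_Schwarz_ineq2)
qed

instance
proof
  fix f g h :: "'a ell2" and r :: real
  show "dist f g = norm (f - g)" by (fact dist_ell2_def)
  show "sgn f = f /\<^sub>R norm f" by (fact sgn_ell2_def)
  show "(uniformity :: ('a ell2 \<times> 'a ell2) filter) = (INF e\<in>{0 <..}. principal {(x, y). dist x y < e})"
    by (fact uniformity_ell2_def)
  show "open U = (\<forall>x\<in>U. \<forall>\<^sub>F (x', y) in uniformity. x' = x \<longrightarrow> y \<in> U)" for U :: "'a ell2 set"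
    by (fact open_ell2_def)
  show "inner f g = inner g f" by (simp add: inner_ell2_def inner_commute)
  show "inner (f + g) h = inner f h + inner g h"
    by (simp add: inner_ell2_def plus_ell2.rep_eq inner_add_left suminf_add summable_inner_ell2)
  show "inner (r *\<^sub>R f) g = r * inner f g"
    by (simp add: inner_ell2_def scaleR_ell2.rep_eq suminf_mult summable_inner_ell2)
  show ge: "0 \<le> inner f f"
    by (simp add: inner_ell2_def suminf_nonneg summable_inner_ell2)
  show "(inner f f = 0) = (f = 0)"
    using suminf_eq_zero_iff[OF summable_inner_ell2[of f f]]
    by (auto simp: inner_ell2_def zero_ell2.rep_eq seq_inject[symmetric] fun_eq_iff)
  show "norm f = sqrt (inner f f)" by (fact norm_ell2_def)
qed
end

lemma seq_minus: "seq (f - g) i = seq f i - seq g i"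
  by (simp add: minus_ell2.rep_eq)

lemma sum_seq_le_norm: "(\<Sum>i<k. (norm (seq f i))\<^sup>2) \<le> (norm f)\<^sup>2"
  using sum_le_suminf[OF summable_inner_ell2[of f f], of "{..<k}"]
  by (simp add: norm_ell2_def inner_ell2_def suminf_nonneg summable_inner_ell2 power2_norm_eq_inner)

lemma norm_seq_le: "norm (seq f i) \<le> norm f"
proof -
  have "(norm (seq f i))\<^sup>2 \<le> (\<Sum>j<Suc i. (norm (seq f j))\<^sup>2)"
    by (rule member_le_sum) auto
  also have "\<dots> \<le> (norm f)\<^sup>2" by (rule sum_seq_le_norm)
  finally show ?thesis by (simp add: power2_le_iff_abs_le)
qed

instance ell2 :: (chilbert) complete_space
proof
  fix X :: "nat \<Rightarrow> 'a ell2"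
  assume X: "Cauchy X"
  have "Cauchy (\<lambda>n. seq (X n) i)" for i
  proof (rule CauchyI)
    fix e :: real assume "0 < e"
    then obtain M where M: "\<forall>m\<ge>M. \<forall>n\<ge>M. norm (X m - X n) < e"
      using CauchyD[OF X] by blast
    then have "\<forall>m\<ge>M. \<forall>n\<ge>M. norm (seq (X m) i - seq (X n) i) < e"
      by (metis norm_seq_le order_le_less_trans seq_minus)
    then show "\<exists>M. \<forall>m\<ge>M. \<forall>n\<ge>M. norm (seq (X m) i - seq (X n) i) < e" by blast
  qed
  then have "\<exists>l. (\<lambda>n. seq (X n) i) \<longlonglongrightarrow> l" for i
    by (simp add: Cauchy_convergent_iff convergent_def)
  then obtain g where g: "\<And>i. (\<lambda>n. seq (X n) i) \<longlonglongrightarrow> g i" by metis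
  have bound: "\<exists>M. \<forall>m\<ge>M. \<forall>k. (\<Sum>i<k. (norm (seq (X m) i - g i))\<^sup>2) \<le> e\<^sup>2" if "0 < e" for e
  proof -
    obtain M where M: "\<forall>m\<ge>M. \<forall>n\<ge>M. norm (X m - X n) < e"
      using CauchyD[OF X \<open>0 < e\<close>] by blast
    have "(\<Sum>i<k. (norm (seq (X m) i - g i))\<^sup>2) \<le> e\<^sup>2" if "m \<ge> M" for m k
    proof (rule LIMSEQ_le_const2)
      show "(\<lambda>n. \<Sum>i<k. (norm (seq (X m) i - seq (X n) i))\<^sup>2)
              \<longlonglongrightarrow> (\<Sum>i<k. (norm (seq (X m) i - g i))\<^sup>2)"
        by (intro tendsto_intros g)
      show "\<exists>N. \<forall>n\<ge>N. (\<Sum>i<k. (norm (seq (X m) i - seq (X n) i))\<^sup>2) \<le> e\<^sup>2"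
      proof (intro exI allI impI)
        fix n assume "M \<le> n"
        have "(\<Sum>i<k. (norm (seq (X m) i - seq (X n) i))\<^sup>2) \<le> (norm (X m - X n))\<^sup>2"
          using sum_seq_le_norm[of "X m - X n" k] by (simp add: seq_minus)
        also have "\<dots> \<le> e\<^sup>2"
          using M \<open>m \<ge> M\<close> \<open>M \<le> n\<close> by (intro power_mono) (auto intro: less_imp_le)
        finally show "(\<Sum>i<k. (norm (seq (X m) i - seq (X n) i))\<^sup>2) \<le> e\<^sup>2" .
      qed
    qed
    then show ?thesis by blast
  qed
  have summ: "summable (\<lambda>i. (norm (seq (X m) i - g i))\<^sup>2)"
    if "\<forall>k. (\<Sum>i<k. (norm (seq (X m) i - g i))\<^sup>2) \<le> e\<^sup>2" for m and e :: real
    by (rule bounded_imp_summable[of _ "e\<^sup>2"])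
       (use that in \<open>auto simp: lessThan_Suc_atMost[symmetric] simp del: sum.lessThan_Suc\<close>)
  obtain m where m: "\<forall>k. (\<Sum>i<k. (norm (seq (X m) i - g i))\<^sup>2) \<le> 1\<^sup>2"
    using bound[of 1] by auto
  have "summable (\<lambda>i. (norm (seq (X m) i + - (seq (X m) i - g i)))\<^sup>2)"
  proof (rule summable_sq_add)
    show "summable (\<lambda>i. (norm (seq (X m) i))\<^sup>2)" using seq[of "X m"] by simp
    show "summable (\<lambda>i. (norm (- (seq (X m) i - g i)))\<^sup>2)"
      using summ[OF m] by (simp only: norm_minus_cancel)
  qed
  then have "summable (\<lambda>i. (norm (g i))\<^sup>2)" by simp
  then have seq_G: "seq (Abs_ell2 g) = g" by (simp add: Abs_ell2_inverse)
  have "X \<longlonglongrightarrow> Abs_ell2 g"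
  proof (rule LIMSEQ_I)
    fix e :: real assume "0 < e"
    then obtain M where M: "\<forall>m\<ge>M. \<forall>k. (\<Sum>i<k. (norm (seq (X m) i - g i))\<^sup>2) \<le> (e / 2)\<^sup>2"
      using bound[of "e / 2"] by auto
    have "norm (X m - Abs_ell2 g) < e" if "m \<ge> M" for m
    proof -
      have "(norm (X m - Abs_ell2 g))\<^sup>2 = (\<Sum>i. (norm (seq (X m) i - g i))\<^sup>2)"
        by (simp add: power2_norm_eq_inner inner_ell2_def seq_minus seq_G)
      also have "\<dots> \<le> (e / 2)\<^sup>2"
        using M that by (intro suminf_le_const summ) auto
      finally have "norm (X m - Abs_ell2 g) \<le> e / 2"
        using \<open>0 < e\<close> by (simp add: power2_le_iff_abs_le)
      then show ?thesis using \<open>0 < e\<close> by simp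
    qed
    then show "\<exists>M. \<forall>m\<ge>M. norm (X m - Abs_ell2 g) < e" by blast
  qed
  then show "convergent X" by (auto simp: convergent_def)
qed

instantiation ell2 :: (chilbert) chilbert
begin
definition cinner_ell2 :: "'a ell2 \<Rightarrow> 'a ell2 \<Rightarrow> complex"
  where "cinner_ell2 f g = (\<Sum>i. cinner (seq f i) (seq g i))"

lemma summable_cinner_ell2: "summable (\<lambda>i. cinner (seq f i) (seq g i))"
  for f g :: "'a ell2"
proof (rule summable_comparison_test')
  show "summable (\<lambda>i. norm (seq f i) * norm (seq g i))"
    using seq[of f] seq[of g] by (intro summable_norm_mult) auto
  show "norm (cinner (seq f i) (seq g i)) \<le> norm (seq f i) * norm (seq g i)" for i
    by (rule norm_cinner_le)
qed

instance
proof
  fix f g h :: "'a ell2" and c :: complex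
  show "cinner f g = cnj (cinner g f)"
    using bounded_linear.suminf[OF bounded_linear_cnj summable_cinner_ell2[of g f]]
    by (simp add: cinner_ell2_def cinner_commute[of "seq f _"])
  show "cinner f (g + h) = cinner f g + cinner f h"
    by (simp add: cinner_ell2_def plus_ell2.rep_eq cinner_add_right suminf_add summable_cinner_ell2)
  show "cinner f (c *\<^sub>C g) = c * cinner f g"
    by (simp add: cinner_ell2_def scaleC_ell2.rep_eq cinner_scaleC_right suminf_mult summable_cinner_ell2)
  show "inner f g = Re (cinner f g)"
    using bounded_linear.suminf[OF bounded_linear_Re summable_cinner_ell2[of f g]]
    by (simp add: inner_ell2_def cinner_ell2_def inner_eq_Re_cinner)
qed
end


section \<open>Operators\<close>

text \<open>The library type of bounded operators is only real-linear; complex linearity is part of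
  \<open>bops\<close> below.\<close>

type_synonym 'a op = "'a \<Rightarrow>\<^sub>L 'a"

lemma bounded_linear_scaleC: "bounded_linear (\<lambda>x::'a::chilbert. c *\<^sub>C x)"
  by (rule bounded_linear_intro[of _ "cmod c"])
     (auto simp: scaleC_add_right norm_scaleC mult.commute scaleC_scaleC scaleC_of_real[symmetric])

instantiation blinfun :: (real_normed_vector, chilbert) complex_vector
begin
lift_definition scaleC_blinfun :: "complex \<Rightarrow> ('a \<Rightarrow>\<^sub>L 'b) \<Rightarrow> 'a \<Rightarrow>\<^sub>L 'b" is "\<lambda>c A x. c *\<^sub>C A x"
  using bounded_linear_compose bounded_linear_scaleC by blast
instance
  by standard
     (transfer; simp add: fun_eq_iff scaleC_add_right scaleC_add_left scaleC_scaleC scaleC_of_real)+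
end

text \<open>A Hilbert space is always given as \<open>eH\<close>, the range of a projection \<open>e\<close> on a space \<open>H\<close> whose
  underlying set is a whole type; \<open>e = id\<close> gives \<open>H\<close>. An operator on \<open>eH\<close> is identified with its
  extension by \<open>0\<close> to \<open>H\<close>, so that \<open>\<B>(eH) = e \<B>(H) e\<close> and \<open>Id = e\<close>. This accommodates
  \<open>\<complex>\<^sup>n\<close> for variable \<open>n\<close> and the algebras \<open>R\<M> \<subseteq> \<B>(RH)\<close>.\<close>

definition bops :: "'a::chilbert op \<Rightarrow> 'a op set" where
  "bops e = {A. e o\<^sub>L A = A \<and> A o\<^sub>L e = A \<and> (\<forall>c x. A (c *\<^sub>C x) = c *\<^sub>C A x)}"

definition adj :: "'a::chilbert op \<Rightarrow> 'a op" where
  "adj A = (THE B :: 'a op. \<forall>x y. cinner (A x) y = cinner x (B y))"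

definition projections :: "'a::chilbert op set \<Rightarrow> 'a op set" where
  "projections M = {P \<in> M. P o\<^sub>L P = P \<and> adj P = P}"

text \<open>\<open>\<Or>S\<close> is the projection onto the closed linear span of the ranges of the members of \<open>S\<close>.\<close>

definition proj_sup :: "'a::chilbert op set \<Rightarrow> 'a op" where
  "proj_sup S = (THE P. P \<in> projections (bops id_blinfun) \<and>
     range (blinfun_apply P) = closure (cvec.span (\<Union>Q\<in>S. range (blinfun_apply Q))))"

text \<open>The weak* topology, as the coarsest topology making the functionals
  \<open>A \<mapsto> \<Sum>k. \<langle>x\<^sub>k, A y\<^sub>k\<rangle>\<close> of the predual (the trace-class operators) continuous.
  The weak* topology of \<open>\<B>(eH)\<close> is the induced one.\<close>

definition weak_star :: "'a::chilbert op topology" where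
  "weak_star = topology_generated_by
     {{A :: 'a op. (\<Sum>k. cinner (x k) (A (y k))) \<in> U} | x y U.
        summable (\<lambda>k. (norm (x k))\<^sup>2) \<and> summable (\<lambda>k. (norm (y k))\<^sup>2) \<and> open U}"

definition commutant :: "'a::chilbert op \<Rightarrow> 'a op set \<Rightarrow> 'a op set" where
  "commutant e M = {A \<in> bops e. \<forall>B\<in>M. A o\<^sub>L B = B o\<^sub>L A}"

definition von_neumann_algebra :: "'a::chilbert op \<Rightarrow> 'a op set \<Rightarrow> bool" where
  "von_neumann_algebra e M \<longleftrightarrow>
     e \<in> projections (bops id_blinfun) \<and> M \<subseteq> bops e \<and> e \<in> M \<and> cvec.subspace M \<and>
     (\<forall>A\<in>M. \<forall>B\<in>M. A o\<^sub>L B \<in> M) \<and> (\<forall>A\<in>M. adj A \<in> M) \<and> closedin weak_star M"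

lift_definition tensor_vec :: "'a::chilbert \<Rightarrow> complex ell2 \<Rightarrow> 'a ell2" is "\<lambda>x f i. f i *\<^sub>C x"
  by (simp add: norm_scaleC power_mult_distrib summable_mult2)

definition tensor_op :: "'a::chilbert op \<Rightarrow> complex ell2 op \<Rightarrow> 'a ell2 op" (infixr \<open>\<otimes>\<^sub>o\<close> 70) where
  "A \<otimes>\<^sub>o B = (THE T :: 'a ell2 op. \<forall>x f. T (tensor_vec x f) = tensor_vec (A x) (B f))"

definition vn_tensor :: "'a::chilbert op set \<Rightarrow> 'a ell2 op set" where
  "vn_tensor M = weak_star closure_of
     cvec.span {A \<otimes>\<^sub>o B | A B. A \<in> M \<and> B \<in> bops id_blinfun}"


section \<open>Quantum metric spaces\<close>

text \<open>\<open>idn\<close> is the identity of the Hilbert space acted on (see \<open>bops\<close>); only the \<open>met X t\<close> with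
  \<open>t \<ge> 0\<close> are meaningful.\<close>

record (overloaded) ('a::chilbert) qspace =
  idn :: "'a \<Rightarrow>\<^sub>L 'a"
  alg :: "('a \<Rightarrow>\<^sub>L 'a) set"
  met :: "real \<Rightarrow> ('a \<Rightarrow>\<^sub>L 'a) set"

definition quantum_metric_space :: "'a::chilbert qspace \<Rightarrow> bool" where
  "quantum_metric_space X \<longleftrightarrow>
     von_neumann_algebra (idn X) (alg X) \<and>
     (\<forall>t\<ge>0. met X t \<subseteq> bops (idn X) \<and> cvec.subspace (met X t) \<and>
        closedin weak_star (met X t) \<and> (\<forall>A\<in>met X t. adj A \<in> met X t)) \<and>
     met X 0 = commutant (idn X) (alg X) \<and>
     (\<forall>s\<ge>0. \<forall>t\<ge>0. \<forall>A\<in>met X s. \<forall>B\<in>met X t. A o\<^sub>L B \<in> met X (s + t)) \<and>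
     (\<forall>t\<ge>0. met X t = (\<Inter>s\<in>{t<..}. met X s))"

definition reflexive_subspace :: "'a::chilbert op \<Rightarrow> 'a op set \<Rightarrow> bool" where
  "reflexive_subspace e V \<longleftrightarrow>
     V = {B \<in> bops e. \<forall>P\<in>projections (bops e). \<forall>Q\<in>projections (bops e).
            (\<forall>A\<in>V. P o\<^sub>L A o\<^sub>L Q = 0) \<longrightarrow> P o\<^sub>L B o\<^sub>L Q = 0}"

definition reflexive_qspace :: "'a::chilbert qspace \<Rightarrow> bool" where
  "reflexive_qspace X \<longleftrightarrow> (\<forall>t\<ge>0. reflexive_subspace (idn X) (met X t))"

definition qdist :: "'a::chilbert qspace \<Rightarrow> 'a ell2 op \<Rightarrow> 'a ell2 op \<Rightarrow> ennreal" where
  "qdist X P Q = Inf {ennreal t | t. 0 \<le> t \<and>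
     (\<exists>A\<in>met X t. P o\<^sub>L (A \<otimes>\<^sub>o id_blinfun) o\<^sub>L Q \<noteq> 0)}"

definition pdist :: "'a::chilbert qspace \<Rightarrow> 'a op \<Rightarrow> 'a op \<Rightarrow> ennreal" where
  "pdist X P Q = qdist X (P \<otimes>\<^sub>o id_blinfun) (Q \<otimes>\<^sub>o id_blinfun)"

definition qdiam :: "'a::chilbert qspace \<Rightarrow> 'a op \<Rightarrow> ennreal" where
  "qdiam X P = (if P = 0 then 0 else
     Sup {qdist X Q R | Q R.
            Q \<in> projections (vn_tensor (alg X)) \<and> R \<in> projections (vn_tensor (alg X)) \<and>
            (\<exists>A\<in>bops (idn X). Q o\<^sub>L ((P o\<^sub>L A o\<^sub>L P) \<otimes>\<^sub>o id_blinfun) o\<^sub>L R \<noteq> 0)})"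

definition nbhd :: "'a::chilbert qspace \<Rightarrow> real \<Rightarrow> 'a op \<Rightarrow> 'a op" where
  "nbhd X \<delta> P = idn X - proj_sup {Q \<in> projections (alg X). ennreal \<delta> \<le> pdist X P Q}"


section \<open>Quantum functions and coarse embeddings\<close>

definition star_hom :: "'a::chilbert op set \<Rightarrow> 'b::chilbert op set \<Rightarrow> ('a op \<Rightarrow> 'b op) \<Rightarrow> bool" where
  "star_hom M N \<phi> \<longleftrightarrow>
     (\<forall>A\<in>M. \<phi> A \<in> N) \<and>
     (\<forall>A\<in>M. \<forall>B\<in>M. \<phi> (A + B) = \<phi> A + \<phi> B) \<and>
     (\<forall>c. \<forall>A\<in>M. \<phi> (c *\<^sub>C A) = c *\<^sub>C \<phi> A) \<and>
     (\<forall>A\<in>M. \<forall>B\<in>M. \<phi> (A o\<^sub>L B) = \<phi> A o\<^sub>L \<phi> B) \<and>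
     (\<forall>A\<in>M. \<phi> (adj A) = adj (\<phi> A))"

definition quantum_function ::
  "'a::chilbert qspace \<Rightarrow> 'b::chilbert qspace \<Rightarrow> ('a op \<Rightarrow> 'b op) \<Rightarrow> bool" where
  "quantum_function X Y \<phi> \<longleftrightarrow>
     star_hom (alg X) (alg Y) \<phi> \<and> \<phi> (idn X) = idn Y \<and>
     continuous_map (subtopology weak_star (alg X)) (subtopology weak_star (alg Y)) \<phi>"

definition omega ::
  "'a::chilbert qspace \<Rightarrow> 'b::chilbert qspace \<Rightarrow> ('a op \<Rightarrow> 'b op) \<Rightarrow> real \<Rightarrow> ennreal" where
  "omega X Y \<phi> t = Inf {pdist Y (\<phi> P) (\<phi> Q) | P Q.
     P \<in> projections (alg X) \<and> Q \<in> projections (alg X) \<and> ennreal t \<le> pdist X P Q}"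

definition rho ::
  "'a::chilbert qspace \<Rightarrow> 'b::chilbert qspace \<Rightarrow> ('a op \<Rightarrow> 'b op) \<Rightarrow> real \<Rightarrow> ennreal" where
  "rho X Y \<phi> t = Sup {qdiam Y (\<phi> P) | P. P \<in> projections (alg X) \<and> qdiam X P \<le> ennreal t}"

definition quantum_coarse_embedding ::
  "'a::chilbert qspace \<Rightarrow> 'b::chilbert qspace \<Rightarrow> ('a op \<Rightarrow> 'b op) \<Rightarrow> bool" where
  "quantum_coarse_embedding X Y \<phi> \<longleftrightarrow>
     quantum_function X Y \<phi> \<and> (omega X Y \<phi> \<longlongrightarrow> \<infinity>) at_top \<and> (\<forall>t\<ge>0. rho X Y \<phi> t < \<infinity>)"

definition equi_coarse ::
  "'a::chilbert qspace \<Rightarrow> ('i \<Rightarrow> 'b::chilbert qspace) \<Rightarrow> ('i \<Rightarrow> 'a op \<Rightarrow> 'b op) \<Rightarrow> bool" where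
  "equi_coarse X Y \<phi> \<longleftrightarrow>
     (\<forall>i. quantum_coarse_embedding X (Y i) (\<phi> i)) \<and>
     (\<exists>f g :: real \<Rightarrow> ennreal. (f \<longlongrightarrow> \<infinity>) at_top \<and> (\<forall>t\<ge>0. g t < \<infinity>) \<and>
        (\<forall>i. \<forall>t\<ge>0. f t \<le> omega X (Y i) (\<phi> i) t \<and> rho X (Y i) (\<phi> i) t \<le> g t))"


section \<open>Asymptotic dimension\<close>

definition r_disjoint :: "'a::chilbert qspace \<Rightarrow> real \<Rightarrow> 'a op set \<Rightarrow> bool" where
  "r_disjoint X r \<P> \<longleftrightarrow> (\<forall>P\<in>\<P>. \<forall>Q\<in>\<P>. P \<noteq> Q \<longrightarrow> nbhd X r P o\<^sub>L nbhd X r Q = 0)"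

definition uniformly_bounded :: "'a::chilbert qspace \<Rightarrow> 'a op set \<Rightarrow> bool" where
  "uniformly_bounded X \<P> \<longleftrightarrow> (\<exists>R>0. (SUP P\<in>\<P>. qdiam X P) \<le> ennreal R)"

definition is_cover :: "'a::chilbert qspace \<Rightarrow> 'a op set \<Rightarrow> bool" where
  "is_cover X \<P> \<longleftrightarrow> proj_sup \<P> = idn X"

definition asdim_le :: "'a::chilbert qspace \<Rightarrow> nat \<Rightarrow> bool" where
  "asdim_le X n \<longleftrightarrow>
     (\<forall>r>0. \<exists>\<P> :: nat \<Rightarrow> 'a op set.
        (\<forall>i\<le>n. \<P> i \<subseteq> projections (alg X) \<and> uniformly_bounded X (\<P> i) \<and> r_disjoint X r (\<P> i)) \<and>
        is_cover X (\<Union>i\<le>n. \<P> i))"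

definition asdim :: "'a::chilbert qspace \<Rightarrow> enat" where
  "asdim X = Inf {enat n | n. asdim_le X n}"


section \<open>Quantum expanders\<close>

text \<open>\<open>\<complex>\<^sup>n\<close> is the span of the first \<open>n\<close> unit vectors of \<open>\<ell>\<^sub>2\<close>, and \<open>M\<^sub>n = \<B>(\<complex>\<^sup>n)\<close>.\<close>

lift_definition ket :: "nat \<Rightarrow> complex ell2" is "\<lambda>j i. if i = j then 1 else 0"
  subgoal for j by (rule summable_finite[of "{j}"]) auto
  done

lift_definition trunc :: "nat \<Rightarrow> complex ell2 \<Rightarrow> complex ell2" is "\<lambda>n f i. if i < n then f i else 0"
  subgoal for n f by (rule summable_finite[of "{..<n}"]) auto
  done

lift_definition one_mat :: "nat \<Rightarrow> complex ell2 op" is trunc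
proof -
  fix n
  have "norm (trunc n f) \<le> norm f" for f
    unfolding norm_ell2_def inner_ell2_def
    by (intro real_sqrt_le_mono suminf_le summable_inner_ell2) (simp add: trunc.rep_eq)
  then show "bounded_linear (trunc n)"
    by (intro bounded_linear_intro[of _ 1])
       (auto simp: seq_inject[symmetric] fun_eq_iff trunc.rep_eq plus_ell2.rep_eq scaleR_ell2.rep_eq)
qed

definition mats :: "nat \<Rightarrow> complex ell2 op set" where
  "mats n = bops (one_mat n)"

definition entry :: "complex ell2 op \<Rightarrow> nat \<Rightarrow> nat \<Rightarrow> complex" where
  "entry A i j = cinner (ket i) (A (ket j))"

definition mtrace :: "nat \<Rightarrow> complex ell2 op \<Rightarrow> complex" where
  "mtrace n A = (\<Sum>i<n. entry A i i)"

definition hs_norm :: "nat \<Rightarrow> complex ell2 op \<Rightarrow> real" where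
  "hs_norm n A = sqrt (\<Sum>i<n. \<Sum>j<n. (cmod (entry A i j))\<^sup>2)"

text \<open>An element of \<open>M\<^sub>k \<otimes> M\<^sub>n\<close> is a \<open>k \<times> k\<close> block matrix over \<open>M\<^sub>n\<close>; the map
  \<open>id \<otimes> \<Phi>\<close> acts blockwise.\<close>

definition psd_block :: "nat \<Rightarrow> (nat \<Rightarrow> nat \<Rightarrow> complex ell2 op) \<Rightarrow> bool" where
  "psd_block k X \<longleftrightarrow>
     (\<forall>v :: nat \<Rightarrow> complex ell2. (\<Sum>a<k. \<Sum>b<k. cinner (v a) (X a b (v b))) \<in> \<real>\<^sub>\<ge>\<^sub>0)"

definition completely_positive :: "nat \<Rightarrow> (complex ell2 op \<Rightarrow> complex ell2 op) \<Rightarrow> bool" where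
  "completely_positive n \<Phi> \<longleftrightarrow>
     (\<forall>k X. (\<forall>a<k. \<forall>b<k. X a b \<in> mats n) \<longrightarrow> psd_block k X \<longrightarrow> psd_block k (\<lambda>a b. \<Phi> (X a b)))"

definition cptp :: "nat \<Rightarrow> (complex ell2 op \<Rightarrow> complex ell2 op) \<Rightarrow> bool" where
  "cptp n \<Phi> \<longleftrightarrow>
     (\<forall>X\<in>mats n. \<Phi> X \<in> mats n) \<and>
     (\<forall>X\<in>mats n. \<forall>Y\<in>mats n. \<Phi> (X + Y) = \<Phi> X + \<Phi> Y) \<and>
     (\<forall>c. \<forall>X\<in>mats n. \<Phi> (c *\<^sub>C X) = c *\<^sub>C \<Phi> X) \<and>
     completely_positive n \<Phi> \<and> (\<forall>X\<in>mats n. mtrace n (\<Phi> X) = mtrace n X)"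

definition spectral_gap :: "real \<Rightarrow> nat \<Rightarrow> (complex ell2 op \<Rightarrow> complex ell2 op) \<Rightarrow> bool" where
  "spectral_gap \<epsilon> n \<Phi> \<longleftrightarrow>
     (\<forall>X\<in>mats n. hs_norm n (\<Phi> X - (mtrace n X / of_nat n) *\<^sub>C one_mat n)
        \<le> (1 - \<epsilon>) * hs_norm n (X - (mtrace n X / of_nat n) *\<^sub>C one_mat n))"

definition unitary_mat :: "nat \<Rightarrow> complex ell2 op \<Rightarrow> bool" where
  "unitary_mat n U \<longleftrightarrow> U \<in> mats n \<and> U o\<^sub>L adj U = one_mat n \<and> adj U o\<^sub>L U = one_mat n"

definition quantum_expander ::
  "nat \<Rightarrow> real \<Rightarrow> nat \<Rightarrow> (complex ell2 op \<Rightarrow> complex ell2 op) \<Rightarrow> bool" where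
  "quantum_expander d \<epsilon> n \<Phi> \<longleftrightarrow>
     0 < n \<and> cptp n \<Phi> \<and> spectral_gap \<epsilon> n \<Phi> \<and>
     (\<exists>U. (\<forall>j<d. unitary_mat n (U j)) \<and>
        (\<forall>X\<in>mats n. \<Phi> X = (1 / of_nat d) *\<^sub>C (\<Sum>j<d. U j o\<^sub>L X o\<^sub>L adj (U j))))"

definition expander_sequence ::
  "nat \<Rightarrow> real \<Rightarrow> (nat \<Rightarrow> nat) \<Rightarrow> (nat \<Rightarrow> complex ell2 op \<Rightarrow> complex ell2 op) \<Rightarrow> bool" where
  "expander_sequence d \<epsilon> n \<Phi> \<longleftrightarrow>
     (\<forall>m. quantum_expander d \<epsilon> (n m) (\<Phi> m)) \<and> filterlim n at_top sequentially"

definition kraus_rep ::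
  "nat \<Rightarrow> nat \<Rightarrow> (nat \<Rightarrow> complex ell2 op) \<Rightarrow> (complex ell2 op \<Rightarrow> complex ell2 op) \<Rightarrow> bool" where
  "kraus_rep n N K \<Phi> \<longleftrightarrow>
     (\<forall>j<N. K j \<in> mats n) \<and> (\<forall>X\<in>mats n. \<Phi> X = (\<Sum>j<N. K j o\<^sub>L X o\<^sub>L adj (K j)))"

text \<open>The span of all \<open>k\<close>-fold products; for \<open>k = 0\<close> the only product is the empty one, the identity.\<close>

definition span_power :: "nat \<Rightarrow> complex ell2 op set \<Rightarrow> nat \<Rightarrow> complex ell2 op set" where
  "span_power n V k = cvec.span {foldr (o\<^sub>L) As (one_mat n) | As. length As = k \<and> set As \<subseteq> V}"

text \<open>As \<open>\<V>\<^sub>1\<^sup>0 = \<complex>I\<^sub>n\<close>, the clause for \<open>t > 0\<close> also gives \<open>\<V>\<^sub>0\<close>.\<close>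

definition kraus_qspace :: "nat \<Rightarrow> nat \<Rightarrow> (nat \<Rightarrow> complex ell2 op) \<Rightarrow> complex ell2 qspace" where
  "kraus_qspace n N K =
     \<lparr>idn = one_mat n, alg = mats n,
      met = (\<lambda>t. span_power n (cvec.span {adj (K j) o\<^sub>L K i | i j. i < N \<and> j < N}) (nat \<lfloor>t\<rfloor>))\<rparr>"

text \<open>The quantum metric does not depend on the Kraus operators; a relation avoids having to
  choose them.\<close>

definition induced_qspace ::
  "nat \<Rightarrow> (complex ell2 op \<Rightarrow> complex ell2 op) \<Rightarrow> complex ell2 qspace \<Rightarrow> bool" where
  "induced_qspace n \<Phi> Y \<longleftrightarrow> (\<exists>N K. kraus_rep n N K \<Phi> \<and> Y = kraus_qspace n N K)"


section \<open>Metric quotients\<close>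

definition central_projection :: "'a::chilbert qspace \<Rightarrow> 'a op \<Rightarrow> bool" where
  "central_projection X R \<longleftrightarrow>
     R \<in> projections (alg X) \<and> (\<forall>A\<in>alg X. R o\<^sub>L A = A o\<^sub>L R)"

definition metric_quotient :: "'a::chilbert qspace \<Rightarrow> 'a op \<Rightarrow> 'a qspace" where
  "metric_quotient X R =
     \<lparr>idn = R, alg = (\<lambda>A. R o\<^sub>L A) ` alg X, met = (\<lambda>t. (\<lambda>A. R o\<^sub>L A o\<^sub>L R) ` met X t)\<rparr>"

definition star_iso :: "'a::chilbert op set \<Rightarrow> 'b::chilbert op set \<Rightarrow> ('a op \<Rightarrow> 'b op) \<Rightarrow> bool" where
  "star_iso M N \<theta> \<longleftrightarrow> star_hom M N \<theta> \<and>
     homeomorphic_map (subtopology weak_star M) (subtopology weak_star N) \<theta>"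

text \<open>\<open>\<Theta>\<close> is the amplification \<open>\<theta> \<otimes> Id\<close>; being weak*-continuous, it is determined by its
  values on elementary tensors.\<close>

definition qspace_iso :: "'a::chilbert qspace \<Rightarrow> 'b::chilbert qspace \<Rightarrow> bool" where
  "qspace_iso X Y \<longleftrightarrow>
     (\<exists>\<theta> \<Theta>. star_iso (alg X) (alg Y) \<theta> \<and>
        star_iso (vn_tensor (alg X)) (vn_tensor (alg Y)) \<Theta> \<and>
        (\<forall>A\<in>alg X. \<forall>B\<in>bops id_blinfun. \<Theta> (A \<otimes>\<^sub>o B) = \<theta> A \<otimes>\<^sub>o B) \<and>
        (\<forall>P\<in>projections (vn_tensor (alg X)). \<forall>Q\<in>projections (vn_tensor (alg X)).
           qdist Y (\<Theta> P) (\<Theta> Q) = qdist X P Q))"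

end

(* Suppose asdim(M) <= N and put C = N + 2. Pull the covers of M to M_n by the quantum functions: they
   stay covers because a quantum function respects suprema of projections. By reflexivity a projection P of
   M_n of diameter at most T satisfies P M_n P <= V_t for t > T, so its rank is at most d^(2t), independently
   of n. If Phi has an eps-gap, Psi = Phi^* Phi contracts traceless matrices by (1-eps)^2, and the
   range of Psi^k P lies in the k-neighbourhood E of P, so Cauchy-Schwarz for tr(E Psi^k P) = tr P gives
   (rank P)^2 <= rank E ((1-eps)^(4k) rank P + (rank P)^2 / n). For k and then n large this is rank E >= C rank P.
   Disjointness of neighbourhoods bounds the total rank of each of the N + 1 families by n / C,
   and these families cannot cover. For metric quotients the quantum functions are A |-> theta(R A); they
   shrink no distance and enlarge no diameter. *)

theory Submission
  imports Defs
begin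

section \<open>Hilbert space operators\<close>

text \<open>The constants have to be chosen in one order: \<open>k\<close> from \<open>N\<close> and
  \<epsilon>, then \<open>r\<close> from \<open>k\<close>, then the cover, then a diameter bound and
  with it a rank bound, and only then the expander. The rank bound must therefore not involve
  \<open>n\<close>, which is why it counts words of bounded length in at most \<open>d^2\<close>
  generators, applied to one vector. For this count the metric, which may be given by any Kraus
  family, is rewritten with the \<open>d\<close> scaled unitaries; hence the comparison of Kraus
  families. The map \<open>Phi^* Phi\<close> replaces \<open>Phi\<close> because the metric is built
  from the products \<open>K_j^* K_i\<close>, and these are the Kraus operators of the composite,
  not of \<open>Phi\<close>. The functional-analytic obstacle is that suprema of projections are
  formed on the Hilbert space, whereas the homomorphism sees only the algebra. Both uses of suprema,
  in covers and in neighbourhoods, reduce to one statement: the \<open>A\<close> with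
  \<open>\<phi> A x = 0\<close> form a weak*-closed left ideal, and such an ideal contains the
  supremum of any set of its projections.\<close>

global_interpretation cinner: bounded_bilinear "cinner :: 'a::chilbert \<Rightarrow> 'a \<Rightarrow> complex"
proof
  fix r :: real and x y z :: 'a
  show "cinner (x + y) z = cinner x z + cinner y z" by (rule cinner_add_left)
  show "cinner x (y + z) = cinner x y + cinner x z" by (rule cinner_add_right)
  show "cinner (r *\<^sub>R x) y = r *\<^sub>R cinner x y"
    by (metis scaleC_of_real cinner_scaleC_left complex_cnj_complex_of_real scaleR_conv_of_real)
  show "cinner x (r *\<^sub>R y) = r *\<^sub>R cinner x y"
    by (metis scaleC_of_real cinner_scaleC_right scaleR_conv_of_real)
  show "\<exists>K. \<forall>x y :: 'a. norm (cinner x y) \<le> norm x * norm y * K"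
    by (rule exI[of _ 1]) (simp add: norm_cinner_le)
qed

lemma cinner_self_eq_0_iff [simp]: "cinner x x = 0 \<longleftrightarrow> x = (0::'a::chilbert)"
  by (simp add: cinner_self)

lemma cinner_ext: "(\<And>z. cinner z x = cinner z y) \<Longrightarrow> x = (y::'a::chilbert)"
  by (metis cinner.diff_right cinner_self_eq_0_iff right_minus_eq)

lemma cinner_eq_0_commute: "cinner x y = 0 \<longleftrightarrow> cinner y (x::'a::chilbert) = 0"
  by (metis cinner_commute complex_cnj_zero)

section \<open>Nearest points in closed subspaces and the Riesz representation\<close>

lemma subspace_if_cvec_subspace:
  assumes "cvec.subspace L"
  shows "subspace (L :: 'a::complex_vector set)"
  using assms unfolding cvec.subspace_def subspace_def
  by (metis scaleC_of_real)

text \<open>The parallelogram law turns a minimising sequence for the distance to \<open>y\<close>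
  into a Cauchy sequence, and comparing its limit with perturbations along a vector of
  \<open>L\<close> gives orthogonality. Only the real inner product is involved, so the complex case
  takes a further argument.\<close>

lemma closed_subspace_projection:
  fixes L :: "'a::{real_inner,complete_space} set"
  assumes L: "subspace L" "closed L"
  obtains u where "u \<in> L" "\<And>v. v \<in> L \<Longrightarrow> inner v (y - u) = 0"
proof -
  define D where "D = infdist y L"
  have ne: "L \<noteq> {}" using L(1) subspace_0 by blast
  have D: "D \<le> norm (y - v)" if "v \<in> L" for v
    using infdist_le[OF that, of y] by (simp add: D_def dist_norm)
  have "\<exists>v\<in>L. norm (y - v) < D + inverse (real (Suc k))" for k
  proof -
    have "(INF v\<in>L. dist y v) < D + inverse (real (Suc k))"
      using ne by (simp add: D_def infdist_notempty)
    then show ?thesis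
      using cInf_lessD[of "dist y ` L" "D + inverse (real (Suc k))"] ne by (auto simp: dist_norm)
  qed
  then obtain v where v: "\<And>k. v k \<in> L" "\<And>k. norm (y - v k) < D + inverse (real (Suc k))"
    by metis
  have lim: "(\<lambda>k. norm (y - v k)) \<longlonglongrightarrow> D"
  proof (rule tendsto_sandwich[of "\<lambda>_. D" _ _ "\<lambda>k. D + inverse (real (Suc k))"])
    show "(\<lambda>k. D + inverse (real (Suc k))) \<longlonglongrightarrow> D"
      using tendsto_add[OF tendsto_const LIMSEQ_inverse_real_of_nat, of D] by simp
    show "\<forall>\<^sub>F k in sequentially. norm (y - v k) \<le> D + inverse (real (Suc k))"
      using v(2) by (intro always_eventually allI less_imp_le)
    show "\<forall>\<^sub>F k in sequentially. D \<le> norm (y - v k)" by (simp add: D v(1))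
  qed simp
  \<comment> \<open>The midpoint of \<open>v j\<close> and \<open>v k\<close> lies in
    \<open>L\<close>, so its distance to \<open>y\<close> is at least \<open>D\<close>.\<close>
  have par: "(norm (v j - v k))\<^sup>2 \<le> 2 * (norm (y - v j))\<^sup>2 + 2 * (norm (y - v k))\<^sup>2 - 4 * D\<^sup>2" for j k
  proof -
    have "D\<^sup>2 \<le> (norm (y - (1/2) *\<^sub>R (v j + v k)))\<^sup>2"
      by (intro power_mono D) (use L v infdist_nonneg in
          \<open>auto simp: D_def intro: subspace_scale subspace_add\<close>)
    moreover have "(norm (v j - v k))\<^sup>2 + 4 * (norm (y - (1/2) *\<^sub>R (v j + v k)))\<^sup>2
        = 2 * (norm (y - v j))\<^sup>2 + 2 * (norm (y - v k))\<^sup>2"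
      by (simp add: power2_norm_eq_inner inner_simps inner_commute algebra_simps)
    ultimately show ?thesis by linarith
  qed
  have lim2: "(\<lambda>k. 2 * (norm (y - v k))\<^sup>2 - 2 * D\<^sup>2) \<longlonglongrightarrow> 2 * D\<^sup>2 - 2 * D\<^sup>2"
    by (intro tendsto_intros lim)
  have "Cauchy v"
  proof (rule metric_CauchyI)
    fix e :: real assume "0 < e"
    then have "0 < e\<^sup>2 / 2" by simp
    then have "\<forall>\<^sub>F k in sequentially. 2 * (norm (y - v k))\<^sup>2 - 2 * D\<^sup>2 < e\<^sup>2 / 2"
      using order_tendstoD(2)[OF lim2, of "e\<^sup>2 / 2"] by simp
    then obtain K where K: "\<And>k. k \<ge> K \<Longrightarrow> 2 * (norm (y - v k))\<^sup>2 - 2 * D\<^sup>2 < e\<^sup>2 / 2"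
      by (auto simp: eventually_sequentially)
    have "dist (v j) (v k) < e" if "j \<ge> K" "k \<ge> K" for j k
    proof -
      have "(norm (v j - v k))\<^sup>2 < e\<^sup>2" using par[of j k] K[OF that(1)] K[OF that(2)] by linarith
      then show ?thesis using \<open>0 < e\<close> by (simp add: dist_norm power_less_imp_less_base)
    qed
    then show "\<exists>M. \<forall>m\<ge>M. \<forall>n\<ge>M. dist (v m) (v n) < e" by blast
  qed
  then obtain u where u: "v \<longlonglongrightarrow> u" using Cauchy_convergent_iff convergent_def by blast
  have uL: "u \<in> L" using closed_sequentially[OF L(2) _ u] v by blast
  have "(\<lambda>k. norm (y - v k)) \<longlonglongrightarrow> norm (y - u)" by (intro tendsto_intros u)
  then have yu: "norm (y - u) = D" using lim LIMSEQ_unique by blast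
  have "inner w (y - u) = 0" if w: "w \<in> L" for w
  proof (cases "w = 0")
    case False
    \<comment> \<open>This \<open>t\<close> minimises the distance from \<open>y\<close> to
      \<open>u + t *\<^sub>R w\<close>; a nonzero inner product would bring that distance below
      \<open>D\<close>.\<close>
    define t where "t = inner w (y - u) / inner w w"
    have "u + t *\<^sub>R w \<in> L" using L uL w by (simp add: subspace_add subspace_scale)
    then have "(norm (y - u))\<^sup>2 \<le> (norm (y - (u + t *\<^sub>R w)))\<^sup>2"
      unfolding yu using D infdist_nonneg[of y L] by (intro power_mono) (simp_all add: D_def)
    also have "\<dots> = (norm (y - u))\<^sup>2 - 2 * t * inner w (y - u) + t\<^sup>2 * inner w w"
      unfolding power2_norm_eq_inner
      by (simp add: inner_simps inner_commute algebra_simps power2_eq_square)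
    also have "\<dots> = (norm (y - u))\<^sup>2 - (inner w (y - u))\<^sup>2 / inner w w"
      using False by (simp add: t_def field_simps power2_eq_square)
    finally have "(inner w (y - u))\<^sup>2 / inner w w \<le> 0" by simp
    then show ?thesis using False
      by (smt (verit) divide_pos_pos inner_gt_zero_iff zero_less_power2)
  qed simp
  with uL that show ?thesis by blast
qed

text \<open>Real orthogonality to \<open>L\<close> controls real parts only. Since \<open>L\<close>
  is closed under multiplication by the imaginary unit, testing with \<open>\<i> *\<^sub>C v\<close>
  controls the imaginary parts as well.\<close>

lemma orthogonal_decomposition:
  fixes L :: "'a::chilbert set"
  assumes L: "cvec.subspace L" "closed L"
  obtains u where "u \<in> L" "\<And>v. v \<in> L \<Longrightarrow> cinner v (y - u) = 0"
proof -
  obtain u where u: "u \<in> L" "\<And>v. v \<in> L \<Longrightarrow> inner v (y - u) = 0"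
    using closed_subspace_projection[OF subspace_if_cvec_subspace[OF L(1)] L(2)] by blast
  have "cinner v (y - u) = 0" if "v \<in> L" for v
  proof (rule complex_eqI)
    show "Re (cinner v (y - u)) = Re 0" using u(2)[OF that] by (simp add: inner_eq_Re_cinner)
    have "\<i> *\<^sub>C v \<in> L" using L that by (simp add: cvec.subspace_scale)
    from u(2)[OF this] show "Im (cinner v (y - u)) = Im 0"
      by (simp add: inner_eq_Re_cinner cinner_scaleC_left)
  qed
  with u that show ?thesis by blast
qed

text \<open>The kernel of a nonzero functional has codimension one: with \<open>w\<close> orthogonal
  to it, every \<open>x\<close> differs from a multiple of \<open>w\<close> by an element of the
  kernel.\<close>

lemma riesz_representation:
  fixes f :: "'a::chilbert \<Rightarrow> complex"
  assumes f: "bounded_linear f" and fC: "\<And>c x. f (c *\<^sub>C x) = c * f x"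
  obtains v where "\<And>x. f x = cinner v x"
proof (cases "\<forall>x. f x = 0")
  case True
  then show ?thesis using that[of 0] by (simp add: cinner.zero_left)
next
  case False
  interpret f: bounded_linear f by fact
  define L where "L = f -` {0}"
  have "cvec.subspace L"
    by (auto simp: cvec.subspace_def L_def f.zero f.add fC)
  moreover have "closed L"
    unfolding L_def by (intro continuous_closed_vimage closed_singleton)
      (simp add: f.isCont)
  moreover obtain y where y: "f y \<noteq> 0" using False by blast
  ultimately obtain u where u: "u \<in> L" "\<And>v. v \<in> L \<Longrightarrow> cinner v (y - u) = 0"
    using orthogonal_decomposition by blast
  define w where "w = y - u"
  have fw: "f w \<noteq> 0" using u y by (simp add: w_def L_def f.diff)
  have w0: "w \<noteq> 0" using fw f.zero by auto
  have "f x = cinner ((cnj (f w) / cinner w w) *\<^sub>C w) x" for x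
  proof -
    have "x - (f x / f w) *\<^sub>C w \<in> L" using fw by (simp add: L_def f.diff fC)
    then have "cinner w (x - (f x / f w) *\<^sub>C w) = 0"
      using u(2) cinner_eq_0_commute unfolding w_def by blast
    then have "cinner w x = (f x / f w) * cinner w w"
      by (simp add: cinner.diff_right cinner_scaleC_right)
    moreover have "cnj (cinner w w) = cinner w w" by (simp add: cinner_self)
    ultimately show ?thesis using fw w0 by (simp add: cinner_scaleC_left)
  qed
  with that show ?thesis by blast
qed

section \<open>Adjoints of complex-linear operators\<close>

lemma bops_id_iff: "A \<in> bops id_blinfun \<longleftrightarrow> (\<forall>c x. A (c *\<^sub>C x) = c *\<^sub>C A x)"
  by (auto simp: bops_def blinfun_eqI)

lemma bops_scaleC: "A \<in> bops e \<Longrightarrow> A (c *\<^sub>C x) = c *\<^sub>C A x"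
  by (simp add: bops_def)

lemma bops_imp_bops_id: "A \<in> bops e \<Longrightarrow> A \<in> bops id_blinfun"
  by (simp add: bops_id_iff bops_scaleC)

lemma adj_eqI:
  fixes A B :: "'a::chilbert op"
  shows "(\<And>x y. cinner (A x) y = cinner x (B y)) \<Longrightarrow> adj A = B"
  unfolding adj_def
proof (rule the_equality)
  assume *: "\<And>x y. cinner (A x) y = cinner x (B y)"
  then show "\<forall>x y. cinner (A x) y = cinner x (B y)" by blast
  show "C = B" if "\<forall>x y. cinner (A x) y = cinner x (C y)" for C :: "'a op"
    by (rule blinfun_eqI, rule cinner_ext) (metis * that)
qed

text \<open>\<open>adj\<close> is a definite description, so it is of use only once an adjoint
  exists. Riesz representation asks for complex linearity, hence the condition
  \<open>A \<in> bops id_blinfun\<close> here and in most later facts about adjoints.\<close>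

lemma adj_exists:
  assumes "A \<in> bops id_blinfun"
  obtains B where "\<And>x y. cinner (A x) y = cinner x (blinfun_apply B y)"
proof -
  have "\<exists>v. \<forall>x. cinner y (A x) = cinner v x" for y
  proof -
    have "bounded_linear (\<lambda>x. cinner y (A x))"
      by (rule bounded_linear_compose[OF cinner.bounded_linear_right blinfun.bounded_linear_right])
    from riesz_representation[OF this] assms show ?thesis
      by (metis bops_id_iff cinner_scaleC_right)
  qed
  then obtain b where b: "\<And>x y. cinner y (A x) = cinner (b y) x" by metis
  have b': "cinner (A x) y = cinner x (b y)" for x y
    by (metis b cinner_commute)
  have "bounded_linear b"
  proof (rule bounded_linear_intro[of _ "norm A"])
    show "b (x + y) = b x + b y" for x y
      by (rule cinner_ext) (simp add: b'[symmetric] cinner_add_right)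
    show "b (r *\<^sub>R x) = r *\<^sub>R b x" for r x
      by (rule cinner_ext) (simp add: b'[symmetric] cinner.scaleR_right)
    fix x
    have "(norm (b x))\<^sup>2 = cmod (cinner (A (b x)) x)"
      unfolding b' cinner_self by (simp add: norm_power)
    also have "\<dots> \<le> norm (A (b x)) * norm x" by (rule norm_cinner_le)
    also have "\<dots> \<le> norm A * norm (b x) * norm x"
      by (intro mult_right_mono norm_blinfun) simp
    finally have "norm (b x) * norm (b x) \<le> norm (b x) * (norm x * norm A)"
      by (simp add: power2_eq_square mult_ac)
    then show "norm (b x) \<le> norm x * norm A"
      by (metis mult_le_cancel_left_pos mult_nonneg_nonneg norm_ge_zero order_le_less)
  qed
  then show ?thesis using that[of "Blinfun b"] b' by (simp add: bounded_linear_Blinfun_apply)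
qed

lemma cinner_adj:
  assumes "A \<in> bops id_blinfun"
  shows "cinner (A x) y = cinner x (adj A y)" and "cinner x (A y) = cinner (adj A x) y"
proof -
  obtain B where B: "\<And>x y. cinner (A x) y = cinner x (blinfun_apply B y)"
    using adj_exists[OF assms] by blast
  then have "adj A = B" by (rule adj_eqI)
  with B show *: "cinner (A x) y = cinner x (adj A y)" for x y by simp
  show "cinner x (A y) = cinner (adj A x) y" by (metis * cinner_commute)
qed

lemma adj_in_bops_id: "A \<in> bops id_blinfun \<Longrightarrow> adj A \<in> bops id_blinfun"
  unfolding bops_id_iff[of "adj A"]
  by (intro allI, rule cinner_ext) (simp add: cinner_scaleC_right cinner_adj(1)[symmetric])

lemma adj_adj: "A \<in> bops id_blinfun \<Longrightarrow> adj (adj A) = A"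
  by (rule adj_eqI) (simp add: cinner_adj)

lemma adj_compose:
  "A \<in> bops id_blinfun \<Longrightarrow> B \<in> bops id_blinfun \<Longrightarrow> adj (A o\<^sub>L B) = adj B o\<^sub>L adj A"
  by (rule adj_eqI) (simp add: cinner_adj)

lemma bops_id_compose: "A \<in> bops id_blinfun \<Longrightarrow> B \<in> bops id_blinfun \<Longrightarrow> A o\<^sub>L B \<in> bops id_blinfun"
  by (simp add: bops_id_iff)

lemma adj_zero [simp]: "adj (0 :: 'a::chilbert op) = 0"
  by (rule adj_eqI) (simp add: cinner.zero_left cinner.zero_right)

lemma scaleC_blinfun_apply [simp]: "(c *\<^sub>C A) x = c *\<^sub>C (A x)"
  for A :: "'a::real_normed_vector \<Rightarrow>\<^sub>L 'b::chilbert"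
  by (simp add: scaleC_blinfun.rep_eq)

lemma subspace_bops: "cvec.subspace (bops e)"
  by (auto simp: cvec.subspace_def bops_def scaleC_add_right scaleC_scaleC mult.commute
      blinfun.bilinear_simps intro!: blinfun_eqI)
    (metis blinfun_apply_blinfun_compose)+

section \<open>Projections, their ranges and their suprema\<close>

lemma projection_bops_id: "P \<in> projections (bops e) \<Longrightarrow> P \<in> projections (bops id_blinfun)"
  by (auto simp: projections_def dest: bops_imp_bops_id)

lemma projection_apply:
  assumes "P \<in> projections (bops e)"
  shows "P (P x) = P x" and "cinner (P x) y = cinner x (P y)"
    and "cinner (P x) (P x) = cinner x (P x)"
proof -
  show 1: "P (P x) = P x" for x
    using assms by (auto simp: projections_def) (metis blinfun_apply_blinfun_compose)
  show 2: "cinner (P x) y = cinner x (P y)" for x y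
    using assms cinner_adj(1)[of P x y] bops_imp_bops_id by (auto simp: projections_def)
  show "cinner (P x) (P x) = cinner x (P x)" by (simp add: 1 2)
qed

lemma projectionI:
  fixes P :: "'a::chilbert op"
  assumes "P \<in> M" "\<And>x. P (P x) = P x" "\<And>x y. cinner (P x) y = cinner x (P y)"
  shows "P \<in> projections M"
proof -
  have "P o\<^sub>L P = P" by (rule blinfun_eqI) (simp add: assms(2))
  moreover have "adj P = P" by (rule adj_eqI) (rule assms(3))
  ultimately show ?thesis using assms(1) by (simp add: projections_def)
qed

lemma in_range_projection_iff:
  assumes "P \<in> projections (bops e)"
  shows "x \<in> range (blinfun_apply P) \<longleftrightarrow> P x = x"
proof
  show "P x = x" if "x \<in> range (blinfun_apply P)"
    using that projection_apply(1)[OF assms] by (elim rangeE) simp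
  show "x \<in> range (blinfun_apply P)" if "P x = x"
    using rangeI[of P x] that by simp
qed

text \<open>Each projection fixes the range of the other, so \<open>P Q = Q\<close> and
  \<open>Q P = P\<close>; self-adjointness turns the second equation into
  \<open>P Q = P\<close>.\<close>

lemma projection_eqI:
  assumes P: "P \<in> projections (bops e)" and Q: "Q \<in> projections (bops e)"
    and "range (blinfun_apply P) = range (blinfun_apply Q)"
  shows "P = Q"
proof (rule blinfun_eqI, rule cinner_ext)
  fix z x
  have PQ: "P (Q x) = Q x" for x
    unfolding in_range_projection_iff[OF P, symmetric] assms(3) by (rule rangeI)
  have QP: "Q (P x) = P x" for x
    unfolding in_range_projection_iff[OF Q, symmetric] assms(3)[symmetric] by (rule rangeI)
  have "cinner z (P x) = cinner (Q (P z)) x"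
    by (simp add: QP projection_apply(2)[OF P])
  also have "\<dots> = cinner z (Q x)"
    by (simp only: projection_apply(2)[OF Q] projection_apply(2)[OF P] PQ)
  finally show "cinner z (P x) = cinner z (Q x)" .
qed

text \<open>The orthogonality condition has only one solution in \<open>L\<close>, so the map to the
  nearest point is linear. Existence of this projection is what gives \<open>proj_sup\<close> a
  value.\<close>

lemma projection_onto_exists:
  fixes L :: "'a::chilbert set"
  assumes L: "cvec.subspace L" "closed L"
  obtains P where "P \<in> projections (bops id_blinfun)" "range (blinfun_apply P) = L"
proof -
  have "\<forall>y. \<exists>u. u \<in> L \<and> (\<forall>v\<in>L. cinner v (y - u) = 0)"
  proof
    fix y
    show "\<exists>u. u \<in> L \<and> (\<forall>v\<in>L. cinner v (y - u) = 0)"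
      by (rule orthogonal_decomposition[OF L, of y]) blast
  qed
  then obtain p where "\<forall>y. p y \<in> L \<and> (\<forall>v\<in>L. cinner v (y - p y) = 0)"
    by (rule choice[THEN exE])
  then have p: "\<And>y. p y \<in> L" "\<And>y v. v \<in> L \<Longrightarrow> cinner v (y - p y) = 0"
    by simp_all
  have uniq: "p y = u" if "u \<in> L" "\<And>v. v \<in> L \<Longrightarrow> cinner v (y - u) = 0" for y u
  proof -
    have "p y - u \<in> L" using L(1) p(1) that(1) by (rule cvec.subspace_diff)
    then have "cinner (p y - u) (y - u) - cinner (p y - u) (y - p y) = 0"
      by (simp only: p(2) that(2) diff_self)
    then have "cinner (p y - u) (p y - u) = 0"
      by (simp add: cinner.diff_right[symmetric])
    then show ?thesis by simp
  qed
  have le: "norm (p y) \<le> norm y" for y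
  proof -
    have "cinner (p y) y = cinner (p y) (p y)"
      using p(2)[OF p(1), of y y] by (simp add: cinner.diff_right)
    then have "(norm (p y))\<^sup>2 = cmod (cinner (p y) y)"
      by (simp add: cinner_self norm_power)
    also have "\<dots> \<le> norm (p y) * norm y" by (rule norm_cinner_le)
    finally show ?thesis
      by (cases "p y = 0") (simp_all add: power2_eq_square)
  qed
  have padd: "p (x + y) = p x + p y" for x y
  proof (rule uniq)
    show "p x + p y \<in> L" using L(1) p(1) by (intro cvec.subspace_add)
    have "x + y - (p x + p y) = (x - p x) + (y - p y)" by simp
    then show "cinner v (x + y - (p x + p y)) = 0" if "v \<in> L" for v
      using that by (simp only: cinner_add_right p(2) add_0_left)
  qed
  have pscale: "p (c *\<^sub>C x) = c *\<^sub>C p x" for c x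
  proof (rule uniq)
    show "c *\<^sub>C p x \<in> L" using L(1) p(1) by (intro cvec.subspace_scale)
    show "cinner v (c *\<^sub>C x - c *\<^sub>C p x) = 0" if "v \<in> L" for v
      using that by (simp add: cvec.scale_right_diff_distrib[symmetric] cinner_scaleC_right p(2))
  qed
  have pL: "p x = x" if "x \<in> L" for x
    by (rule uniq) (simp_all add: that cinner.zero_right)
  have "bounded_linear p"
    by (rule bounded_linear_intro[of _ 1])
      (simp_all add: padd pscale le scaleC_of_real[symmetric])
  then have ap: "blinfun_apply (Blinfun p) = p" by (rule bounded_linear_Blinfun_apply)
  have "Blinfun p \<in> projections (bops id_blinfun)"
  proof (rule projectionI)
    show "Blinfun p \<in> bops id_blinfun" by (simp add: ap bops_id_iff pscale)
    show "Blinfun p (Blinfun p x) = Blinfun p x" for x by (simp add: ap pL p(1))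
    fix x y
    have "cinner (p x) (y - p y) = 0" by (rule p(2)[OF p(1)])
    moreover have "cinner (x - p x) (p y) = 0"
      by (subst cinner_eq_0_commute) (rule p(2)[OF p(1)])
    ultimately show "cinner (Blinfun p x) y = cinner x (Blinfun p y)"
      by (simp add: ap cinner.diff_right cinner.diff_left)
  qed
  moreover have "range (blinfun_apply (Blinfun p)) = L"
  proof
    show "range (blinfun_apply (Blinfun p)) \<subseteq> L" using p(1) by (auto simp: ap)
    show "L \<subseteq> range (blinfun_apply (Blinfun p))"
    proof
      fix x assume "x \<in> L"
      then show "x \<in> range (blinfun_apply (Blinfun p))"
        using rangeI[of "blinfun_apply (Blinfun p)" x] by (simp add: ap pL)
    qed
  qed
  ultimately show ?thesis by (rule that)
qed

lemma cvec_subspace_closure: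
  fixes S :: "'a::chilbert set"
  assumes S: "cvec.subspace S"
  shows "cvec.subspace (closure S)"
  unfolding cvec.subspace_def
proof (intro conjI ballI allI)
  show "0 \<in> closure S" using S closure_subset cvec.subspace_0 by blast
  show "x + y \<in> closure S" if "x \<in> closure S" "y \<in> closure S" for x y
  proof -
    obtain f g where f: "\<And>n. f n \<in> S" "f \<longlonglongrightarrow> x" and g: "\<And>n. g n \<in> S" "g \<longlonglongrightarrow> y"
      using \<open>x \<in> closure S\<close> \<open>y \<in> closure S\<close> closure_sequential by metis
    have "(\<lambda>n. f n + g n) \<longlonglongrightarrow> x + y"
      by (intro tendsto_add f g)
    moreover have "\<forall>n. f n + g n \<in> S" using S f g by (simp add: cvec.subspace_add)
    ultimately show ?thesis unfolding closure_sequential by (intro exI conjI)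
  qed
  show "c *\<^sub>C x \<in> closure S" if x: "x \<in> closure S" for c x
  proof -
    obtain f where f: "\<And>n. f n \<in> S" "f \<longlonglongrightarrow> x" using x closure_sequential by metis
    have "(\<lambda>n. c *\<^sub>C f n) \<longlonglongrightarrow> c *\<^sub>C x"
      by (rule bounded_linear.tendsto[OF bounded_linear_scaleC f(2)])
    moreover have "\<forall>n. c *\<^sub>C f n \<in> S" using S f by (simp add: cvec.subspace_scale)
    ultimately show ?thesis unfolding closure_sequential by (intro exI conjI)
  qed
qed

text \<open>Every closed complex subspace is the range of exactly one projection, so the description
  defining \<open>proj_sup\<close> succeeds for an arbitrary set \<open>S\<close> of
  operators.\<close>

lemma
  fixes S :: "'a::chilbert op set"
  shows proj_sup_projection: "proj_sup S \<in> projections (bops id_blinfun)"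
    and range_proj_sup:
      "range (blinfun_apply (proj_sup S)) = closure (cvec.span (\<Union>Q\<in>S. range (blinfun_apply Q)))"
proof -
  let ?L = "closure (cvec.span (\<Union>Q\<in>S. range (blinfun_apply Q)))"
  have "cvec.subspace ?L" "closed ?L" by (simp_all add: cvec_subspace_closure cvec.subspace_span)
  then obtain P where P: "P \<in> projections (bops id_blinfun)" "range (blinfun_apply P) = ?L"
    using projection_onto_exists by metis
  then have "proj_sup S = P"
    unfolding proj_sup_def
  proof (intro the_equality conjI)
    show "Q = P" if "Q \<in> projections (bops id_blinfun) \<and> range (blinfun_apply Q) = ?L" for Q
      using projection_eqI[of Q id_blinfun P] that P by simp
  qed
  with P show "proj_sup S \<in> projections (bops id_blinfun)"
    "range (blinfun_apply (proj_sup S)) = ?L" by simp_all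
qed

text \<open>A projection annihilates exactly the vectors orthogonal to its range, and orthogonality
  to \<open>x\<close> passes to spans and closures.\<close>

lemma proj_sup_kernel:
  assumes "\<And>Q. Q \<in> S \<Longrightarrow> Q \<in> projections (bops e)"
    and "\<And>Q. Q \<in> S \<Longrightarrow> Q x = 0"
  shows "proj_sup S x = 0"
proof -
  let ?L = "(cvec.span (\<Union>Q\<in>S. range (blinfun_apply Q)))"
  have "cinner y x = 0" if "y \<in> ?L" for y
    using that
  proof (induction rule: cvec.span_induct_alt)
    case (step c y z)
    from step(1) obtain Q w where "Q \<in> S" "y = Q w" by blast
    then have "cinner y x = 0"
      using assms projection_apply(2)[of Q e w x] by (simp add: cinner.zero_right)
    with step show ?case by (simp add: cinner_add_left cinner_scaleC_left)
  qed (simp add: cinner.zero_left)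
  then have "?L \<subseteq> {y. cinner y x = 0}" by blast
  moreover have "closed {y. cinner y x = 0}"
    by (intro closed_Collect_eq continuous_intros cinner.continuous_on)
  ultimately have "closure ?L \<subseteq> {y. cinner y x = 0}" by (rule closure_minimal)
  then have "cinner (proj_sup S x) x = 0" by (auto simp: range_proj_sup[symmetric])
  then show ?thesis
    using projection_apply[OF proj_sup_projection] by (metis cinner_self_eq_0_iff)
qed

section \<open>Amplification and the weak* topology\<close>

lemma norm_ell2_sq: "(norm f)\<^sup>2 = (\<Sum>i. (norm (seq f i))\<^sup>2)"
  by (simp add: power2_norm_eq_inner inner_ell2_def)

lemma summable_seq: "summable (\<lambda>i. (norm (seq f i))\<^sup>2)"
  using seq[of f] by simp

lemma ell2_eqI: "(\<And>i. seq f i = seq g i) \<Longrightarrow> f = g"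
  by (simp add: seq_inject[symmetric] fun_eq_iff)

lemma seq_add: "seq (f + g) i = seq f i + seq g i"
  by (simp add: plus_ell2.rep_eq)

lemma seq_scaleC: "seq (c *\<^sub>C f) i = c *\<^sub>C seq f i"
  by (simp add: scaleC_ell2.rep_eq)

lemma seq_zero [simp]: "seq 0 i = 0"
  by (simp add: zero_ell2.rep_eq)

lemma seq_sum: "seq (sum f A) i = (\<Sum>a\<in>A. seq (f a) i)"
  by (induction A rule: infinite_finite_induct) (simp_all add: seq_add)

lemma seq_tensor_vec: "seq (tensor_vec x f) i = seq f i *\<^sub>C x"
  by (simp add: tensor_vec.rep_eq)

lemma seq_ket: "seq (ket j) i = (if i = j then 1 else 0)"
  by (simp add: ket.rep_eq)

text \<open>This is \<open>A \<otimes> Id\<close> written coordinatewise. The explicit form can be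
  computed with, while \<open>\<otimes>\<^sub>o\<close> is a definite description and is reached
  through \<open>tensor_op_id\<close>.\<close>

definition amp_vec :: "('a::chilbert) op \<Rightarrow> 'a ell2 \<Rightarrow> 'a ell2" where
  "amp_vec A f = Abs_ell2 (\<lambda>i. A (seq f i))"

lemma summable_amp: "summable (\<lambda>i. (norm (blinfun_apply A (seq f i)))\<^sup>2)"
proof (rule summable_comparison_test')
  show "summable (\<lambda>i. (norm A)\<^sup>2 * (norm (seq f i))\<^sup>2)"
    by (intro summable_mult summable_seq)
  show "norm ((norm (blinfun_apply A (seq f i)))\<^sup>2) \<le> (norm A)\<^sup>2 * (norm (seq f i))\<^sup>2" for i
    unfolding power_mult_distrib[symmetric] by (simp add: norm_blinfun power_mono)
qed

lemma seq_amp_vec: "seq (amp_vec A f) i = A (seq f i)"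
  by (simp add: amp_vec_def Abs_ell2_inverse summable_amp)

definition amp :: "('a::chilbert) op \<Rightarrow> 'a ell2 op" where
  "amp A = Blinfun (amp_vec A)"

lemma bounded_linear_amp_vec: "bounded_linear (amp_vec A)"
proof (rule bounded_linear_intro[of _ "norm A"])
  show "amp_vec A (f + g) = amp_vec A f + amp_vec A g" for f g
    by (rule ell2_eqI) (simp add: seq_amp_vec seq_add blinfun.add_right)
  show "amp_vec A (r *\<^sub>R f) = r *\<^sub>R amp_vec A f" for r f
    by (rule ell2_eqI) (simp add: seq_amp_vec scaleR_ell2.rep_eq blinfun.scaleR_right)
  fix f
  have "(norm (amp_vec A f))\<^sup>2 \<le> (\<Sum>i. (norm A)\<^sup>2 * (norm (seq f i))\<^sup>2)"
    unfolding norm_ell2_sq seq_amp_vec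
    by (intro suminf_le summable_mult summable_seq summable_amp)
      (simp add: norm_blinfun power_mono flip: power_mult_distrib)
  also have "\<dots> = (norm f * norm A)\<^sup>2"
    by (simp add: suminf_mult summable_seq norm_ell2_sq power_mult_distrib mult.commute)
  finally show "norm (amp_vec A f) \<le> norm f * norm A"
    by (rule power2_le_imp_le) simp
qed

lemma seq_amp: "seq (amp A f) i = A (seq f i)"
  by (simp add: amp_def bounded_linear_Blinfun_apply bounded_linear_amp_vec seq_amp_vec)

lemma amp_compose: "amp (A o\<^sub>L B) = amp A o\<^sub>L amp B"
  by (rule blinfun_eqI, rule ell2_eqI) (simp add: seq_amp)

lemma amp_add: "amp (A + B) = amp A + amp B"
  by (rule blinfun_eqI, rule ell2_eqI) (simp add: seq_amp seq_add blinfun.add_left)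

lemma amp_diff: "amp (A - B) = amp A - amp B"
  by (rule blinfun_eqI, rule ell2_eqI) (simp add: seq_amp seq_minus blinfun.diff_left)

lemma amp_scaleC: "amp (c *\<^sub>C A) = c *\<^sub>C amp A"
  by (rule blinfun_eqI, rule ell2_eqI) (simp add: seq_amp seq_scaleC)

lemma amp_eq_0_iff: "amp A = 0 \<longleftrightarrow> A = 0"
proof
  assume 0: "amp A = 0"
  have "A x = seq (amp A (tensor_vec x (ket 0))) 0" for x
    by (simp add: seq_amp seq_tensor_vec seq_ket)
  then show "A = 0" by (intro blinfun_eqI) (simp add: 0)
next
  assume "A = 0"
  then show "amp A = 0" by (intro blinfun_eqI ell2_eqI) (simp add: seq_amp)
qed

lemma amp_in_bops_id: "A \<in> bops id_blinfun \<Longrightarrow> amp A \<in> bops id_blinfun"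
  unfolding bops_id_iff by (intro allI ell2_eqI) (simp add: seq_amp seq_scaleC)

lemma amp_projection:
  assumes "P \<in> projections (bops e)" "amp P \<in> M"
  shows "amp P \<in> projections M"
proof (rule projectionI)
  show "amp P (amp P f) = amp P f" for f
    by (rule ell2_eqI) (simp add: seq_amp projection_apply(1)[OF assms(1)])
  show "cinner (amp P f) g = cinner f (amp P g)" for f g
    by (simp add: cinner_ell2_def seq_amp projection_apply(2)[OF assms(1)])
qed fact

text \<open>The squared error is a tail of a convergent series. Finite sums of elementary tensors
  are thus dense, which is the uniqueness half of \<open>tensor_op_id\<close>.\<close>

lemma ell2_sum_tensor_ket: "(\<lambda>k. \<Sum>i<k. tensor_vec (seq f i) (ket i)) \<longlonglongrightarrow> f"
proof -
  let ?S = "\<lambda>k. \<Sum>i<k. tensor_vec (seq f i) (ket i)"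
  let ?g = "\<lambda>i. (norm (seq f i))\<^sup>2"
  have "seq (?S k) j = (if j < k then seq f j else 0)" for k j
  proof -
    have "seq (?S k) j = (\<Sum>i<k. if i = j then seq f j else 0)"
      unfolding seq_sum seq_tensor_vec seq_ket by (intro sum.cong) auto
    then show ?thesis by simp
  qed
  then have "(norm (?S k - f))\<^sup>2 = (\<Sum>i. if i < k then 0 else ?g i)" for k
    unfolding norm_ell2_sq seq_minus by (intro arg_cong[of _ _ suminf]) auto
  moreover have "(\<Sum>i. if i < k then 0 else ?g i) = suminf ?g - (\<Sum>i<k. ?g i)" for k
  proof -
    have "(\<lambda>i. if i \<in> {..<k} then ?g i else 0) sums (\<Sum>i<k. ?g i)"
      by (rule sums_If_finite_set) simp
    from sums_diff[OF summable_sums[OF summable_seq[of f]] this]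
    have "(\<lambda>i. ?g i - (if i \<in> {..<k} then ?g i else 0)) sums (suminf ?g - (\<Sum>i<k. ?g i))" .
    moreover have "(\<lambda>i. ?g i - (if i \<in> {..<k} then ?g i else 0)) = (\<lambda>i. if i < k then 0 else ?g i)"
      by auto
    ultimately show ?thesis by (simp add: sums_unique[symmetric])
  qed
  ultimately have "(norm (?S k - f))\<^sup>2 = suminf ?g - (\<Sum>i<k. ?g i)" for k by simp
  moreover have "(\<lambda>k. suminf ?g - (\<Sum>i<k. ?g i)) \<longlonglongrightarrow> suminf ?g - suminf ?g"
    by (intro tendsto_diff tendsto_const summable_LIMSEQ summable_seq)
  ultimately have "(\<lambda>k. (norm (?S k - f))\<^sup>2) \<longlonglongrightarrow> 0" by simp
  then have "(\<lambda>k. sqrt ((norm (?S k - f))\<^sup>2)) \<longlonglongrightarrow> sqrt 0" by (rule tendsto_real_sqrt)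
  then have "(\<lambda>k. norm (?S k - f)) \<longlonglongrightarrow> 0" by simp
  then show ?thesis by (rule LIM_zero_cancel[OF tendsto_norm_zero_cancel])
qed

lemma tensor_op_id:
  assumes A: "A \<in> bops id_blinfun"
  shows "A \<otimes>\<^sub>o id_blinfun = amp A"
  unfolding tensor_op_def
proof (rule the_equality)
  show amp: "\<forall>x f. amp A (tensor_vec x f) = tensor_vec (A x) (id_blinfun f)"
    by (intro allI ell2_eqI) (simp add: seq_amp seq_tensor_vec bops_scaleC[OF A])
  fix T :: "'a ell2 op"
  assume T: "\<forall>x f. T (tensor_vec x f) = tensor_vec (A x) (id_blinfun f)"
  show "T = amp A"
  proof (rule blinfun_eqI)
    fix f :: "'a ell2"
    let ?S = "\<lambda>k. \<Sum>i<k. tensor_vec (seq f i) (ket i)"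
    have "T (?S k) = amp A (?S k)" for k
      by (simp only: blinfun.sum_right T amp)
    moreover have "(\<lambda>k. T (?S k)) \<longlonglongrightarrow> T f" "(\<lambda>k. amp A (?S k)) \<longlonglongrightarrow> amp A f"
      by (intro blinfun.tendsto tendsto_const ell2_sum_tensor_ket)+
    ultimately show "T f = amp A f" using LIMSEQ_unique by fastforce
  qed
qed

text \<open>The generating functionals, indexed by pairs of square-summable sequences, are matrix
  coefficients of the amplification. Questions about the weak* topology thereby become geometric
  ones in \<open>'a ell2\<close>.\<close>

lemma openin_weak_star_functional:
  fixes f g :: "'a::chilbert ell2"
  assumes "open U"
  shows "openin weak_star {A :: 'a op. cinner f (amp A g) \<in> U}"
  unfolding weak_star_def
proof (rule topology_generated_by_Basis, intro CollectI exI conjI)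
  show "{A :: 'a op. cinner f (amp A g) \<in> U} = {A. (\<Sum>k. cinner (seq f k) (blinfun_apply A (seq g k))) \<in> U}"
    by (simp add: cinner_ell2_def seq_amp)
qed (use assms summable_seq in auto)

lemma topspace_weak_star: "topspace weak_star = (UNIV :: 'a::chilbert op set)"
  using openin_subset[OF openin_weak_star_functional[OF open_UNIV, where 'a='a]] by auto

text \<open>A coefficient at two vectors is a generating functional whose sequences vanish outside
  index 0.\<close>

lemma closedin_weak_star_functional:
  fixes x y :: "'a::chilbert"
  assumes "closed C"
  shows "closedin weak_star {A :: 'a op. cinner x (A y) \<in> C}"
proof -
  have "cinner x (A y) = cinner (tensor_vec x (ket 0)) (amp A (tensor_vec y (ket 0)))"
    for A :: "'a op"
  proof -
    have "(\<lambda>k. cinner (seq (tensor_vec x (ket 0)) k) (A (seq (tensor_vec y (ket 0)) k)))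
        = (\<lambda>k. if k \<in> {0} then cinner x (A y) else 0)"
      by (auto simp: seq_tensor_vec seq_ket cinner.zero_left)
    then show ?thesis
      using sums_unique[OF sums_If_finite_set[of "{0}" "\<lambda>k. cinner x (A y)"]]
      by (simp add: cinner_ell2_def seq_amp)
  qed
  then have "openin weak_star (- {A :: 'a op. cinner x (A y) \<in> C})"
    using openin_weak_star_functional[OF open_Compl[OF assms], of "tensor_vec x (ket 0)" "tensor_vec y (ket 0)"]
    by (simp add: Collect_neg_eq[symmetric])
  then show ?thesis by (simp add: closedin_def topspace_weak_star Compl_eq_Diff_UNIV)
qed

text \<open>Placing \<open>w1\<close> at even and \<open>w2\<close> at odd indices makes the squared
  norms add under every amplified operator. Finite intersections of neighbourhoods can so be
  controlled by a single sequence.\<close>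

lemma ell2_interleave:
  fixes w1 w2 :: "'a::chilbert ell2"
  obtains w where "\<And>D. norm (amp D w1) \<le> norm (amp D w)" "\<And>D. norm (amp D w2) \<le> norm (amp D w)"
proof -
  define h where "h = (\<lambda>n. if even n then seq w1 (n div 2) else seq w2 ((n - 1) div 2))"
  have sums: "(\<lambda>n. (norm (D (h n)))\<^sup>2) sums ((norm (amp D w2))\<^sup>2 + (norm (amp D w1))\<^sup>2)"
    for D :: "'a op"
  proof -
    have s: "(\<lambda>n. (norm (D (seq w n)))\<^sup>2) sums (norm (amp D w))\<^sup>2" for w :: "'a ell2"
      unfolding norm_ell2_sq seq_amp by (intro summable_sums summable_amp)
    have "(\<lambda>n. (norm (D (h n)))\<^sup>2) = (\<lambda>n. if even n then (norm (D (seq w1 (n div 2))))\<^sup>2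
        else (norm (D (seq w2 ((n - 1) div 2))))\<^sup>2)"
      by (auto simp: h_def)
    then show ?thesis using sums_if[OF s[of w2] s[of w1]] by simp
  qed
  have "summable (\<lambda>n. (norm (h n))\<^sup>2)"
    using sums_summable[OF sums[of id_blinfun]] by simp
  then have h: "seq (Abs_ell2 h) = h" by (simp add: Abs_ell2_inverse)
  have "(norm (amp D (Abs_ell2 h)))\<^sup>2 = (norm (amp D w2))\<^sup>2 + (norm (amp D w1))\<^sup>2" for D
    unfolding norm_ell2_sq[of "amp D (Abs_ell2 h)"] seq_amp h
    by (rule sums_unique[OF sums, symmetric])
  then have "(norm (amp D w1))\<^sup>2 \<le> (norm (amp D (Abs_ell2 h)))\<^sup>2"
    "(norm (amp D w2))\<^sup>2 \<le> (norm (amp D (Abs_ell2 h)))\<^sup>2" for D by simp_all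
  then have "norm (amp D w1) \<le> norm (amp D (Abs_ell2 h))" "norm (amp D w2) \<le> norm (amp D (Abs_ell2 h))"
    for D using power2_le_imp_le norm_ge_zero by blast+
  then show ?thesis by (rule that)
qed

text \<open>One square-summable sequence of vectors controls a whole weak* neighbourhood: this replaces
  the passage from the weak* to the ultrastrong topology.\<close>

lemma weak_star_neighbourhood:
  fixes A :: "'a::chilbert op"
  assumes "openin weak_star U" "A \<in> U"
  obtains w \<delta> where "0 < \<delta>" "\<And>B. norm (amp (B - A) w) < \<delta> \<Longrightarrow> B \<in> U"
proof -
  have "\<exists>w. \<exists>\<delta>>0. \<forall>B. norm (amp (B - A) w) < \<delta> \<longrightarrow> B \<in> U"
    using assms unfolding weak_star_def openin_topology_generated_by_iff
  proof (induction U rule: generate_topology_on.induct)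
    case (Int U V)
    then obtain w1 \<delta>1 w2 \<delta>2 where 1: "0 < \<delta>1" "\<And>B. norm (amp (B - A) w1) < \<delta>1 \<Longrightarrow> B \<in> U"
      and 2: "0 < \<delta>2" "\<And>B. norm (amp (B - A) w2) < \<delta>2 \<Longrightarrow> B \<in> V"
      by (metis IntE)
    obtain w where w: "\<And>D. norm (amp D w1) \<le> norm (amp D w)" "\<And>D. norm (amp D w2) \<le> norm (amp D w)"
      using ell2_interleave by metis
    have "\<forall>B. norm (amp (B - A) w) < min \<delta>1 \<delta>2 \<longrightarrow> B \<in> U \<inter> V"
      using 1(2) 2(2) w by (meson IntI min_less_iff_conj order_le_less_trans)
    moreover have "0 < min \<delta>1 \<delta>2" using 1(1) 2(1) by simp
    ultimately show ?case by blast
  next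
    case (UN K)
    then obtain k where "k \<in> K" "A \<in> k" by blast
    then obtain w \<delta> where "0 < \<delta>" "\<forall>B. norm (amp (B - A) w) < \<delta> \<longrightarrow> B \<in> k" using UN.IH by blast
    then show ?case using \<open>k \<in> K\<close> by blast
  next
    case (Basis U)
    then obtain x y V where U: "U = {A :: 'a op. (\<Sum>k. cinner (x k) (A (y k))) \<in> V}"
      and xy: "summable (\<lambda>k. (norm (x k))\<^sup>2)" "summable (\<lambda>k. (norm (y k))\<^sup>2)" and "open V"
      by blast
    define f g where "f = Abs_ell2 x" and "g = Abs_ell2 y"
    have "seq f = x" "seq g = y" by (simp_all add: f_def g_def Abs_ell2_inverse xy)
    then have U: "U = {A. cinner f (amp A g) \<in> V}"
      by (simp add: U cinner_ell2_def seq_amp)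
    obtain e where e: "0 < e" "\<And>z. dist z (cinner f (amp A g)) < e \<Longrightarrow> z \<in> V"
      using \<open>open V\<close> Basis(2) unfolding U open_dist by blast
    \<comment> \<open>Adding 1 keeps the divisor positive when \<open>f = 0\<close>.\<close>
    have "B \<in> U" if "norm (amp (B - A) g) < e / (norm f + 1)" for B
    proof -
      have "dist (cinner f (amp B g)) (cinner f (amp A g)) = cmod (cinner f (amp (B - A) g))"
        by (simp add: dist_norm amp_diff blinfun.diff_left cinner.diff_right)
      also have "\<dots> \<le> (norm f + 1) * norm (amp (B - A) g)"
        using norm_cinner_le[of f "amp (B - A) g"]
        by (simp add: distrib_right add_increasing2)
      also have "\<dots> < e" using that
        by (simp add: pos_less_divide_eq mult.commute add_nonneg_pos)
      finally show ?thesis using e(2) by (simp add: U)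
    qed
    moreover have "0 < e / (norm f + 1)" using e(1) by (simp add: add_nonneg_pos)
    ultimately show ?case by blast
  qed simp
  with that show ?thesis by blast
qed

lemma blinfun_compose_assoc: "(A o\<^sub>L B) o\<^sub>L C = A o\<^sub>L (B o\<^sub>L C)"
  by (rule blinfun_eqI) simp

lemma proj_sup_compose:
  assumes "Q \<in> S" "Q \<in> projections (bops e)"
  shows "proj_sup S o\<^sub>L Q = Q"
proof (rule blinfun_eqI)
  fix x
  have "Q x \<in> range (blinfun_apply (proj_sup S))"
    unfolding range_proj_sup by (rule subsetD[OF closure_subset], rule cvec.span_base) (use assms in blast)
  then show "(proj_sup S o\<^sub>L Q) x = Q x"
    by (simp add: in_range_projection_iff[OF proj_sup_projection])
qed

lemma projection_compose_commute:
  assumes "P \<in> projections (bops e)" "Q \<in> projections (bops e')" "P o\<^sub>L Q = Q"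
  shows "Q o\<^sub>L P = Q"
proof -
  have "adj (P o\<^sub>L Q) = adj Q o\<^sub>L adj P"
    by (rule adj_compose) (use assms in \<open>auto simp: projections_def dest: bops_imp_bops_id\<close>)
  then show ?thesis using assms by (simp add: projections_def)
qed

text \<open>The supremum is approximated by the elements of \<open>J\<close>: in the amplified space the component of
  \<open>(\<Or>S) w\<close> orthogonal to \<open>J w\<close> is annihilated by every member of \<open>S\<close>.\<close>

lemma proj_sup_in_weak_star_closed:
  fixes J :: "'a::chilbert op set"
  assumes closed: "closedin weak_star J" and J: "cvec.subspace J" and SJ: "S \<subseteq> J"
    and S: "S \<subseteq> projections (bops id_blinfun)" and mult: "\<And>P B. P \<in> S \<Longrightarrow> B \<in> J \<Longrightarrow> P o\<^sub>L B \<in> J"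
  shows "proj_sup S \<in> J"
proof (rule ccontr)
  define G where "G = proj_sup S"
  have G: "G \<in> projections (bops id_blinfun)" unfolding G_def by (rule proj_sup_projection)
  assume "proj_sup S \<notin> J"
  then have "G \<in> - J" by (simp add: G_def)
  moreover have "openin weak_star (- J)"
    using closed by (simp add: closedin_def topspace_weak_star Compl_eq_Diff_UNIV)
  ultimately obtain w \<delta> where \<delta>: "0 < \<delta>" and w: "\<And>B. norm (amp (B - G) w) < \<delta> \<Longrightarrow> B \<in> - J"
    using weak_star_neighbourhood by metis
  \<comment> \<open>The condition \<open>G o\<^sub>L B = B\<close> keeps \<open>K\<close> inside the
    range of \<open>amp G\<close>, so that the point of \<open>closure K\<close> nearest to
    \<open>amp G w\<close> is fixed by \<open>amp G\<close>.\<close>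
  define K where "K = {amp B w | B. B \<in> J \<and> G o\<^sub>L B = B}"
  have K: "cvec.subspace K"
    unfolding cvec.subspace_def
  proof (intro conjI ballI allI)
    have "0 = amp 0 w" by (rule ell2_eqI) (simp add: seq_amp)
    then show "0 \<in> K" unfolding K_def using cvec.subspace_0[OF J] by force
  next
    fix x y assume "x \<in> K" "y \<in> K"
    then obtain B C where "x = amp B w" "B \<in> J" "G o\<^sub>L B = B" "y = amp C w" "C \<in> J" "G o\<^sub>L C = C"
      by (auto simp: K_def)
    then have "x + y = amp (B + C) w \<and> B + C \<in> J \<and> G o\<^sub>L (B + C) = B + C"
      using cvec.subspace_add[OF J] by (simp add: amp_add blinfun.add_left
          bounded_bilinear.add_right[OF bounded_bilinear_blinfun_compose])
    then show "x + y \<in> K" unfolding K_def by blast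
  next
    fix c x assume "x \<in> K"
    then obtain B where B: "x = amp B w" "B \<in> J" "G o\<^sub>L B = B" by (auto simp: K_def)
    have "G o\<^sub>L (c *\<^sub>C B) = c *\<^sub>C B"
    proof (rule blinfun_eqI)
      fix x show "(G o\<^sub>L (c *\<^sub>C B)) x = (c *\<^sub>C B) x"
        using arg_cong[OF B(3), of "\<lambda>T. T x"] projection_bops_id[OF G]
        by (auto simp: projections_def bops_id_iff)
    qed
    then have "c *\<^sub>C x = amp (c *\<^sub>C B) w \<and> c *\<^sub>C B \<in> J \<and> G o\<^sub>L (c *\<^sub>C B) = c *\<^sub>C B"
      using B cvec.subspace_scale[OF J] by (simp add: amp_scaleC)
    then show "c *\<^sub>C x \<in> K" unfolding K_def by blast
  qed
  define y where "y = amp G w"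
  obtain u where u: "u \<in> closure K" "\<And>v. v \<in> closure K \<Longrightarrow> cinner v (y - u) = 0"
    using orthogonal_decomposition[OF cvec_subspace_closure[OF K] closed_closure, of y] by blast
  have invar: "amp T x \<in> closure K" if T: "\<And>z. z \<in> K \<Longrightarrow> amp T z \<in> K" and x: "x \<in> closure K" for T x
  proof -
    obtain z where z: "\<And>n. z n \<in> K" "z \<longlonglongrightarrow> x" using x closure_sequential by metis
    have "(\<lambda>n. amp T (z n)) \<longlonglongrightarrow> amp T x" by (intro blinfun.tendsto tendsto_const z)
    moreover have "\<forall>n. amp T (z n) \<in> K" using T z by blast
    ultimately show ?thesis unfolding closure_sequential by (intro exI conjI)
  qed
  \<comment> \<open>Both \<open>amp P y\<close> and \<open>amp P u\<close> lie in
    \<open>closure K\<close>, hence so does \<open>amp P (y - u)\<close>. It is then orthogonal to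
    \<open>y - u\<close>, and for a projection this forces it to vanish.\<close>
  have P0: "amp P (y - u) = 0" if "P \<in> S" for P
  proof -
    have P: "P \<in> projections (bops id_blinfun)" using S that by blast
    have GP: "G o\<^sub>L P = P" unfolding G_def by (rule proj_sup_compose[OF that P])
    have PG: "P o\<^sub>L G = P" by (rule projection_compose_commute[OF G P GP])
    have aP: "amp P \<in> projections (bops id_blinfun)"
      using P amp_projection amp_in_bops_id by (auto simp: projections_def)
    have "amp P z \<in> K" if "z \<in> K" for z
    proof -
      from that obtain B where B: "z = amp B w" "B \<in> J" "G o\<^sub>L B = B" by (auto simp: K_def)
      have "amp P z = amp (P o\<^sub>L B) w" by (simp add: B amp_compose)
      moreover have "P o\<^sub>L B \<in> J" by (rule mult) fact+
      moreover have "G o\<^sub>L (P o\<^sub>L B) = P o\<^sub>L B" by (simp only: blinfun_compose_assoc[symmetric] GP)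
      ultimately show ?thesis unfolding K_def by blast
    qed
    then have "amp P u \<in> closure K" using invar u(1) by blast
    moreover have "amp P y = amp P w" by (simp add: y_def PG flip: blinfun_apply_blinfun_compose amp_compose)
    then have "amp P y \<in> closure K"
      using GP SJ that closure_subset[of K] unfolding K_def by blast
    ultimately have "amp P (y - u) \<in> closure K"
      by (simp add: blinfun.diff_right cvec.subspace_diff[OF cvec_subspace_closure[OF K]])
    from u(2)[OF this] show ?thesis
      using projection_apply(2,3)[OF aP] by (metis cinner_self_eq_0_iff)
  qed
  \<comment> \<open>Coordinatewise, a vector killed by all members of \<open>S\<close> is killed by
    their supremum. As \<open>amp G\<close> fixes both \<open>y\<close> and \<open>u\<close>, the
    residual itself is zero.\<close>
  have "amp G (y - u) = 0"
  proof (rule ell2_eqI)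
    fix i
    have "P (seq (y - u) i) = 0" if "P \<in> S" for P
      using arg_cong[OF P0[OF that], of "\<lambda>f. seq f i"] by (simp add: seq_amp)
    then have "G (seq (y - u) i) = 0" unfolding G_def using S by (intro proj_sup_kernel) auto
    then show "seq (amp G (y - u)) i = seq 0 i" by (simp add: seq_amp)
  qed
  moreover have "amp G y = y"
    by (rule ell2_eqI) (simp add: y_def seq_amp projection_apply(1)[OF G])
  moreover have "amp G u = u"
  proof -
    have "K \<subseteq> {z. amp G z = z}" by (auto simp: K_def simp flip: blinfun_apply_blinfun_compose amp_compose)
    moreover have "closed {z. amp G z = z}"
      by (intro closed_Collect_eq continuous_intros blinfun.continuous_on)
    ultimately have "closure K \<subseteq> {z. amp G z = z}" by (rule closure_minimal)
    with u(1) show ?thesis by blast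
  qed
  ultimately have "y = u" by (simp add: blinfun.diff_right)
  then obtain z where "z \<in> K" "dist z y < \<delta>" using u(1) \<delta> closure_approachable by blast
  then obtain B where "B \<in> J" "norm (amp B w - amp G w) < \<delta>" by (auto simp: K_def y_def dist_norm)
  with w[of B] show False by (simp add: amp_diff blinfun.diff_left)
qed

section \<open>Orthonormal bases, ranks and matrices\<close>

lemma projection_eq_0I:
  assumes "P \<in> projections (bops e)" "cinner (P x) x = 0"
  shows "P x = 0"
proof -
  have "cinner (P x) (P x) = 0" using assms(2) by (simp add: projection_apply(1,2)[OF assms(1)])
  then show ?thesis by simp
qed

definition orthonormal :: "'a::chilbert set \<Rightarrow> bool" where
  "orthonormal B \<longleftrightarrow> (\<forall>x\<in>B. \<forall>y\<in>B. cinner x y = (if x = y then 1 else 0))"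

lemma cinner_span_eq_0:
  assumes "\<And>b. b \<in> S \<Longrightarrow> cinner b y = 0" and "z \<in> cvec.span S"
  shows "cinner z (y::'a::chilbert) = 0"
  using assms(2)
proof (induction rule: cvec.span_induct_alt)
  case (step c x z)
  then show ?case using assms(1) by (simp add: cinner_add_left cinner_scaleC_left)
qed (simp add: cinner.zero_left)

lemma orthonormal_residual:
  assumes "orthonormal B" "finite B" "b \<in> B"
  shows "cinner b (x - (\<Sum>c\<in>B. cinner c x *\<^sub>C c)) = 0"
proof -
  have "cinner b (\<Sum>c\<in>B. cinner c x *\<^sub>C c) = (\<Sum>c\<in>B. if b = c then cinner c x else 0)"
    unfolding cinner.sum_right cinner_scaleC_right
    by (intro sum.cong) (use assms in \<open>auto simp: orthonormal_def\<close>)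
  also have "\<dots> = cinner b x" using assms by simp
  finally show ?thesis by (simp add: cinner.diff_right)
qed

lemma orthonormal_expansion:
  assumes "orthonormal B" "finite B" "x \<in> cvec.span B"
  shows "x = (\<Sum>c\<in>B. cinner c x *\<^sub>C c)"
proof -
  let ?y = "x - (\<Sum>c\<in>B. cinner c x *\<^sub>C c)"
  have "(\<Sum>c\<in>B. cinner c x *\<^sub>C c) \<in> cvec.span B"
    by (intro cvec.span_sum cvec.span_scale cvec.span_base)
  then have "?y \<in> cvec.span B" using assms(3) by (rule cvec.span_diff[rotated])
  then have "cinner ?y ?y = 0"
    by (rule cinner_span_eq_0[rotated]) (rule orthonormal_residual[OF assms(1,2)])
  then show ?thesis by simp
qed

lemma orthonormal_independent:
  assumes "orthonormal B"
  shows "cvec.independent B"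
  unfolding cvec.dependent_def
proof
  assume "\<exists>a\<in>B. a \<in> cvec.span (B - {a})"
  then obtain a where a: "a \<in> B" "a \<in> cvec.span (B - {a})" by blast
  have "cinner a a = 0"
    by (rule cinner_span_eq_0[OF _ a(2)]) (use assms a(1) in \<open>auto simp: orthonormal_def\<close>)
  moreover have "cinner a a = 1" using assms a(1) by (simp add: orthonormal_def)
  ultimately show False by simp
qed

lemma orthonormal_card_le:
  assumes "orthonormal B" "B \<subseteq> cvec.span S" "finite S"
  shows "finite B" "card B \<le> card S"
  using cvec.independent_span_bound[OF assms(3) orthonormal_independent[OF assms(1)] assms(2)] by auto

lemma gram_schmidt:
  assumes "finite (S :: 'a::chilbert set)"
  obtains B where "finite B" "orthonormal B" "cvec.span B = cvec.span S"
proof -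
  from assms have "\<exists>B. finite B \<and> orthonormal B \<and> cvec.span B = cvec.span S"
  proof (induction S rule: finite_induct)
    case empty
    show ?case by (rule exI[of _ "{}"]) (simp add: orthonormal_def)
  next
    case (insert a S)
    then obtain B where B: "finite B" "orthonormal B" "cvec.span B = cvec.span S" by blast
    define p where "p = (\<Sum>c\<in>B. cinner c a *\<^sub>C c)"
    have p: "p \<in> cvec.span B"
      unfolding p_def by (intro cvec.span_sum cvec.span_scale cvec.span_base)
    have span_a: "cvec.span (insert a S) = cvec.span (insert a B)"
      unfolding cvec.span_insert B(3) ..
    show ?case
    proof (cases "a = p")
      case True
      then have "cvec.span (insert a B) = cvec.span B" using p by (simp add: cvec.span_redundant)
      with B span_a show ?thesis by auto
    next
      case False
      define r where "r = of_real (inverse (norm (a - p))) *\<^sub>C (a - p)"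
      have r: "norm r = 1" using False by (simp add: r_def norm_scaleC norm_inverse)
      then have rr: "cinner r r = 1" by (simp add: cinner_self)
      have br: "cinner b r = 0" if "b \<in> B" for b
        using orthonormal_residual[OF B(2,1) that, of a] by (simp add: r_def p_def cinner_scaleC_right)
      have rb: "cinner r b = 0" if "b \<in> B" for b
        using br[OF that] cinner_eq_0_commute by blast
      have rB: "r \<notin> B" using br rr by force
      have "orthonormal (insert r B)"
        using B(2) br rb rr rB by (auto simp: orthonormal_def)
      moreover have "cvec.span (insert r B) = cvec.span (insert a B)"
        unfolding cvec.span_eq
      proof
        have pa: "p \<in> cvec.span (insert a B)" and pr: "p \<in> cvec.span (insert r B)"
          using p cvec.span_mono[OF subset_insertI] by blast+
        have "r \<in> cvec.span (insert a B)"
          unfolding r_def by (intro cvec.span_scale cvec.span_diff pa cvec.span_base) simp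
        then show "insert r B \<subseteq> cvec.span (insert a B)"
          using cvec.span_superset[of "insert a B"] by blast
        have "a = of_real (norm (a - p)) *\<^sub>C r + p"
          using False by (simp add: r_def scaleC_scaleC flip: of_real_mult)
        moreover have "of_real (norm (a - p)) *\<^sub>C r + p \<in> cvec.span (insert r B)"
          by (intro cvec.span_scale cvec.span_add pr cvec.span_base) simp
        ultimately have "a \<in> cvec.span (insert r B)" by simp
        then show "insert a B \<subseteq> cvec.span (insert r B)"
          using cvec.span_superset[of "insert r B"] by blast
      qed
      ultimately show ?thesis using B(1) span_a by (intro exI[of _ "insert r B"]) simp
    qed
  qed
  with that show ?thesis by blast
qed

section \<open>Matrices and their ranks\<close>

lemma blinfun_apply_one_mat: "one_mat n x = trunc n x"
  by (simp add: one_mat.rep_eq)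

lemma seq_one_mat: "seq (one_mat n x) i = (if i < n then seq x i else 0)"
  by (simp add: blinfun_apply_one_mat trunc.rep_eq)

lemma cinner_ket_left: "cinner (ket i) x = seq x i"
proof -
  have "(\<lambda>k. cinner (seq (ket i) k) (seq x k)) = (\<lambda>k. if k \<in> {i} then seq x k else 0)"
    by (auto simp: seq_ket cinner_complex_def)
  then show ?thesis
    using sums_unique[OF sums_If_finite_set[of "{i}" "\<lambda>k. seq x k"]] by (simp add: cinner_ell2_def)
qed

lemma inj_ket: "inj ket"
  by (rule injI) (metis seq_ket zero_neq_one)

lemma orthonormal_ket: "orthonormal (ket ` S)"
  by (auto simp: orthonormal_def cinner_ket_left seq_ket inj_eq[OF inj_ket])

lemma one_mat_expansion: "one_mat n x = (\<Sum>i<n. seq x i *\<^sub>C ket i)"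
proof (rule ell2_eqI)
  fix j
  have "seq (\<Sum>i<n. seq x i *\<^sub>C ket i) j = (\<Sum>i<n. if j = i then seq x i else 0)"
    unfolding seq_sum seq_scaleC seq_ket scaleC_complex_def by (intro sum.cong) auto
  then show "seq (one_mat n x) j = seq (\<Sum>i<n. seq x i *\<^sub>C ket i) j"
    by (simp add: seq_one_mat)
qed

lemma one_mat_ket: "i < n \<Longrightarrow> one_mat n (ket i) = ket i"
  by (rule ell2_eqI) (simp add: seq_one_mat seq_ket)

lemma one_mat_projection: "one_mat n \<in> projections (bops id_blinfun)"
proof (rule projectionI)
  show "one_mat n \<in> bops id_blinfun"
    unfolding bops_id_iff by (intro allI ell2_eqI) (simp add: seq_one_mat seq_scaleC)
  show "one_mat n (one_mat n x) = one_mat n x" for x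
    by (rule ell2_eqI) (simp add: seq_one_mat)
  show "cinner (one_mat n x) y = cinner x (one_mat n y)" for x y
    unfolding cinner_ell2_def seq_one_mat
    by (intro arg_cong[of _ _ suminf]) (auto simp: cinner_complex_def)
qed

lemma one_mat_idem [simp]: "one_mat n o\<^sub>L one_mat n = one_mat n"
  using one_mat_projection by (simp add: projections_def)

lemma adj_one_mat [simp]: "adj (one_mat n) = one_mat n"
  using one_mat_projection by (simp add: projections_def)

lemma one_mat_in_mats: "one_mat n \<in> mats n"
  using one_mat_projection by (auto simp: mats_def bops_def projections_def)

lemma mats_apply:
  assumes "A \<in> mats n"
  shows "one_mat n (A x) = A x" "A (one_mat n x) = A x"
  using assms by (auto simp: mats_def bops_def simp flip: blinfun_apply_blinfun_compose)

lemma mats_bops_id: "A \<in> mats n \<Longrightarrow> A \<in> bops id_blinfun"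
  by (auto simp: mats_def dest: bops_imp_bops_id)

lemma mats_scaleC: "A \<in> mats n \<Longrightarrow> A (c *\<^sub>C x) = c *\<^sub>C A x"
  by (simp add: mats_def bops_scaleC)

lemma matsI:
  fixes A :: "complex ell2 op"
  assumes "\<And>x. one_mat n (A x) = A x" "\<And>x. A (one_mat n x) = A x" "\<And>c x. A (c *\<^sub>C x) = c *\<^sub>C A x"
  shows "A \<in> mats n"
  unfolding mats_def bops_def using assms by (auto intro!: blinfun_eqI)

lemma mats_compose: "A \<in> mats n \<Longrightarrow> B \<in> mats n \<Longrightarrow> A o\<^sub>L B \<in> mats n"
  by (rule matsI) (simp_all add: mats_apply mats_scaleC)

lemma mats_adj: "A \<in> mats n \<Longrightarrow> adj A \<in> mats n"
proof (rule matsI)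
  assume A: "A \<in> mats n"
  note b = mats_bops_id[OF A]
  note o = projection_apply(2)[OF one_mat_projection]
  show "one_mat n (adj A x) = adj A x" for x
    by (rule cinner_ext) (simp add: o[symmetric] cinner_adj(1)[OF b, symmetric] mats_apply[OF A])
  show "adj A (one_mat n x) = adj A x" for x
    by (rule cinner_ext) (simp add: o[symmetric] cinner_adj(1)[OF b, symmetric] mats_apply[OF A])
  show "adj A (c *\<^sub>C x) = c *\<^sub>C adj A x" for c x
    using adj_in_bops_id[OF b] by (simp add: bops_id_iff)
qed

lemma subspace_mats: "cvec.subspace (mats n)"
  unfolding mats_def by (rule subspace_bops)

lemma mats_sum: "(\<And>i. i \<in> I \<Longrightarrow> f i \<in> mats n) \<Longrightarrow> sum f I \<in> mats n"
  by (rule cvec.subspace_sum[OF subspace_mats])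

lemma projection_mats_bops_id: "P \<in> projections (mats n) \<Longrightarrow> P \<in> projections (bops id_blinfun)"
  by (auto simp: mats_def dest: projection_bops_id)

lemma projection_mats: "P \<in> projections (mats n) \<Longrightarrow> P \<in> mats n"
  by (simp add: projections_def)

lemma range_mats:
  assumes "A \<in> mats n"
  shows "range (blinfun_apply A) = cvec.span (A ` ket ` {..<n})"
proof
  have "A x \<in> cvec.span (A ` ket ` {..<n})" for x
  proof -
    have "A x = (\<Sum>i<n. seq x i *\<^sub>C A (ket i))"
      by (subst mats_apply(2)[OF assms, symmetric])
        (simp add: one_mat_expansion blinfun.sum_right mats_scaleC[OF assms])
    also have "\<dots> \<in> cvec.span (A ` ket ` {..<n})"
      by (intro cvec.span_sum cvec.span_scale cvec.span_base) simp
    finally show ?thesis .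
  qed
  then show "range (blinfun_apply A) \<subseteq> cvec.span (A ` ket ` {..<n})" by blast
  have "cvec.subspace (range (blinfun_apply A))"
    unfolding cvec.subspace_def
  proof (intro conjI ballI allI)
    show "0 \<in> range (blinfun_apply A)" using rangeI[of A 0] by (simp add: blinfun.zero_right)
    show "x + y \<in> range (blinfun_apply A)"
      if "x \<in> range (blinfun_apply A)" "y \<in> range (blinfun_apply A)" for x y
      using that by (elim rangeE) (simp flip: blinfun.add_right)
    show "c *\<^sub>C x \<in> range (blinfun_apply A)" if "x \<in> range (blinfun_apply A)" for c x
      using that by (elim rangeE) (simp flip: mats_scaleC[OF assms])
  qed
  then show "cvec.span (A ` ket ` {..<n}) \<subseteq> range (blinfun_apply A)"
    by (rule cvec.span_minimal[rotated]) blast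
qed

definition op_rank :: "'a::chilbert op \<Rightarrow> nat" where
  "op_rank A = cvec.dim (range (blinfun_apply A))"

lemma projection_basis:
  assumes "P \<in> projections (mats n)"
  obtains B where "finite B" "orthonormal B" "cvec.span B = range (blinfun_apply P)" "card B = op_rank P"
    "\<And>b. b \<in> B \<Longrightarrow> P b = b"
proof -
  obtain B where B: "finite B" "orthonormal B" "cvec.span B = cvec.span (P ` ket ` {..<n})"
    using gram_schmidt[of "P ` ket ` {..<n}"] by blast
  have r: "cvec.span B = range (blinfun_apply P)"
    using B(3) range_mats[OF projection_mats[OF assms]] by simp
  moreover have "op_rank P = card B"
    unfolding op_rank_def r[symmetric]
    by (simp add: cvec.dim_eq_card[OF refl orthonormal_independent[OF B(2)]])
  moreover have "P b = b" if "b \<in> B" for b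
  proof -
    have "b \<in> range (blinfun_apply P)" unfolding r[symmetric] by (rule cvec.span_base) fact
    then show ?thesis by (simp only: in_range_projection_iff[OF projection_mats_bops_id[OF assms]])
  qed
  ultimately show ?thesis by (intro that[OF B(1,2)]) simp_all
qed

text \<open>Expanding \<open>P (ket i)\<close> in an orthonormal basis of the range and exchanging
  the sums leaves the squared norms of the basis vectors. Ranks thereby become Hilbert-Schmidt
  quantities.\<close>

lemma mtrace_projection:
  assumes P: "P \<in> projections (mats n)"
  shows "mtrace n P = of_nat (op_rank P)"
proof -
  obtain B where B: "finite B" "orthonormal B" "cvec.span B = range (blinfun_apply P)" "card B = op_rank P"
    "\<And>b. b \<in> B \<Longrightarrow> P b = b" by (rule projection_basis[OF P], rule that) assumption+
  have b: "(\<Sum>i<n. cinner b (ket i) * seq b i) = 1" if "b \<in> B" for b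
  proof -
    have "one_mat n b = b" using mats_apply(1)[OF projection_mats[OF P], of b] B(5)[OF that] by simp
    then have "cinner b b = (\<Sum>i<n. seq b i * cinner b (ket i))"
      using one_mat_expansion[of n b] by (metis (no_types, lifting) cinner.sum_right cinner_scaleC_right sum.cong)
    then show ?thesis using B(2) that by (simp add: orthonormal_def mult.commute)
  qed
  have "P (ket i) = (\<Sum>c\<in>B. cinner c (ket i) *\<^sub>C c)" for i
  proof -
    have "cinner c (P (ket i)) = cinner c (ket i)" if "c \<in> B" for c
      using projection_apply(2)[OF projection_mats_bops_id[OF P], of c "ket i"] B(5)[OF that] by simp
    moreover have "P (ket i) \<in> cvec.span B" using B(3) by blast
    ultimately show ?thesis
      using orthonormal_expansion[OF B(2,1), of "P (ket i)"] by (metis (no_types, lifting) sum.cong)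
  qed
  then have "mtrace n P = (\<Sum>i<n. \<Sum>c\<in>B. cinner c (ket i) * seq c i)"
    by (simp add: mtrace_def entry_def cinner.sum_right cinner_scaleC_right cinner_ket_left)
  also have "\<dots> = (\<Sum>c\<in>B. \<Sum>i<n. cinner c (ket i) * seq c i)" by (rule sum.swap)
  also have "\<dots> = of_nat (card B)" by (simp add: b)
  finally show ?thesis using B(4) by simp
qed

lemma rank_le_card:
  assumes "P \<in> projections (mats n)" "range (blinfun_apply P) \<subseteq> cvec.span S" "finite S"
  shows "op_rank P \<le> card S"
proof -
  obtain B where B: "finite B" "orthonormal B" "cvec.span B = range (blinfun_apply P)" "card B = op_rank P"
    by (rule projection_basis[OF assms(1)], rule that) assumption+
  have "B \<subseteq> cvec.span S" using assms(2) cvec.span_superset[of B] unfolding B(3) by (rule subset_trans[rotated])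
  from orthonormal_card_le(2)[OF B(2) this assms(3)] B(4) show ?thesis by simp
qed

lemma rank_pos:
  assumes "P \<in> projections (mats n)" "P \<noteq> 0"
  shows "0 < op_rank P"
proof (rule ccontr)
  obtain B where B: "finite B" "cvec.span B = range (blinfun_apply P)" "card B = op_rank P"
    by (rule projection_basis[OF assms(1)], rule that) assumption+
  assume "\<not> 0 < op_rank P"
  then have "range (blinfun_apply P) = {0}" using B by (simp add: B(2)[symmetric])
  then have "P x = 0" for x by blast
  then have "P = 0" by (intro blinfun_eqI) simp
  with assms(2) show False by contradiction
qed

lemma mats_kets_span: "A \<in> mats n \<Longrightarrow> A x \<in> cvec.span (ket ` {..<n})"
  by (subst mats_apply(1)[symmetric], assumption, unfold one_mat_expansion,
      intro cvec.span_sum cvec.span_scale cvec.span_base) simp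

lemma card_kets: "card (ket ` {..<n}) = n"
  by (simp add: card_image inj_on_subset[OF inj_ket])

text \<open>Orthonormal bases of mutually orthogonal ranges unite to one orthonormal system inside
  the \<open>n\<close>-dimensional space.\<close>

lemma sum_rank_le_of_orthogonal:
  assumes "finite I" and E: "\<And>i. i \<in> I \<Longrightarrow> E i \<in> projections (mats n)"
    and orth: "\<And>i j. i \<in> I \<Longrightarrow> j \<in> I \<Longrightarrow> i \<noteq> j \<Longrightarrow> E i o\<^sub>L E j = 0"
  shows "(\<Sum>i\<in>I. op_rank (E i)) \<le> n"
proof -
  have "\<forall>i\<in>I. \<exists>B. finite B \<and> orthonormal B \<and> card B = op_rank (E i) \<and> (\<forall>b\<in>B. E i b = b)"
    by (intro ballI, rule projection_basis[OF E], assumption) blast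
  then obtain B where B: "\<And>i. i \<in> I \<Longrightarrow> finite (B i) \<and> orthonormal (B i) \<and> card (B i) = op_rank (E i)"
    and EB: "\<And>i b. i \<in> I \<Longrightarrow> b \<in> B i \<Longrightarrow> E i b = b" by metis
  have orthB: "cinner b c = 0" if "i \<in> I" "j \<in> I" "i \<noteq> j" "b \<in> B i" "c \<in> B j" for i j b c
  proof -
    have "cinner b c = cinner (E i b) (E j c)" by (simp only: EB that)
    also have "\<dots> = cinner b ((E i o\<^sub>L E j) c)"
      using projection_apply(2)[OF projection_mats_bops_id[OF E]] that(1) by simp
    finally show ?thesis using orth that(1-3) by (simp add: cinner.zero_right)
  qed
  have disj: "B i \<inter> B j = {}" if "i \<in> I" "j \<in> I" "i \<noteq> j" for i j
  proof -
    have "cinner b b = 1" if "b \<in> B i" for b using B[OF \<open>i \<in> I\<close>] that by (simp add: orthonormal_def)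
    then show ?thesis using orthB[OF that] by fastforce
  qed
  have "orthonormal (\<Union>i\<in>I. B i)"
    unfolding orthonormal_def
  proof (intro ballI)
    fix b c assume "b \<in> (\<Union>i\<in>I. B i)" "c \<in> (\<Union>i\<in>I. B i)"
    then obtain i j where ij: "i \<in> I" "j \<in> I" "b \<in> B i" "c \<in> B j" by blast
    show "cinner b c = (if b = c then 1 else 0)"
    proof (cases "i = j")
      case True
      then show ?thesis using ij B[of i] by (simp add: orthonormal_def)
    next
      case False
      then have "b \<noteq> c" using disj ij by blast
      then show ?thesis using orthB ij False by simp
    qed
  qed
  moreover have "(\<Union>i\<in>I. B i) \<subseteq> cvec.span (ket ` {..<n})"
    using EB mats_kets_span[OF projection_mats[OF E]] by (metis (no_types, lifting) UN_E subsetI)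
  ultimately have "card (\<Union>i\<in>I. B i) \<le> n"
    using orthonormal_card_le(2)[of "\<Union>i\<in>I. B i" "ket ` {..<n}"] by (simp add: card_kets)
  moreover have "card (\<Union>i\<in>I. B i) = (\<Sum>i\<in>I. card (B i))"
    by (rule card_UN_disjoint) (use assms(1) B disj in auto)
  ultimately show ?thesis using B by simp
qed

text \<open>The union \<open>S\<close> of bases of the ranges spans: otherwise some ket has a
  nonzero component orthogonal to \<open>S\<close>, and every projection of the family kills this
  component.\<close>

lemma le_sum_rank_of_joint_kernel:
  assumes "finite I" and P: "\<And>i. i \<in> I \<Longrightarrow> P i \<in> projections (mats n)"
    and ker: "\<And>x. one_mat n x = x \<Longrightarrow> (\<And>i. i \<in> I \<Longrightarrow> P i x = 0) \<Longrightarrow> x = 0"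
  shows "n \<le> (\<Sum>i\<in>I. op_rank (P i))"
proof -
  have "\<forall>i\<in>I. \<exists>B. finite B \<and> cvec.span B = range (blinfun_apply (P i)) \<and> card B = op_rank (P i) \<and> (\<forall>b\<in>B. P i b = b)"
    by (intro ballI, rule projection_basis[OF P], assumption) blast
  then obtain B where B: "\<And>i. i \<in> I \<Longrightarrow> finite (B i) \<and> card (B i) = op_rank (P i)"
    and BP: "\<And>i. i \<in> I \<Longrightarrow> cvec.span (B i) = range (blinfun_apply (P i))"
    and PB: "\<And>i b. i \<in> I \<Longrightarrow> b \<in> B i \<Longrightarrow> P i b = b" by metis
  define S where "S = (\<Union>i\<in>I. B i)"
  have S: "finite S" using assms(1) B by (simp add: S_def)
  have "card S \<le> (\<Sum>i\<in>I. card (B i))" unfolding S_def by (rule card_UN_le[OF assms(1)])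
  then have cardS: "card S \<le> (\<Sum>i\<in>I. op_rank (P i))" using B by simp
  obtain C where C: "finite C" "orthonormal C" "cvec.span C = cvec.span S" using gram_schmidt[OF S] by blast
  have Sn: "one_mat n x = x" if "x \<in> cvec.span S" for x
    using that
  proof (induction rule: cvec.span_induct_alt)
    case base
    show ?case by (simp add: blinfun.zero_right)
  next
    case (step c s z)
    then obtain i where "i \<in> I" "s = P i s" using PB unfolding S_def by force
    then have "one_mat n s = s" using mats_apply(1)[OF projection_mats[OF P]] by metis
    with step show ?case by (simp add: blinfun.add_right mats_scaleC[OF one_mat_in_mats])
  qed
  have "ket i \<in> cvec.span S" if "i < n" for i
  proof -
    let ?p = "\<Sum>c\<in>C. cinner c (ket i) *\<^sub>C c"
    have p: "?p \<in> cvec.span S"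
      unfolding C(3)[symmetric] by (intro cvec.span_sum cvec.span_scale cvec.span_base)
    have orth: "cinner z (ket i - ?p) = 0" if "z \<in> cvec.span S" for z
      by (rule cinner_span_eq_0[OF orthonormal_residual[OF C(2,1)], of C]) (simp_all add: that C(3))
    have "P j (ket i - ?p) = 0" if "j \<in> I" for j
    proof -
      have "cvec.span (B j) \<subseteq> cvec.span S" unfolding S_def using that by (intro cvec.span_mono) blast
      then have "P j (ket i - ?p) \<in> cvec.span S"
        unfolding BP[OF that] by (rule subsetD) (rule rangeI)
      from orth[OF this] show ?thesis
        by (rule projection_eq_0I[OF projection_mats_bops_id[OF P[OF that]]])
    qed
    moreover have "one_mat n (ket i - ?p) = ket i - ?p"
      using Sn[OF p] by (simp add: blinfun.diff_right one_mat_ket[OF \<open>i < n\<close>])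
    ultimately have "ket i - ?p = 0" using ker by blast
    then show ?thesis using p by simp
  qed
  then have "ket ` {..<n} \<subseteq> cvec.span S" by blast
  from orthonormal_card_le(2)[OF orthonormal_ket this S] show ?thesis using cardS by (simp add: card_kets)
qed

text \<open>The matrix \<open>A\<close> as the vector of its columns: this turns the Hilbert--Schmidt norm into a
  Hilbert space norm.\<close>

definition vecm :: "nat \<Rightarrow> complex ell2 op \<Rightarrow> complex ell2 ell2" where
  "vecm n A = Abs_ell2 (\<lambda>j. if j < n then A (ket j) else 0)"

lemma seq_vecm: "seq (vecm n A) j = (if j < n then A (ket j) else 0)"
proof -
  have "summable (\<lambda>j. (norm (if j < n then A (ket j) else 0))\<^sup>2)"
    by (rule summable_finite[of "{..<n}"]) auto
  then show ?thesis by (simp add: vecm_def Abs_ell2_inverse)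
qed

lemma vecm_add: "vecm n (A + B) = vecm n A + vecm n B"
  by (rule ell2_eqI) (simp add: seq_vecm seq_add blinfun.add_left)

lemma vecm_diff: "vecm n (A - B) = vecm n A - vecm n B"
  by (rule ell2_eqI) (simp add: seq_vecm seq_minus blinfun.diff_left)

lemma vecm_scaleC: "vecm n (c *\<^sub>C A) = c *\<^sub>C vecm n A"
  by (rule ell2_eqI) (simp add: seq_vecm seq_scaleC)

lemma vecm_zero: "vecm n 0 = 0"
  by (rule ell2_eqI) (simp add: seq_vecm)

lemma vecm_sum: "vecm n (sum f I) = (\<Sum>i\<in>I. vecm n (f i))"
  by (induction I rule: infinite_finite_induct) (simp_all add: vecm_zero vecm_add)

lemma cinner_vecm: "cinner (vecm n A) (vecm n B) = (\<Sum>j<n. cinner (A (ket j)) (B (ket j)))"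
proof -
  have "(\<lambda>j. cinner (seq (vecm n A) j) (seq (vecm n B) j))
      = (\<lambda>j. if j \<in> {..<n} then cinner (A (ket j)) (B (ket j)) else 0)"
    by (auto simp: seq_vecm cinner.zero_left)
  then show ?thesis
    using sums_unique[OF sums_If_finite_set[of "{..<n}" "\<lambda>j. cinner (A (ket j)) (B (ket j))"]]
    by (simp add: cinner_ell2_def)
qed

lemma vecm_eq_0_iff:
  assumes "A \<in> mats n"
  shows "vecm n A = 0 \<longleftrightarrow> A = 0"
proof
  assume 0: "vecm n A = 0"
  have "A (ket i) = 0" if "i < n" for i
    using arg_cong[OF 0, of "\<lambda>v. seq v i"] that by (simp add: seq_vecm)
  then have "A (one_mat n x) = 0" for x
    by (simp add: one_mat_expansion blinfun.sum_right mats_scaleC[OF assms])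
  then show "A = 0" by (intro blinfun_eqI) (simp add: mats_apply(2)[OF assms])
qed (simp add: vecm_zero)

lemma cinner_one_mat: 
  assumes "one_mat n x = x"
  shows "cinner x y = (\<Sum>i<n. cnj (seq x i) * seq y i)"
proof -
  have "cinner x y = cinner (\<Sum>i<n. seq x i *\<^sub>C ket i) y"
    using assms by (simp add: one_mat_expansion)
  then show ?thesis by (simp add: cinner.sum_left cinner_scaleC_left cinner_ket_left)
qed

lemma entry_eq: "entry A i j = seq (A (ket j)) i"
  by (simp add: entry_def cinner_ket_left)

lemma hs_norm_eq:
  assumes "A \<in> mats n"
  shows "hs_norm n A = norm (vecm n A)"
proof -
  have "complex_of_real ((norm (vecm n A))\<^sup>2) = (\<Sum>j<n. \<Sum>i<n. complex_of_real ((cmod (entry A i j))\<^sup>2))"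
    unfolding cinner_self[symmetric] cinner_vecm entry_eq complex_norm_square
    by (simp add: cinner_one_mat[OF mats_apply(1)[OF assms]] mult.commute)
      (simp add: mult.commute cinner_complex_def)
  also have "\<dots> = complex_of_real (\<Sum>i<n. \<Sum>j<n. (cmod (entry A i j))\<^sup>2)"
    unfolding of_real_sum by (rule sum.swap)
  finally have "(norm (vecm n A))\<^sup>2 = (\<Sum>i<n. \<Sum>j<n. (cmod (entry A i j))\<^sup>2)"
    using of_real_eq_iff by blast
  from this[symmetric] show ?thesis by (simp only: hs_norm_def real_sqrt_abs abs_norm_cancel)
qed

section \<open>Kraus operators\<close>

text \<open>The rank-one operator usually written |x><y|; for kets these are the matrix
  units.\<close>

definition outer :: "'a::chilbert \<Rightarrow> 'a \<Rightarrow> 'a op" where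
  "outer x y = Blinfun (\<lambda>z. cinner y z *\<^sub>C x)"

lemma outer_apply: "outer x y z = cinner y z *\<^sub>C x"
proof -
  have "bounded_linear (\<lambda>z. cinner y z *\<^sub>C x)"
  proof (rule bounded_linear_intro[of _ "norm y * norm x"])
    show "cinner y (z + w) *\<^sub>C x = cinner y z *\<^sub>C x + cinner y w *\<^sub>C x" for z w
      by (simp add: cinner_add_right scaleC_add_left)
    show "cinner y (r *\<^sub>R z) *\<^sub>C x = r *\<^sub>R cinner y z *\<^sub>C x" for r z
      by (simp add: cinner_scaleC_right scaleC_scaleC flip: scaleC_of_real)
    show "norm (cinner y z *\<^sub>C x) \<le> norm z * (norm y * norm x)" for z
      using mult_right_mono[OF norm_cinner_le[of y z], of "norm x"] by (simp add: norm_scaleC mult_ac)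
  qed
  then show ?thesis by (simp add: outer_def bounded_linear_Blinfun_apply)
qed

lemma outer_in_mats:
  assumes "one_mat n x = x" "one_mat n y = y"
  shows "outer x y \<in> mats n"
proof (rule matsI)
  show "one_mat n (outer x y z) = outer x y z" for z
    by (simp add: outer_apply mats_scaleC[OF one_mat_in_mats] assms(1))
  show "outer x y (one_mat n z) = outer x y z" for z
    by (simp add: outer_apply projection_apply(2)[OF one_mat_projection, symmetric] assms(2))
  show "outer x y (c *\<^sub>C z) = c *\<^sub>C outer x y z" for c z
    by (simp add: outer_apply cinner_scaleC_right scaleC_scaleC)
qed

lemma compose_scaleC_right: "A \<in> bops id_blinfun \<Longrightarrow> A o\<^sub>L (c *\<^sub>C B) = c *\<^sub>C (A o\<^sub>L B)"
  by (rule blinfun_eqI) (simp add: bops_id_iff)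

lemma compose_scaleC_left: "(c *\<^sub>C A) o\<^sub>L B = c *\<^sub>C (A o\<^sub>L B)"
  for A B :: "'a::chilbert op"
  by (rule blinfun_eqI) simp

lemma compose_add_right: "A o\<^sub>L (B + C) = (A o\<^sub>L B) + (A o\<^sub>L C)"
  by (rule blinfun_eqI) (simp add: blinfun.bilinear_simps)

lemma compose_add_left: "(A + B) o\<^sub>L C = (A o\<^sub>L C) + (B o\<^sub>L C)"
  by (rule blinfun_eqI) (simp add: blinfun.bilinear_simps)

lemma compose_zero [simp]: "A o\<^sub>L 0 = 0" "0 o\<^sub>L A = 0"
  by (rule blinfun_eqI, simp add: blinfun.bilinear_simps)+

lemma adj_scaleC: "A \<in> bops id_blinfun \<Longrightarrow> adj (c *\<^sub>C A) = cnj c *\<^sub>C adj A"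
  by (rule adj_eqI) (simp add: cinner_scaleC_left cinner_scaleC_right cinner_adj(1))

lemma adj_add:
  "A \<in> bops id_blinfun \<Longrightarrow> B \<in> bops id_blinfun \<Longrightarrow> adj (A + B) = adj A + adj B"
  by (rule adj_eqI) (simp add: blinfun.add_left cinner_add_left cinner_add_right cinner_adj(1))

text \<open>Conjugate linearity of \<open>adj\<close> is harmless inside a complex span. With a
  Kraus family as \<open>S\<close>, the set on the right generates the subspace at parameter 1 of
  the induced metric.\<close>

lemma adj_compose_in_span:
  assumes S: "S \<subseteq> bops id_blinfun" and A: "A \<in> cvec.span S" and B: "B \<in> cvec.span S"
  shows "adj A o\<^sub>L B \<in> cvec.span {adj a o\<^sub>L b | a b. a \<in> S \<and> b \<in> S}" (is "_ \<in> ?T")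
proof -
  have 1: "adj a o\<^sub>L B \<in> ?T" if a: "a \<in> S" for a
    using B
  proof (induction rule: cvec.span_induct_alt)
    case base
    show ?case by (simp add: cvec.span_zero)
  next
    case (step c b z)
    have "adj a \<in> bops id_blinfun" using S a by (blast intro: adj_in_bops_id)
    moreover have "adj a o\<^sub>L b \<in> ?T" using a step(1) by (blast intro: cvec.span_base)
    ultimately show ?case using step(2)
      by (simp add: compose_add_right compose_scaleC_right cvec.span_add cvec.span_scale)
  qed
  have "A \<in> bops id_blinfun \<and> adj A o\<^sub>L B \<in> ?T" using A
  proof (induction rule: cvec.span_induct_alt)
    case base
    show ?case using cvec.subspace_0[OF subspace_bops] by (simp add: cvec.span_zero)
  next
    case (step c a z)
    have a: "a \<in> bops id_blinfun" and z: "z \<in> bops id_blinfun"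
      using S step by blast+
    have "c *\<^sub>C a \<in> bops id_blinfun" using a by (rule cvec.subspace_scale[OF subspace_bops])
    then have "adj (c *\<^sub>C a + z) o\<^sub>L B = cnj c *\<^sub>C (adj a o\<^sub>L B) + (adj z o\<^sub>L B)"
      using a z by (simp add: adj_add adj_scaleC compose_add_left compose_scaleC_left)
    then show ?case
      using 1[OF step(1)] step(2) \<open>c *\<^sub>C a \<in> bops id_blinfun\<close> z cvec.subspace_add[OF subspace_bops]
      by (simp add: cvec.span_add cvec.span_scale)
  qed
  then show ?thesis ..
qed

text \<open>The right-hand side is the quadratic form of the Choi matrix of \<open>\<Phi>\<close>,
  with blocks \<open>\<Phi> (outer (ket j) (ket k))\<close>, at the vector of columns of
  \<open>C\<close>. It makes no reference to the Kraus operators.\<close>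

lemma kraus_cinner:
  assumes K: "kraus_rep n N K \<Phi>"
  shows "(\<Sum>i<N. complex_of_real ((cmod (cinner (vecm n C) (vecm n (K i))))\<^sup>2))
    = (\<Sum>j<n. \<Sum>k<n. cinner (C (ket j)) (\<Phi> (outer (ket j) (ket k)) (C (ket k))))"
proof -
  have \<Phi>: "\<Phi> (outer (ket j) (ket k)) (C (ket k))
      = (\<Sum>i<N. cinner (K i (ket k)) (C (ket k)) *\<^sub>C K i (ket j))" if "j < n" "k < n" for j k
  proof -
    have "\<Phi> (outer (ket j) (ket k)) = (\<Sum>i<N. K i o\<^sub>L outer (ket j) (ket k) o\<^sub>L adj (K i))"
      using K outer_in_mats one_mat_ket that by (simp add: kraus_rep_def)
    moreover have "(K i o\<^sub>L outer (ket j) (ket k) o\<^sub>L adj (K i)) (C (ket k))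
        = cinner (K i (ket k)) (C (ket k)) *\<^sub>C K i (ket j)" if "i < N" for i
    proof -
      have Ki: "K i \<in> mats n" using K that by (simp add: kraus_rep_def)
      show ?thesis by (simp add: outer_apply cinner_adj(1)[OF mats_bops_id[OF Ki]] mats_scaleC[OF Ki])
    qed
    ultimately show ?thesis by (simp add: blinfun.sum_left)
  qed
  have "complex_of_real ((cmod (cinner (vecm n C) (vecm n (K i))))\<^sup>2)
      = (\<Sum>j<n. \<Sum>k<n. cinner (K i (ket k)) (C (ket k)) * cinner (C (ket j)) (K i (ket j)))" for i
  proof -
    have "cnj (cinner (vecm n C) (vecm n (K i))) = cinner (vecm n (K i)) (vecm n C)"
      by (metis cinner_commute)
    then show ?thesis
      unfolding complex_norm_square by (simp add: cinner_vecm sum_product mult.commute)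
  qed
  then have "(\<Sum>i<N. complex_of_real ((cmod (cinner (vecm n C) (vecm n (K i))))\<^sup>2))
    = (\<Sum>i<N. \<Sum>j<n. \<Sum>k<n. cinner (K i (ket k)) (C (ket k)) * cinner (C (ket j)) (K i (ket j)))"
    by simp
  also have "\<dots> = (\<Sum>j<n. \<Sum>i<N. \<Sum>k<n. cinner (K i (ket k)) (C (ket k)) * cinner (C (ket j)) (K i (ket j)))"
    by (rule sum.swap)
  also have "\<dots> = (\<Sum>j<n. \<Sum>k<n. \<Sum>i<N. cinner (K i (ket k)) (C (ket k)) * cinner (C (ket j)) (K i (ket j)))"
    by (intro sum.cong refl sum.swap)
  also have "\<dots> = (\<Sum>j<n. \<Sum>k<n. cinner (C (ket j)) (\<Phi> (outer (ket j) (ket k)) (C (ket k))))"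
    by (simp add: \<Phi> cinner.sum_right cinner_scaleC_right)
  finally show ?thesis .
qed

lemma span_vecm_image:
  assumes "p \<in> cvec.span (vecm n ` S)"
  obtains A where "A \<in> cvec.span S" "p = vecm n A"
proof -
  from assms have "\<exists>A\<in>cvec.span S. p = vecm n A"
  proof (induction rule: cvec.span_induct_alt)
    case base
    show ?case by (rule bexI[of _ 0]) (simp_all add: vecm_zero cvec.span_zero)
  next
    case (step c x y)
    then obtain B A where "B \<in> S" "x = vecm n B" "A \<in> cvec.span S" "y = vecm n A" by blast
    then show ?case
      by (intro bexI[of _ "c *\<^sub>C B + A"])
        (simp_all add: vecm_add vecm_scaleC cvec.span_add cvec.span_scale cvec.span_base)
  qed
  with that show ?thesis by blast
qed

text \<open>The sum in \<open>kraus_cinner\<close> depends only on the map, so a component orthogonal to one Kraus family is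
  orthogonal to the other.\<close>

lemma kraus_in_span:
  assumes K: "kraus_rep n N K \<Phi>" and L: "kraus_rep n M L \<Phi>" and "i < N"
  shows "K i \<in> cvec.span (L ` {..<M})"
proof -
  have Lm: "L ` {..<M} \<subseteq> mats n" using L by (auto simp: kraus_rep_def)
  have Ki: "K i \<in> mats n" using K \<open>i < N\<close> by (simp add: kraus_rep_def)
  obtain B where B: "finite B" "orthonormal B" "cvec.span B = cvec.span (vecm n ` L ` {..<M})"
    using gram_schmidt[of "vecm n ` L ` {..<M}"] by blast
  define p where "p = (\<Sum>b\<in>B. cinner b (vecm n (K i)) *\<^sub>C b)"
  have "p \<in> cvec.span B"
    unfolding p_def by (intro cvec.span_sum cvec.span_scale cvec.span_base)
  then have pL: "p \<in> cvec.span (vecm n ` L ` {..<M})" by (simp only: B(3))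
  then obtain G where G: "G \<in> cvec.span (L ` {..<M})" "p = vecm n G"
    using span_vecm_image by blast
  have Gm: "G \<in> mats n" using G(1) cvec.span_minimal[OF Lm subspace_mats] by blast
  \<comment> \<open>\<open>C\<close> is the component of \<open>K i\<close> orthogonal to the span
    of the family \<open>L\<close>; the aim is \<open>C = 0\<close>.\<close>
  define C where "C = K i - G"
  have vC: "vecm n C = vecm n (K i) - p" by (simp add: C_def vecm_diff G(2))
  have orth: "cinner z (vecm n C) = 0" if "z \<in> cvec.span (vecm n ` L ` {..<M})" for z
    unfolding vC p_def
    by (rule cinner_span_eq_0[OF orthonormal_residual[OF B(2,1)], of B]) (simp_all add: that B(3))
  have "(\<Sum>i<N. complex_of_real ((cmod (cinner (vecm n C) (vecm n (K i))))\<^sup>2))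
      = (\<Sum>i<M. complex_of_real ((cmod (cinner (vecm n C) (vecm n (L i))))\<^sup>2))"
    by (simp only: kraus_cinner[OF K] kraus_cinner[OF L])
  also have "\<dots> = 0"
  proof (intro sum.neutral ballI)
    fix j assume "j \<in> {..<M}"
    then have "vecm n (L j) \<in> cvec.span (vecm n ` L ` {..<M})" by (intro cvec.span_base) simp
    then have "cinner (vecm n C) (vecm n (L j)) = 0"
      using orth cinner_eq_0_commute by blast
    then show "complex_of_real ((cmod (cinner (vecm n C) (vecm n (L j))))\<^sup>2) = 0" by simp
  qed
  finally have "complex_of_real (\<Sum>i<N. (cmod (cinner (vecm n C) (vecm n (K i))))\<^sup>2) = 0"
    by (simp only: of_real_sum)
  then have "(\<Sum>i<N. (cmod (cinner (vecm n C) (vecm n (K i))))\<^sup>2) = 0"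
    by (simp only: of_real_eq_0_iff)
  then have "cinner (vecm n C) (vecm n (K i)) = 0"
    using \<open>i < N\<close> by (subst (asm) sum_nonneg_eq_0_iff) auto
  moreover have "cinner (vecm n C) p = 0" using orth[OF pL] cinner_eq_0_commute by blast
  ultimately have "cinner (vecm n C) (vecm n C) = 0" by (subst (2) vC) (simp add: cinner.diff_right)
  then have "vecm n C = 0" by simp
  moreover have "C \<in> mats n" unfolding C_def using Ki Gm by (rule cvec.subspace_diff[OF subspace_mats])
  ultimately have "K i = G" by (simp add: C_def vecm_eq_0_iff)
  with G(1) show ?thesis by simp
qed

section \<open>Expansion from the spectral gap\<close>

lemma mats_compose_one_mat:
  assumes "A \<in> mats n"
  shows "A o\<^sub>L one_mat n = A" "one_mat n o\<^sub>L A = A"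
  using assms by (auto simp: mats_def bops_def)

lemma foldr_compose_mats: "set As \<subseteq> mats n \<Longrightarrow> foldr (o\<^sub>L) As (one_mat n) \<in> mats n"
  by (induction As) (simp_all add: one_mat_in_mats mats_compose)

lemma foldr_compose_right:
  "B \<in> mats n \<Longrightarrow> foldr (o\<^sub>L) As B = foldr (o\<^sub>L) As (one_mat n) o\<^sub>L B"
proof (induction As)
  case Nil
  then show ?case by (simp add: mats_compose_one_mat)
next
  case (Cons A As)
  from Cons.IH[OF Cons.prems] show ?case by (simp add: blinfun_compose_assoc)
qed

lemma span_power_subset_mats:
  assumes "V \<subseteq> mats n"
  shows "span_power n V k \<subseteq> mats n"
  unfolding span_power_def
  by (rule cvec.span_minimal[OF _ subspace_mats]) (use assms foldr_compose_mats in blast)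

text \<open>The further factor goes on the right because later the adjoints \<open>adj A\<close> act
  on vectors: applying one more operator after \<open>adj A\<close> lengthens \<open>A\<close> at
  its right end.\<close>

lemma span_power_compose_right:
  assumes V: "V \<subseteq> mats n" and A: "A \<in> span_power n V k" and W: "W \<in> V"
  shows "A o\<^sub>L W \<in> span_power n V (Suc k)"
  using A unfolding span_power_def[of n V k]
proof (induction rule: cvec.span_induct_alt)
  case base
  show ?case by (simp add: span_power_def cvec.span_zero)
next
  case (step c B z)
  then obtain As where As: "B = foldr (o\<^sub>L) As (one_mat n)" "length As = k" "set As \<subseteq> V" by blast
  have Wm: "W \<in> mats n" using V W by blast
  have "foldr (o\<^sub>L) (As @ [W]) (one_mat n) = foldr (o\<^sub>L) As W"
    using Wm by (simp add: mats_compose_one_mat)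
  then have "B o\<^sub>L W = foldr (o\<^sub>L) (As @ [W]) (one_mat n)"
    using foldr_compose_right[OF Wm] As(1) by metis
  moreover have "length (As @ [W]) = Suc k" "set (As @ [W]) \<subseteq> V" using As W by auto
  ultimately have "B o\<^sub>L W \<in> span_power n V (Suc k)"
    unfolding span_power_def by (intro cvec.span_base) blast
  then show ?case
    using step(2) unfolding span_power_def
    by (simp add: compose_add_left compose_scaleC_left cvec.span_add cvec.span_scale)
qed

text \<open>Shorter products are padded with the identity.\<close>

lemma span_power_mono:
  assumes V: "V \<subseteq> mats n" "one_mat n \<in> V" and "j \<le> k"
  shows "span_power n V j \<subseteq> span_power n V k"
  using \<open>j \<le> k\<close>
proof (induction rule: dec_induct)
  case (step k)
  have "A \<in> span_power n V (Suc k)" if A: "A \<in> span_power n V k" for A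
  proof -
    have "A o\<^sub>L one_mat n = A"
      using span_power_subset_mats[OF V(1)] A by (blast intro: mats_compose_one_mat)
    then show ?thesis using span_power_compose_right[OF V(1) A V(2)] by simp
  qed
  with step show ?case by blast
qed simp

lemma span_apply_in_span:
  assumes W: "W \<subseteq> bops id_blinfun" and A: "A \<in> cvec.span W" and z: "z \<in> cvec.span S"
  shows "A z \<in> cvec.span {blinfun_apply w s | w s. w \<in> W \<and> s \<in> S}" (is "_ \<in> ?T")
proof -
  have 1: "w z \<in> ?T" if w: "w \<in> W" for w
    using z
  proof (induction rule: cvec.span_induct_alt)
    case base
    show ?case by (simp add: cvec.span_zero blinfun.zero_right)
  next
    case (step c s y)
    have "w (c *\<^sub>C s) = c *\<^sub>C w s" using W w by (auto simp: bops_id_iff)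
    moreover have "w s \<in> ?T" using w step(1) by (blast intro: cvec.span_base)
    ultimately show ?case using step(2)
      by (simp add: blinfun.add_right cvec.span_add cvec.span_scale)
  qed
  show ?thesis using A
  proof (induction rule: cvec.span_induct_alt)
    case base
    show ?case by (simp add: cvec.span_zero)
  next
    case (step c a y)
    then show ?case using 1[OF step(1)]
      by (simp add: blinfun.add_left cvec.span_add cvec.span_scale)
  qed
qed

text \<open>Products are multilinear in their factors, so their values at one vector are spanned by
  the values of words in \<open>W\<close> alone. The bound involves the number of generators and the
  length, not \<open>n\<close>.\<close>

lemma span_power_apply_in_span:
  assumes W: "W \<subseteq> mats n" "finite W"
  obtains S where "finite S" "card S \<le> card W ^ k"
    "\<And>A. A \<in> span_power n (cvec.span W) k \<Longrightarrow> A x \<in> cvec.span S"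
proof -
  have Wb: "W \<subseteq> bops id_blinfun" using W(1) mats_bops_id by blast
  have "\<exists>S. finite S \<and> card S \<le> card W ^ k \<and>
    (\<forall>As. length As = k \<and> set As \<subseteq> cvec.span W \<longrightarrow> foldr (o\<^sub>L) As (one_mat n) x \<in> cvec.span S)"
  proof (induction k)
    case 0
    show ?case by (rule exI[of _ "{one_mat n x}"]) (simp add: cvec.span_base)
  next
    case (Suc k)
    then obtain S where S: "finite S" "card S \<le> card W ^ k"
      "\<And>As. length As = k \<Longrightarrow> set As \<subseteq> cvec.span W \<Longrightarrow> foldr (o\<^sub>L) As (one_mat n) x \<in> cvec.span S"
      by blast
    define T where "T = {blinfun_apply w s | w s. w \<in> W \<and> s \<in> S}"
    have T: "T = (\<lambda>(w, s). blinfun_apply w s) ` (W \<times> S)" by (auto simp: T_def)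
    have "finite T" unfolding T using W(2) S(1) by simp
    moreover have "card T \<le> card W ^ Suc k"
    proof -
      have "card T \<le> card (W \<times> S)" unfolding T using W(2) S(1) by (intro card_image_le) simp
      also have "\<dots> \<le> card W * card W ^ k" using S(2) by (simp add: card_cartesian_product)
      finally show ?thesis by simp
    qed
    moreover have "foldr (o\<^sub>L) As (one_mat n) x \<in> cvec.span T"
      if As: "length As = Suc k" "set As \<subseteq> cvec.span W" for As
    proof -
      obtain A Bs where AB: "As = A # Bs" "length Bs = k" using As(1) by (cases As) auto
      then have "A \<in> cvec.span W" "foldr (o\<^sub>L) Bs (one_mat n) x \<in> cvec.span S" using As(2) S(3) by auto
      from span_apply_in_span[OF Wb this] show ?thesis by (simp add: AB(1) T_def)
    qed
    ultimately show ?case by blast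
  qed
  then obtain S where S: "finite S" "card S \<le> card W ^ k"
    "\<And>As. length As = k \<Longrightarrow> set As \<subseteq> cvec.span W \<Longrightarrow> foldr (o\<^sub>L) As (one_mat n) x \<in> cvec.span S"
    by blast
  have "A x \<in> cvec.span S" if "A \<in> span_power n (cvec.span W) k" for A
    using that unfolding span_power_def
  proof (induction rule: cvec.span_induct_alt)
    case base
    show ?case by (simp add: cvec.span_zero)
  next
    case (step c B z)
    then show ?case using S(3) by (auto simp: blinfun.add_left intro!: cvec.span_add cvec.span_scale)
  qed
  with S that show ?thesis by blast
qed

section \<open>Hilbert-Schmidt adjoints of Kraus maps\<close>

lemma cinner_vecm_adj:
  assumes "A \<in> mats n" "B \<in> mats n"
  shows "cinner (vecm n (adj A)) (vecm n (adj B)) = cinner (vecm n B) (vecm n A)"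
proof -
  have e: "cinner (vecm n A) (vecm n B) = (\<Sum>j<n. \<Sum>i<n. cnj (entry A i j) * entry B i j)"
    if "A \<in> mats n" for A B
    unfolding cinner_vecm entry_eq by (simp add: cinner_one_mat[OF mats_apply(1)[OF that]])
  have adj: "entry (adj A) i j = cnj (entry A j i)" if "A \<in> mats n" for A i j
    unfolding entry_def by (metis cinner_adj(1)[OF mats_bops_id[OF that]] cinner_commute)
  have "cinner (vecm n (adj A)) (vecm n (adj B)) = (\<Sum>j<n. \<Sum>i<n. entry A j i * cnj (entry B j i))"
    by (simp add: e mats_adj assms adj)
  also have "\<dots> = (\<Sum>i<n. \<Sum>j<n. entry A j i * cnj (entry B j i))" by (rule sum.swap)
  also have "\<dots> = cinner (vecm n B) (vecm n A)" by (simp add: e assms mult.commute)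
  finally show ?thesis .
qed

lemma cinner_vecm_left:
  assumes "A \<in> mats n"
  shows "cinner (vecm n (A o\<^sub>L X)) (vecm n Y) = cinner (vecm n X) (vecm n (adj A o\<^sub>L Y))"
  by (simp add: cinner_vecm cinner_adj(1)[OF mats_bops_id[OF assms]])

text \<open>Taking adjoints is antiunitary for the Hilbert-Schmidt inner product and exchanges right
  with left multiplication, for which the rule is immediate.\<close>

lemma cinner_vecm_right:
  assumes "A \<in> mats n" "X \<in> mats n" "Y \<in> mats n"
  shows "cinner (vecm n (X o\<^sub>L A)) (vecm n Y) = cinner (vecm n X) (vecm n (Y o\<^sub>L adj A))"
proof -
  note b = assms[THEN mats_bops_id]
  have "cinner (vecm n (X o\<^sub>L A)) (vecm n Y) = cinner (vecm n (adj Y)) (vecm n (adj A o\<^sub>L adj X))"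
    using cinner_vecm_adj[of Y n "X o\<^sub>L A"] assms by (simp add: mats_compose adj_compose b)
  also have "\<dots> = cinner (vecm n (adj (Y o\<^sub>L adj A))) (vecm n (adj X))"
    using cinner_vecm_left[of "A" n "adj Y" "adj X"] assms
    by (simp add: adj_compose adj_adj b adj_in_bops_id)
  also have "\<dots> = cinner (vecm n X) (vecm n (Y o\<^sub>L adj A))"
    using assms by (simp add: cinner_vecm_adj mats_compose mats_adj)
  finally show ?thesis .
qed

text \<open>The Kraus form of a map. Its Hilbert-Schmidt adjoint is the same form with
  \<open>adj (L j)\<close> for \<open>L j\<close>, so adjoint maps are handled without a notion of
  their own.\<close>

definition sandwich :: "nat \<Rightarrow> (nat \<Rightarrow> 'a::chilbert op) \<Rightarrow> 'a op \<Rightarrow> 'a op" where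
  "sandwich d L X = (\<Sum>j<d. L j o\<^sub>L X o\<^sub>L adj (L j))"

lemma sandwich_mats:
  "(\<And>j. j < d \<Longrightarrow> L j \<in> mats n) \<Longrightarrow> X \<in> mats n \<Longrightarrow> sandwich d L X \<in> mats n"
  unfolding sandwich_def by (intro mats_sum mats_compose mats_adj) simp_all

lemma sandwich_add_scaleC:
  assumes "\<And>j. j < d \<Longrightarrow> L j \<in> bops id_blinfun"
  shows "sandwich d L (X + c *\<^sub>C Y) = sandwich d L X + c *\<^sub>C sandwich d L Y"
  unfolding sandwich_def cvec.scale_sum_right sum.distrib[symmetric]
  by (intro sum.cong refl)
    (simp add: assms compose_add_left compose_add_right compose_scaleC_left compose_scaleC_right)

lemma cinner_vecm_sandwich:
  assumes L: "\<And>j. j < d \<Longrightarrow> L j \<in> mats n" and X: "X \<in> mats n" and Y: "Y \<in> mats n"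
  shows "cinner (vecm n (sandwich d L X)) (vecm n Y)
    = cinner (vecm n X) (vecm n (sandwich d (\<lambda>j. adj (L j)) Y))"
  unfolding sandwich_def vecm_sum cinner.sum_left cinner.sum_right
proof (rule sum.cong)
  fix j assume "j \<in> {..<d}"
  then have Lj: "L j \<in> mats n" using L by simp
  then show "cinner (vecm n (L j o\<^sub>L X o\<^sub>L adj (L j))) (vecm n Y)
      = cinner (vecm n X) (vecm n (adj (L j) o\<^sub>L Y o\<^sub>L adj (adj (L j))))"
    using X Y by (subst cinner_vecm_right)
      (simp_all add: cinner_vecm_left mats_adj mats_compose blinfun_compose_assoc)
qed simp

lemma mtrace_eq: "mtrace n X = cinner (vecm n (one_mat n)) (vecm n X)"
  by (simp add: mtrace_def entry_def cinner_vecm one_mat_ket)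

lemma norm_vecm_projection:
  assumes "P \<in> projections (mats n)"
  shows "(norm (vecm n P))\<^sup>2 = real (op_rank P)"
proof -
  have "cinner (vecm n P) (vecm n P) = mtrace n P"
    by (simp add: cinner_vecm mtrace_def entry_def projection_apply(3)[OF projection_mats_bops_id[OF assms]])
  then have "complex_of_real ((norm (vecm n P))\<^sup>2) = complex_of_real (real (op_rank P))"
    by (simp add: cinner_self mtrace_projection[OF assms])
  then show ?thesis using of_real_eq_iff by blast
qed

lemma one_mat_projection_mats: "one_mat n \<in> projections (mats n)"
  using one_mat_in_mats by (simp add: projections_def)

lemma op_rank_one_mat: "op_rank (one_mat n) = n"
proof -
  have "mtrace n (one_mat n) = of_nat n" by (simp add: mtrace_def entry_def one_mat_ket cinner_ket_left seq_ket)
  then show ?thesis using mtrace_projection[OF one_mat_projection_mats] of_nat_eq_iff by metis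
qed

text \<open>The factor \<open>1 / sqrt d\<close> is absorbed into \<open>L\<close>, and unitarity
  survives as unitality and trace preservation. On traceless matrices the scalar terms of the
  spectral gap vanish.\<close>

locale kraus_expander =
  fixes n d :: nat and L :: "nat \<Rightarrow> complex ell2 op" and \<epsilon> :: real
  assumes n: "0 < n" and L: "j < d \<Longrightarrow> L j \<in> mats n"
    and unital: "(\<Sum>j<d. L j o\<^sub>L adj (L j)) = one_mat n"
    and trace_preserving: "(\<Sum>j<d. adj (L j) o\<^sub>L L j) = one_mat n"
    and gap: "X \<in> mats n \<Longrightarrow> mtrace n X = 0 \<Longrightarrow>
      norm (vecm n (sandwich d L X)) \<le> (1 - \<epsilon>) * norm (vecm n X)"
    and \<epsilon>: "0 < \<epsilon>" "\<epsilon> < 1"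
begin

definition generators :: "complex ell2 op set" where
  "generators = {adj (L j) o\<^sub>L L i | i j. i < d \<and> j < d}"

text \<open>Its Kraus operators \<open>adj (L j) o\<^sub>L L i\<close> are precisely the generators,
  so \<open>k\<close> iterations stay within distance \<open>k\<close> in the induced
  metric.\<close>

definition \<Psi> :: "complex ell2 op \<Rightarrow> complex ell2 op" where
  "\<Psi> X = sandwich d (\<lambda>j. adj (L j)) (sandwich d L X)"

lemma generators_mats: "generators \<subseteq> mats n"
  by (auto simp: generators_def intro!: mats_compose mats_adj L)

lemma span_generators_mats: "cvec.span generators \<subseteq> mats n"
  by (rule cvec.span_minimal[OF generators_mats subspace_mats])

text \<open>Trace preservation exhibits the identity as a sum of diagonal generators, which makes
  the powers of the span increase.\<close>

lemma one_mat_in_span: "one_mat n \<in> cvec.span generators"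
  unfolding trace_preserving[symmetric]
  by (intro cvec.span_sum cvec.span_base) (auto simp: generators_def)

lemma card_generators: "finite generators" "card generators \<le> d\<^sup>2"
proof -
  have g: "generators = (\<lambda>(i, j). adj (L j) o\<^sub>L L i) ` ({..<d} \<times> {..<d})"
    by (auto simp: generators_def)
  show "finite generators" unfolding g by simp
  show "card generators \<le> d\<^sup>2"
    unfolding g using card_image_le[of "{..<d} \<times> {..<d}" "\<lambda>(i, j). adj (L j) o\<^sub>L L i"]
    by (simp add: card_cartesian_product power2_eq_square)
qed

text \<open>Compressing \<open>outer y x\<close> by \<open>P\<close> gives an element of the power
  that sends a fixed nonzero \<open>x\<close> of the range to a nonzero multiple of an arbitrary
  \<open>y\<close> of the range. The whole range thus lies in the orbit of \<open>x\<close>, whose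
  dimension is controlled.\<close>

lemma rank_bound:
  assumes P: "P \<in> projections (mats n)"
    and PAP: "\<And>A. A \<in> mats n \<Longrightarrow> P o\<^sub>L A o\<^sub>L P \<in> span_power n (cvec.span generators) k"
  shows "op_rank P \<le> (d\<^sup>2) ^ k"
proof (cases "P = 0")
  case True
  then have "op_rank P \<le> card ({} :: complex ell2 set)" by (intro rank_le_card[OF P]) (auto simp: True)
  then show ?thesis by simp
next
  case False
  then obtain x0 where "P x0 \<noteq> 0" using blinfun_eqI[of P 0] by auto
  define x where "x = P x0"
  have x: "P x = x" "x \<noteq> 0"
    using \<open>P x0 \<noteq> 0\<close> by (simp_all add: x_def projection_apply(1)[OF projection_mats_bops_id[OF P]])
  obtain S where S: "finite S" "card S \<le> card generators ^ k"
    "\<And>A. A \<in> span_power n (cvec.span generators) k \<Longrightarrow> A x \<in> cvec.span S"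
    using span_power_apply_in_span[OF generators_mats card_generators(1)] by blast
  have "y \<in> cvec.span S" if "y \<in> range (blinfun_apply P)" for y
  proof -
    have y: "P y = y" using that by (simp add: in_range_projection_iff[OF projection_mats_bops_id[OF P]])
    have "one_mat n z = z" if "P z = z" for z using mats_apply(1)[OF projection_mats[OF P], of z] that by simp
    then have "outer y x \<in> mats n" using x y by (intro outer_in_mats) auto
    from S(3)[OF PAP[OF this]] have "cinner x x *\<^sub>C y \<in> cvec.span S"
      by (simp add: x y outer_apply mats_scaleC[OF projection_mats[OF P]])
    then have "inverse (cinner x x) *\<^sub>C cinner x x *\<^sub>C y \<in> cvec.span S" by (rule cvec.span_scale)
    then show ?thesis using x(2) by (simp add: scaleC_scaleC)
  qed
  then have "op_rank P \<le> card S" by (intro rank_le_card[OF P] S(1)) blast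
  also have "\<dots> \<le> (d\<^sup>2) ^ k" using S(2) power_mono[OF card_generators(2), of k] by simp
  finally show ?thesis .
qed

lemma L': "j < d \<Longrightarrow> adj (L j) \<in> mats n"
  by (intro mats_adj L)

lemma sandwich_adj_adj: "sandwich d (\<lambda>j. adj (adj (L j))) X = sandwich d L X"
  unfolding sandwich_def by (intro sum.cong refl) (simp add: adj_adj mats_bops_id[OF L])

lemma sandwich_one: "sandwich d L (one_mat n) = one_mat n"
  "sandwich d (\<lambda>j. adj (L j)) (one_mat n) = one_mat n"
proof -
  have "L j o\<^sub>L one_mat n = L j" "adj (L j) o\<^sub>L one_mat n = adj (L j)" if "j < d" for j
    using L[OF that] L'[OF that] by (simp_all add: mats_compose_one_mat)
  then show "sandwich d L (one_mat n) = one_mat n"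
    "sandwich d (\<lambda>j. adj (L j)) (one_mat n) = one_mat n"
    by (simp_all add: sandwich_def adj_adj mats_bops_id[OF L] unital trace_preserving)
qed

text \<open>The trace is the Hilbert-Schmidt product with the identity, which both the map and its
  adjoint fix.\<close>

lemma mtrace_sandwich:
  assumes "X \<in> mats n"
  shows "mtrace n (sandwich d L X) = mtrace n X" "mtrace n (sandwich d (\<lambda>j. adj (L j)) X) = mtrace n X"
  using cinner_vecm_sandwich[of d L n "one_mat n" X]
    cinner_vecm_sandwich[of d "\<lambda>j. adj (L j)" n "one_mat n" X]
  by (simp_all add: mtrace_eq L L' one_mat_in_mats assms sandwich_one sandwich_adj_adj)

lemma \<Psi>_mats: "X \<in> mats n \<Longrightarrow> \<Psi> X \<in> mats n"
  unfolding \<Psi>_def by (intro sandwich_mats L L')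

lemma \<Psi>_add_scaleC: "X \<in> mats n \<Longrightarrow> Y \<in> mats n \<Longrightarrow> \<Psi> (X + c *\<^sub>C Y) = \<Psi> X + c *\<^sub>C \<Psi> Y"
  unfolding \<Psi>_def by (simp add: sandwich_add_scaleC mats_bops_id[OF L] mats_bops_id[OF L'])

lemma \<Psi>_one: "\<Psi> (one_mat n) = one_mat n"
  by (simp add: \<Psi>_def sandwich_one)

lemma mtrace_\<Psi>: "X \<in> mats n \<Longrightarrow> mtrace n (\<Psi> X) = mtrace n X"
  by (simp add: \<Psi>_def mtrace_sandwich sandwich_mats L)

text \<open>The gap passes to the adjoint map, since \<open>\<parallel>\<Phi>\<^sup>*Y\<parallel>\<^sup>2 = \<langle>Y, \<Phi>\<Phi>\<^sup>*Y\<rangle>\<close>.\<close>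

lemma gap_adj:
  assumes Y: "Y \<in> mats n" "mtrace n Y = 0"
  shows "norm (vecm n (sandwich d (\<lambda>j. adj (L j)) Y)) \<le> (1 - \<epsilon>) * norm (vecm n Y)"
proof -
  let ?Z = "sandwich d (\<lambda>j. adj (L j)) Y"
  have Z: "?Z \<in> mats n" "mtrace n ?Z = 0" using Y by (auto intro: sandwich_mats L' simp: mtrace_sandwich)
  have "(norm (vecm n ?Z))\<^sup>2 = cmod (cinner (vecm n ?Z) (vecm n ?Z))"
    by (simp add: cinner_self norm_power)
  also have "cinner (vecm n ?Z) (vecm n ?Z) = cinner (vecm n Y) (vecm n (sandwich d L ?Z))"
    using cinner_vecm_sandwich[of d "\<lambda>j. adj (L j)" n Y ?Z] L' Y Z by (simp add: sandwich_adj_adj)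
  also have "cmod \<dots> \<le> norm (vecm n Y) * norm (vecm n (sandwich d L ?Z))" by (rule norm_cinner_le)
  also have "\<dots> \<le> norm (vecm n Y) * ((1 - \<epsilon>) * norm (vecm n ?Z))"
    by (intro mult_left_mono gap Z) simp
  finally have "norm (vecm n ?Z) * norm (vecm n ?Z) \<le> norm (vecm n ?Z) * ((1 - \<epsilon>) * norm (vecm n Y))"
    by (simp add: power2_eq_square mult_ac)
  then show ?thesis
  proof (cases "norm (vecm n ?Z) = 0")
    case True
    then show ?thesis using \<epsilon> by simp
  next
    case False
    then have "0 < norm (vecm n ?Z)" by simp
    with \<open>norm (vecm n ?Z) * norm (vecm n ?Z) \<le> _\<close> show ?thesis by (simp only: mult_le_cancel_left_pos)
  qed
qed

lemma \<Psi>_contraction: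
  assumes X: "X \<in> mats n" "mtrace n X = 0"
  shows "norm (vecm n (\<Psi> X)) \<le> (1 - \<epsilon>)\<^sup>2 * norm (vecm n X)"
proof -
  have "norm (vecm n (\<Psi> X)) \<le> (1 - \<epsilon>) * norm (vecm n (sandwich d L X))"
    unfolding \<Psi>_def using X by (intro gap_adj) (auto intro: sandwich_mats L simp: mtrace_sandwich)
  also have "\<dots> \<le> (1 - \<epsilon>) * ((1 - \<epsilon>) * norm (vecm n X))"
    using \<epsilon> by (intro mult_left_mono gap X) simp
  finally show ?thesis by (simp add: power2_eq_square mult.assoc)
qed

lemma \<Psi>_funpow:
  assumes X: "X \<in> mats n"
  shows "(\<Psi> ^^ k) X \<in> mats n" "mtrace n ((\<Psi> ^^ k) X) = mtrace n X"
    "(\<Psi> ^^ k) (X + c *\<^sub>C one_mat n) = (\<Psi> ^^ k) X + c *\<^sub>C one_mat n"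
proof -
  show m: "(\<Psi> ^^ k) X \<in> mats n" for k
    using X by (induction k) (simp_all add: \<Psi>_mats)
  show "mtrace n ((\<Psi> ^^ k) X) = mtrace n X"
    by (induction k) (simp_all add: m mtrace_\<Psi>)
  show "(\<Psi> ^^ k) (X + c *\<^sub>C one_mat n) = (\<Psi> ^^ k) X + c *\<^sub>C one_mat n"
    by (induction k) (simp_all add: m \<Psi>_add_scaleC one_mat_in_mats \<Psi>_one)
qed

lemma \<Psi>_funpow_contraction:
  assumes X: "X \<in> mats n" "mtrace n X = 0"
  shows "norm (vecm n ((\<Psi> ^^ k) X)) \<le> (1 - \<epsilon>) ^ (2 * k) * norm (vecm n X)"
proof (induction k)
  case (Suc k)
  have "norm (vecm n ((\<Psi> ^^ Suc k) X)) \<le> (1 - \<epsilon>)\<^sup>2 * norm (vecm n ((\<Psi> ^^ k) X))"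
    using \<Psi>_contraction[OF \<Psi>_funpow(1)[OF X(1)]] X by (simp add: \<Psi>_funpow(2))
  also have "\<dots> \<le> (1 - \<epsilon>)\<^sup>2 * ((1 - \<epsilon>) ^ (2 * k) * norm (vecm n X))"
    by (intro mult_left_mono Suc) simp
  finally show ?case by (simp add: power2_eq_square mult_ac)
qed simp

text \<open>Each application of \<open>\<Psi>\<close> contributes left factors
  \<open>adj (L j) o\<^sub>L L i\<close>; the factors on the right only change the argument, so the
  induction keeps \<open>x\<close> arbitrary. Adjoints occur because a condition
  \<open>P A Q = 0\<close> on distances is used in the form \<open>Q A^* P = 0\<close>.\<close>

lemma \<Psi>_funpow_range:
  assumes P: "P \<in> mats n"
  shows "(\<Psi> ^^ k) P x \<in> cvec.span {adj A (P y) | A y. A \<in> span_power n (cvec.span generators) k}"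
proof (induction k arbitrary: x)
  case 0
  have "one_mat n \<in> span_power n (cvec.span generators) 0"
    by (auto simp: span_power_def intro: cvec.span_base)
  then have "adj (one_mat n) (P x) \<in> cvec.span {adj A (P y) | A y. A \<in> span_power n (cvec.span generators) 0}"
    by (intro cvec.span_base) blast
  then show ?case by (simp add: mats_apply(1)[OF P])
next
  case (Suc k)
  let ?R = "\<lambda>k. cvec.span {adj A (P y) | A y. A \<in> span_power n (cvec.span generators) k}"
  have step: "adj (L j) (L i z) \<in> ?R (Suc k)" if ij: "i < d" "j < d" and z: "z \<in> ?R k" for i j z
    using z
  proof (induction rule: cvec.span_induct_alt)
    case base
    show ?case by (simp add: cvec.span_zero blinfun.zero_right)
  next
    case (step c w z)
    then obtain A y where w: "w = adj A (P y)" and A: "A \<in> span_power n (cvec.span generators) k" by blast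
    \<comment> \<open>The indices are swapped: it is \<open>adj ?W\<close> that equals
      \<open>adj (L j) o\<^sub>L L i\<close>.\<close>
    let ?W = "adj (L i) o\<^sub>L L j"
    have Am: "A \<in> mats n" using A span_power_subset_mats[OF span_generators_mats] by blast
    have "?W \<in> cvec.span generators" using ij by (intro cvec.span_base) (auto simp: generators_def)
    from span_power_compose_right[OF span_generators_mats A this]
    have "adj (A o\<^sub>L ?W) (P y) \<in> ?R (Suc k)" by (intro cvec.span_base) blast
    moreover have "adj (A o\<^sub>L ?W) (P y) = adj (L j) (L i w)"
      using mats_bops_id[OF Am] mats_bops_id[OF L] ij
      by (simp add: w adj_compose bops_id_compose adj_in_bops_id adj_adj)
    ultimately have "adj (L j) (L i w) \<in> ?R (Suc k)" by simp
    moreover have "adj (L j) (L i (c *\<^sub>C w + z)) = c *\<^sub>C adj (L j) (L i w) + adj (L j) (L i z)"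
      using ij by (simp add: blinfun.add_right mats_scaleC[OF L] mats_scaleC[OF L'])
    ultimately show ?case using step(2) by (simp add: cvec.span_add cvec.span_scale)
  qed
  have "(\<Psi> ^^ Suc k) P x = (\<Sum>j<d. \<Sum>i<d. adj (L j) (L i ((\<Psi> ^^ k) P (adj (L i) (adj (adj (L j)) x)))))"
    by (simp add: \<Psi>_def sandwich_def blinfun.sum_left blinfun.sum_right)
  also have "\<dots> \<in> ?R (Suc k)"
    by (intro cvec.span_sum step Suc) simp_all
  finally show ?case .
qed

text \<open>A projection containing the \<open>k\<close>-neighbourhood of \<open>P\<close> dominates the range of \<open>\<Psi>\<^sup>k P\<close>,
  which the spectral gap makes almost uniformly distributed.\<close>

lemma expansion:
  assumes P: "P \<in> projections (mats n)" and E: "E \<in> projections (mats n)"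
    and EP: "\<And>A x. A \<in> span_power n (cvec.span generators) k \<Longrightarrow> E (adj A (P x)) = adj A (P x)"
  shows "(real (op_rank P))\<^sup>2
    \<le> real (op_rank E) * ((1 - \<epsilon>) ^ (4 * k) * real (op_rank P) + (real (op_rank P))\<^sup>2 / real n)"
proof -
  define p where "p = real (op_rank P)"
  define I where "I = vecm n (one_mat n)"
  \<comment> \<open>With this \<open>c\<close> the matrix \<open>P0\<close> below is traceless;
    \<open>\<Psi>\<close> contracts it and fixes the scalar part.\<close>
  define c where "c = complex_of_real (p / real n)"
  define P0 where "P0 = P - c *\<^sub>C one_mat n"
  define Z where "Z = (\<Psi> ^^ k) P"
  define Z0 where "Z0 = (\<Psi> ^^ k) P0"
  have I2: "(norm I)\<^sup>2 = real n"
    unfolding I_def by (simp add: norm_vecm_projection[OF one_mat_projection_mats] op_rank_one_mat)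
  have II: "cinner I I = of_nat n" by (simp add: cinner_self I2)
  have Pm: "P \<in> mats n" by (rule projection_mats[OF P])
  have P0m: "P0 \<in> mats n"
    unfolding P0_def by (intro cvec.subspace_diff[OF subspace_mats] cvec.subspace_scale[OF subspace_mats] Pm one_mat_in_mats)
  have IP: "cinner I (vecm n P) = p"
    unfolding I_def p_def mtrace_eq[symmetric] by (simp add: mtrace_projection[OF P])
  have IP0: "cinner I (vecm n P0) = 0"
    using n by (simp add: P0_def vecm_diff vecm_scaleC cinner.diff_right cinner_scaleC_right IP II c_def flip: I_def)
  then have tr0: "mtrace n P0 = 0" by (simp add: mtrace_eq I_def)
  have PP0: "P = P0 + c *\<^sub>C one_mat n" by (simp add: P0_def)
  \<comment> \<open>Traceless means orthogonal to \<open>I\<close>, and the scalar part contributes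
    \<open>|c|^2 n = p^2 / n\<close>.\<close>
  have pyth: "(norm (v + c *\<^sub>C I))\<^sup>2 = (norm v)\<^sup>2 + p\<^sup>2 / real n" if "cinner I v = 0" for v
  proof -
    have vI: "cinner v I = 0" using that cinner_eq_0_commute by blast
    have "complex_of_real ((norm (v + c *\<^sub>C I))\<^sup>2) = cinner v v + cnj c * (c * cinner I I)"
      unfolding cinner_self[symmetric]
      by (simp add: cinner_add_left cinner_add_right cinner_scaleC_left cinner_scaleC_right that vI)
    also have "\<dots> = complex_of_real ((norm v)\<^sup>2 + p\<^sup>2 / real n)"
      using n by (simp only: II) (simp add: cinner_self c_def power2_eq_square)
    finally show ?thesis using of_real_eq_iff by blast
  qed
  have norm_P0: "(norm (vecm n P0))\<^sup>2 \<le> p"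
  proof -
    have "p = (norm (vecm n P0))\<^sup>2 + p\<^sup>2 / real n"
      using pyth[OF IP0] norm_vecm_projection[OF P]
      by (simp add: p_def I_def flip: vecm_scaleC vecm_add PP0)
    moreover have "0 \<le> p\<^sup>2 / real n" by simp
    ultimately show ?thesis by linarith
  qed
  have "norm (vecm n Z0) \<le> (1 - \<epsilon>) ^ (2 * k) * norm (vecm n P0)"
    unfolding Z0_def by (rule \<Psi>_funpow_contraction[OF P0m tr0])
  then have "(norm (vecm n Z0))\<^sup>2 \<le> ((1 - \<epsilon>) ^ (2 * k) * norm (vecm n P0))\<^sup>2"
    by (intro power_mono) simp_all
  also have "\<dots> = (1 - \<epsilon>) ^ (4 * k) * (norm (vecm n P0))\<^sup>2"
    by (simp add: power_mult_distrib flip: power_mult)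
  also have "\<dots> \<le> (1 - \<epsilon>) ^ (4 * k) * p"
    using \<epsilon> norm_P0 by (intro mult_left_mono) simp_all
  finally have Z0: "(norm (vecm n Z0))\<^sup>2 \<le> (1 - \<epsilon>) ^ (4 * k) * p" .
  have ZZ0: "Z = Z0 + c *\<^sub>C one_mat n"
    unfolding Z_def Z0_def \<Psi>_funpow(3)[OF P0m, symmetric] PP0[symmetric] ..
  have IZ0: "cinner I (vecm n Z0) = 0"
    unfolding I_def Z0_def mtrace_eq[symmetric] \<Psi>_funpow(2)[OF P0m] tr0 ..
  have Z: "(norm (vecm n Z))\<^sup>2 \<le> (1 - \<epsilon>) ^ (4 * k) * p + p\<^sup>2 / real n"
    using pyth[OF IZ0] Z0 by (simp add: ZZ0 vecm_add vecm_scaleC I_def)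
  have "E (Z x) = Z x" for x
  proof -
    have "z = E z" if "z \<in> cvec.span {adj A (P y) | A y. A \<in> span_power n (cvec.span generators) k}" for z
      using that
    proof (induction rule: cvec.span_induct_alt)
      case base
      show ?case by (simp add: blinfun.zero_right)
    next
      case (step c w z)
      then have "E w = w" using EP by blast
      with step show ?case by (simp add: blinfun.add_right mats_scaleC[OF projection_mats[OF E]])
    qed
    from this[OF \<Psi>_funpow_range[OF Pm]] show ?thesis by (simp add: Z_def)
  qed
  \<comment> \<open>As \<open>E\<close> fixes the range of \<open>Z\<close>, the trace of
    \<open>Z\<close> equals that of \<open>E Z\<close>; this brings the rank of \<open>E\<close>
    into the Cauchy-Schwarz bound.\<close>
  then have "cinner I (vecm n Z) = cinner (vecm n E) (vecm n Z)"
    unfolding I_def cinner_vecm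
    by (intro sum.cong refl) (simp add: one_mat_ket projection_apply(2)[OF projection_mats_bops_id[OF E]])
  moreover have "cinner I (vecm n Z) = p"
    unfolding I_def Z_def mtrace_eq[symmetric] \<Psi>_funpow(2)[OF Pm] p_def by (simp add: mtrace_projection[OF P])
  ultimately have "p = cmod (cinner (vecm n E) (vecm n Z))"
    by (metis abs_of_nat norm_of_real p_def)
  also have "\<dots> \<le> norm (vecm n E) * norm (vecm n Z)" by (rule norm_cinner_le)
  finally have "p\<^sup>2 \<le> (norm (vecm n E) * norm (vecm n Z))\<^sup>2"
    by (rule power_mono) (simp add: p_def)
  also have "\<dots> = real (op_rank E) * (norm (vecm n Z))\<^sup>2"
    by (simp add: power_mult_distrib norm_vecm_projection[OF E])
  also have "\<dots> \<le> real (op_rank E) * ((1 - \<epsilon>) ^ (4 * k) * p + p\<^sup>2 / real n)"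
    by (intro mult_left_mono Z) simp
  finally show ?thesis unfolding p_def .
qed

end

section \<open>Quantum functions into expanders\<close>

lemma expander_kraus:
  assumes \<Phi>: "quantum_expander d \<epsilon> n \<Phi>" and d: "1 \<le> d" and \<epsilon>: "0 < \<epsilon>" "\<epsilon> < 1"
  obtains L where "kraus_rep n d L \<Phi>" "kraus_expander n d L \<epsilon>"
proof -
  obtain U where U: "\<And>j. j < d \<Longrightarrow> unitary_mat n (U j)"
    and \<Phi>U: "\<And>X. X \<in> mats n \<Longrightarrow> \<Phi> X = (1 / of_nat d) *\<^sub>C (\<Sum>j<d. U j o\<^sub>L X o\<^sub>L adj (U j))"
    using \<Phi> unfolding quantum_expander_def by blast
  have n: "0 < n" and gap: "spectral_gap \<epsilon> n \<Phi>" using \<Phi> by (auto simp: quantum_expander_def)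
  \<comment> \<open>A scalar of squared modulus \<open>1 / d\<close> turns the average of the
    unitary conjugations into a plain Kraus sum.\<close>
  define c where "c = complex_of_real (1 / sqrt (real d))"
  have cc: "c * cnj c = 1 / of_nat d"
    unfolding c_def complex_cnj_complex_of_real of_real_mult[symmetric]
    by simp
  define L where "L = (\<lambda>j. c *\<^sub>C U j)"
  have Um: "U j \<in> mats n" if "j < d" for j using U[OF that] by (simp add: unitary_mat_def)
  have Lm: "L j \<in> mats n" if "j < d" for j
    unfolding L_def by (rule cvec.subspace_scale[OF subspace_mats Um[OF that]])
  have adjL: "adj (L j) = cnj c *\<^sub>C adj (U j)" if "j < d" for j
    unfolding L_def by (rule adj_scaleC[OF mats_bops_id[OF Um[OF that]]])
  have LX: "L j o\<^sub>L X o\<^sub>L adj (L j) = (1 / of_nat d) *\<^sub>C (U j o\<^sub>L X o\<^sub>L adj (U j))"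
    if "j < d" "X \<in> mats n" for j X
    unfolding adjL[OF that(1)] unfolding L_def cc[symmetric]
    using mats_bops_id[OF that(2)] mats_bops_id[OF Um[OF that(1)]]
    by (simp add: compose_scaleC_left compose_scaleC_right bops_id_compose scaleC_scaleC)
  have rep: "\<Phi> X = sandwich d L X" if X: "X \<in> mats n" for X
    unfolding \<Phi>U[OF X] sandwich_def cvec.scale_sum_right
    by (intro sum.cong refl) (simp add: LX X)
  have const: "(\<Sum>j<d. (1 / of_nat d) *\<^sub>C one_mat n) = one_mat n"
    using d by (simp add: cvec.scale_sum_left[symmetric] flip: sum_distrib_left)
  have "kraus_rep n d L \<Phi>"
    using Lm rep by (simp add: kraus_rep_def sandwich_def)
  moreover have "kraus_expander n d L \<epsilon>"
  proof
    show "(\<Sum>j<d. L j o\<^sub>L adj (L j)) = one_mat n"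
    proof -
      have "L j o\<^sub>L adj (L j) = (1 / of_nat d) *\<^sub>C one_mat n" if "j < d" for j
        using LX[OF that one_mat_in_mats] U[OF that] Lm[OF that]
        by (simp add: mats_compose_one_mat unitary_mat_def)
      then show ?thesis using const by simp
    qed
    show "(\<Sum>j<d. adj (L j) o\<^sub>L L j) = one_mat n"
    proof -
      have "adj (L j) o\<^sub>L L j = (1 / of_nat d) *\<^sub>C one_mat n" if "j < d" for j
        unfolding adjL[OF that] unfolding L_def cc[symmetric]
        using U[OF that] mats_bops_id[OF mats_adj[OF Um[OF that]]]
        by (simp add: compose_scaleC_left compose_scaleC_right scaleC_scaleC unitary_mat_def mult.commute)
      then show ?thesis using const by simp
    qed
    fix X assume X: "X \<in> mats n" "mtrace n X = 0"
    then have "hs_norm n (\<Phi> X) \<le> (1 - \<epsilon>) * hs_norm n X"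
      using gap by (auto simp: spectral_gap_def)
    then show "norm (vecm n (sandwich d L X)) \<le> (1 - \<epsilon>) * norm (vecm n X)"
      using X by (simp add: rep hs_norm_eq sandwich_mats Lm)
  qed (use n Lm \<epsilon> in auto)
  ultimately show ?thesis by (rule that)
qed

lemma kraus_span_subset:
  assumes K: "kraus_rep n N K \<Phi>" and L: "kraus_rep n M L \<Phi>"
  shows "cvec.span {adj (K j) o\<^sub>L K i | i j. i < N \<and> j < N}
    \<subseteq> cvec.span {adj (L j) o\<^sub>L L i | i j. i < M \<and> j < M}"
proof (rule cvec.span_minimal[OF _ cvec.subspace_span], clarify)
  fix i j assume "i < N" "j < N"
  moreover have "L ` {..<M} \<subseteq> bops id_blinfun"
    using L by (auto simp: kraus_rep_def intro: mats_bops_id)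
  ultimately have "adj (K j) o\<^sub>L K i \<in> cvec.span {adj a o\<^sub>L b | a b. a \<in> L ` {..<M} \<and> b \<in> L ` {..<M}}"
    using kraus_in_span[OF K L] by (intro adj_compose_in_span)
  also have "{adj a o\<^sub>L b | a b. a \<in> L ` {..<M} \<and> b \<in> L ` {..<M}} = {adj (L j) o\<^sub>L L i | i j. i < M \<and> j < M}"
    by blast
  finally show "adj (K j) o\<^sub>L K i \<in> cvec.span {adj (L j) o\<^sub>L L i | i j. i < M \<and> j < M}" .
qed

text \<open>The relation \<open>induced_qspace\<close> allows any Kraus family. Comparing spans in
  both directions replaces it by the family of \<open>d\<close> operators, on whose number the rank
  bound rests.\<close>

lemma induced_qspace_eq:
  assumes "induced_qspace n \<Phi> Y" "kraus_rep n d L \<Phi>"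
  shows "Y = kraus_qspace n d L"
proof -
  obtain N K where K: "kraus_rep n N K \<Phi>" "Y = kraus_qspace n N K"
    using assms(1) by (auto simp: induced_qspace_def)
  have "cvec.span {adj (K j) o\<^sub>L K i | i j. i < N \<and> j < N} = cvec.span {adj (L j) o\<^sub>L L i | i j. i < d \<and> j < d}"
    using kraus_span_subset[OF K(1) assms(2)] kraus_span_subset[OF assms(2) K(1)] by (rule equalityI)
  then show ?thesis by (simp only: K(2) kraus_qspace_def)
qed

text \<open>The amplification is multiplicative and faithful, so products on the Hilbert space
  vanish exactly when their amplifications do. This bound and the next one give distances between
  projections of the algebra without the tensor factor.\<close>

lemma pdist_le:
  assumes "P \<in> bops id_blinfun" "Q \<in> bops id_blinfun" "A \<in> bops id_blinfun"
    and "0 \<le> t" "A \<in> met X t" "P o\<^sub>L A o\<^sub>L Q \<noteq> 0"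
  shows "pdist X P Q \<le> ennreal t"
  unfolding pdist_def qdist_def
proof (rule Inf_lower, intro CollectI exI conjI bexI)
  show "(P \<otimes>\<^sub>o id_blinfun) o\<^sub>L (A \<otimes>\<^sub>o id_blinfun) o\<^sub>L (Q \<otimes>\<^sub>o id_blinfun) \<noteq> 0"
    using assms by (simp add: tensor_op_id amp_eq_0_iff flip: amp_compose)
qed (use assms in auto)

lemma le_pdist:
  assumes "P \<in> bops id_blinfun" "Q \<in> bops id_blinfun"
    and "\<And>t. 0 \<le> t \<Longrightarrow> met X t \<subseteq> bops id_blinfun"
    and "\<And>t A. 0 \<le> t \<Longrightarrow> A \<in> met X t \<Longrightarrow> P o\<^sub>L A o\<^sub>L Q \<noteq> 0 \<Longrightarrow> s \<le> ennreal t"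
  shows "s \<le> pdist X P Q"
  unfolding pdist_def qdist_def
proof (rule Inf_greatest, clarify)
  fix t A assume t: "0 \<le> t" and A: "A \<in> met X t"
    and ne: "(P \<otimes>\<^sub>o id_blinfun) o\<^sub>L (A \<otimes>\<^sub>o id_blinfun) o\<^sub>L (Q \<otimes>\<^sub>o id_blinfun) \<noteq> 0"
  have "A \<in> bops id_blinfun" using assms(3)[OF t] A by blast
  then have "P o\<^sub>L A o\<^sub>L Q \<noteq> 0"
    using ne assms(1,2) by (simp add: tensor_op_id amp_eq_0_iff flip: amp_compose)
  then show "s \<le> ennreal t" by (rule assms(4)[OF t A])
qed

context kraus_expander
begin

abbreviation "Y \<equiv> kraus_qspace n d L"

lemma met_Y: "met Y t = span_power n (cvec.span generators) (nat \<lfloor>t\<rfloor>)"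
  by (simp add: kraus_qspace_def generators_def)

lemma met_Y_mats: "met Y t \<subseteq> mats n"
  unfolding met_Y by (rule span_power_subset_mats[OF span_generators_mats])

lemma met_Y_mono: "s \<le> t \<Longrightarrow> met Y s \<subseteq> met Y t"
  unfolding met_Y by (intro span_power_mono span_generators_mats one_mat_in_span nat_mono floor_mono)

text \<open>Reflexivity turns the diameter bound into \<open>P M\<^sub>n P \<subseteq> \<V>\<^sub>t\<close> for \<open>t\<close> beyond the diameter.\<close>

lemma rank_le_of_diam:
  assumes refl: "reflexive_qspace Y" and P: "P \<in> projections (mats n)" and T: "0 \<le> T"
    and diam: "\<And>Q Q' A. Q \<in> projections (mats n) \<Longrightarrow> Q' \<in> projections (mats n) \<Longrightarrow> A \<in> mats n \<Longrightarrow>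
      Q o\<^sub>L (P o\<^sub>L A o\<^sub>L P) o\<^sub>L Q' \<noteq> 0 \<Longrightarrow> pdist Y Q Q' \<le> ennreal T"
  shows "op_rank P \<le> (d\<^sup>2) ^ nat \<lfloor>T + 1\<rfloor>"
proof (rule rank_bound[OF P])
  fix A assume A: "A \<in> mats n"
  \<comment> \<open>Any parameter beyond \<open>T\<close> would serve. The subspaces increase, so a
    pair of projections annihilating the one at \<open>T + 1\<close> is at distance at least
    \<open>T + 1\<close>, too far for the diameter bound.\<close>
  have "reflexive_subspace (one_mat n) (met Y (T + 1))"
    using refl[unfolded reflexive_qspace_def, rule_format, of "T + 1"] T
    by (simp add: kraus_qspace_def)
  then have V: "met Y (T + 1) = {B \<in> mats n. \<forall>Q\<in>projections (mats n). \<forall>Q'\<in>projections (mats n).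
      (\<forall>A\<in>met Y (T + 1). Q o\<^sub>L A o\<^sub>L Q' = 0) \<longrightarrow> Q o\<^sub>L B o\<^sub>L Q' = 0}"
    unfolding reflexive_subspace_def mats_def .
  have "P o\<^sub>L A o\<^sub>L P \<in> met Y (T + 1)"
  proof (rule subsetD[OF equalityD2[OF V]], intro CollectI conjI ballI impI)
    show "P o\<^sub>L A o\<^sub>L P \<in> mats n" using A projection_mats[OF P] by (intro mats_compose)
    fix Q Q' assume Q: "Q \<in> projections (mats n)" "Q' \<in> projections (mats n)"
      and 0: "\<forall>A\<in>met Y (T + 1). Q o\<^sub>L A o\<^sub>L Q' = 0"
    show "Q o\<^sub>L (P o\<^sub>L A o\<^sub>L P) o\<^sub>L Q' = 0"
    proof (rule ccontr)
      assume "Q o\<^sub>L (P o\<^sub>L A o\<^sub>L P) o\<^sub>L Q' \<noteq> 0"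
      then have "pdist Y Q Q' \<le> ennreal T" by (rule diam[OF Q A])
      moreover have "ennreal (T + 1) \<le> pdist Y Q Q'"
      proof (rule le_pdist)
        show "Q \<in> bops id_blinfun" "Q' \<in> bops id_blinfun" using Q projection_mats mats_bops_id by blast+
        show "met Y t \<subseteq> bops id_blinfun" for t using met_Y_mats mats_bops_id by blast
        fix t B assume "0 \<le> t" "B \<in> met Y t" "Q o\<^sub>L B o\<^sub>L Q' \<noteq> 0"
        then have "\<not> t \<le> T + 1" using 0 met_Y_mono by blast
        then show "ennreal (T + 1) \<le> ennreal t" by (intro ennreal_leI) simp
      qed
      ultimately have "ennreal (T + 1) \<le> ennreal T" by (rule order_trans[rotated])
      then show False using T by simp
    qed
  qed
  then show "P o\<^sub>L A o\<^sub>L P \<in> span_power n (cvec.span generators) (nat \<lfloor>T + 1\<rfloor>)" by (simp only: met_Y)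
qed

end

section \<open>Homomorphisms from a quantum metric space into an expander\<close>

lemma projection_one_minus:
  assumes "P \<in> projections (mats n)"
  shows "one_mat n - P \<in> projections (mats n)"
proof (rule projectionI)
  note p = projection_apply[OF projection_mats_bops_id[OF assms]]
    and o = projection_apply[OF one_mat_projection] and m = mats_apply[OF projection_mats[OF assms]]
  show "one_mat n - P \<in> mats n"
    by (intro cvec.subspace_diff[OF subspace_mats] one_mat_in_mats projection_mats assms)
  show "(one_mat n - P) ((one_mat n - P) x) = (one_mat n - P) x" for x
    by (simp add: blinfun.diff_left blinfun.diff_right p(1) o(1) m)
  show "cinner ((one_mat n - P) x) y = cinner x ((one_mat n - P) y)" for x y
    by (simp add: blinfun.diff_left cinner.diff_left cinner.diff_right p(2) o(2))
qed

locale quantum_metric =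
  fixes X :: "'h::chilbert qspace"
  assumes X: "quantum_metric_space X"
begin

lemma vn: "von_neumann_algebra (idn X) (alg X)"
  using X by (simp add: quantum_metric_space_def)

lemma alg_closed: "closedin weak_star (alg X)" and alg_subspace: "cvec.subspace (alg X)"
  and alg_bops: "alg X \<subseteq> bops (idn X)" and alg_idn: "idn X \<in> alg X"
  and alg_compose: "A \<in> alg X \<Longrightarrow> B \<in> alg X \<Longrightarrow> A o\<^sub>L B \<in> alg X"
  and alg_adj: "A \<in> alg X \<Longrightarrow> adj A \<in> alg X"
  using vn by (auto simp: von_neumann_algebra_def)

lemma alg_bops_id: "A \<in> alg X \<Longrightarrow> A \<in> bops id_blinfun"
  using alg_bops bops_imp_bops_id by blast

lemma projection_alg: "P \<in> projections (alg X) \<Longrightarrow> P \<in> alg X"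
  "P \<in> projections (alg X) \<Longrightarrow> P \<in> projections (bops id_blinfun)"
  using alg_bops_id by (auto simp: projections_def)

lemma met_bops_id: "0 \<le> t \<Longrightarrow> met X t \<subseteq> bops id_blinfun"
proof -
  assume "0 \<le> t"
  then have "met X t \<subseteq> bops (idn X)" using X unfolding quantum_metric_space_def by blast
  then show ?thesis using bops_imp_bops_id by blast
qed

end

text \<open>Weak*-continuity is recorded as closedness of the annihilator of each vector, the form
  in which suprema use it. Distances do not enter, so coarse embeddings and quotient maps are
  treated alike.\<close>

locale expander_hom = kraus_expander n d L \<epsilon> + quantum_metric X
  for n d :: nat and L :: "nat \<Rightarrow> complex ell2 op" and \<epsilon> :: real and X :: "'h::chilbert qspace" +
  fixes \<phi> :: "'h op \<Rightarrow> complex ell2 op"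
  assumes hom: "star_hom (alg X) (mats n) \<phi>" and unit: "\<phi> (idn X) = one_mat n"
    and kernel_closed: "closedin weak_star {A \<in> alg X. \<phi> A x = 0}"
begin

lemma \<phi>_mats: "A \<in> alg X \<Longrightarrow> \<phi> A \<in> mats n"
  and \<phi>_add: "A \<in> alg X \<Longrightarrow> B \<in> alg X \<Longrightarrow> \<phi> (A + B) = \<phi> A + \<phi> B"
  and \<phi>_scaleC: "A \<in> alg X \<Longrightarrow> \<phi> (c *\<^sub>C A) = c *\<^sub>C \<phi> A"
  and \<phi>_compose: "A \<in> alg X \<Longrightarrow> B \<in> alg X \<Longrightarrow> \<phi> (A o\<^sub>L B) = \<phi> A o\<^sub>L \<phi> B"
  and \<phi>_adj: "A \<in> alg X \<Longrightarrow> \<phi> (adj A) = adj (\<phi> A)"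
  using hom unfolding star_hom_def by blast+

lemma \<phi>_zero: "\<phi> 0 = 0"
  using \<phi>_scaleC[OF alg_idn, of 0] by simp

lemma \<phi>_diff:
  assumes "A \<in> alg X" "B \<in> alg X"
  shows "\<phi> (A - B) = \<phi> A - \<phi> B"
proof -
  have "A - B \<in> alg X" by (rule cvec.subspace_diff[OF alg_subspace assms])
  from \<phi>_add[OF this assms(2)] show ?thesis by simp
qed

lemma \<phi>_projection: "P \<in> projections (alg X) \<Longrightarrow> \<phi> P \<in> projections (mats n)"
  using \<phi>_mats \<phi>_compose[of P P] \<phi>_adj[of P] by (auto simp: projections_def)

text \<open>Working with one vector \<open>x\<close> at a time makes the set of admissible
  \<open>A\<close> a weak*-closed left ideal, to which \<open>proj_sup_in_weak_star_closed\<close>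
  applies.\<close>

lemma \<phi>_proj_sup_kernel:
  assumes S: "S \<subseteq> projections (alg X)" and 0: "\<And>Q. Q \<in> S \<Longrightarrow> \<phi> Q x = 0"
  shows "proj_sup S \<in> alg X" "\<phi> (proj_sup S) x = 0"
proof -
  let ?J = "{A \<in> alg X. \<phi> A x = 0}"
  have "proj_sup S \<in> ?J"
  proof (rule proj_sup_in_weak_star_closed[OF kernel_closed])
    show "cvec.subspace ?J"
      using cvec.subspace_0[OF alg_subspace] cvec.subspace_add[OF alg_subspace]
        cvec.subspace_scale[OF alg_subspace]
      by (auto simp: cvec.subspace_def \<phi>_zero \<phi>_add \<phi>_scaleC blinfun.add_left)
    show "S \<subseteq> ?J" "S \<subseteq> projections (bops id_blinfun)" using S 0 projection_alg by blast+
    show "P o\<^sub>L B \<in> ?J" if "P \<in> S" "B \<in> ?J" for P B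
    proof -
      have "P \<in> alg X" using that(1) S projection_alg by blast
      then show ?thesis using that(2) by (simp add: alg_compose \<phi>_compose blinfun.zero_right)
    qed
  qed
  then show "proj_sup S \<in> alg X" "\<phi> (proj_sup S) x = 0" by simp_all
qed

lemma nbhd_in_alg: "nbhd X r P \<in> alg X"
  and \<phi>_nbhd_projection: "\<phi> (nbhd X r P) \<in> projections (mats n)"
proof -
  let ?S = "{Q \<in> projections (alg X). ennreal r \<le> pdist X P Q}"
  \<comment> \<open>At the vector 0 the annihilator condition is void, which leaves membership of
    the supremum in the algebra.\<close>
  have G: "proj_sup ?S \<in> alg X" by (rule \<phi>_proj_sup_kernel(1)[of _ 0]) (auto simp: blinfun.zero_right)
  then have "proj_sup ?S \<in> projections (alg X)"
    using proj_sup_projection[of ?S] by (simp add: projections_def)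
  from projection_one_minus[OF \<phi>_projection[OF this]]
  show "\<phi> (nbhd X r P) \<in> projections (mats n)" by (simp add: nbhd_def \<phi>_diff[OF alg_idn G] unit)
  show "nbhd X r P \<in> alg X" unfolding nbhd_def by (rule cvec.subspace_diff[OF alg_subspace alg_idn G])
qed

text \<open>Vectors reached from the range of \<open>\<phi> P\<close> in \<open>k\<close> steps are
  annihilated by \<open>\<phi> Q\<close> for every \<open>Q\<close> at distance at least
  \<open>r\<close> from \<open>P\<close>, hence fixed by the image of the neighbourhood. That image
  is therefore an admissible \<open>E\<close> in \<open>expansion\<close>, and the conditions on
  \<open>C\<close> make each of the two summands there at most the rank divided by
  \<open>2 C\<close>.\<close>

lemma nbhd_expansion:
  assumes P: "P \<in> projections (alg X)"
    and far: "\<And>Q. Q \<in> projections (alg X) \<Longrightarrow> ennreal r \<le> pdist X P Q \<Longrightarrow>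
      ennreal (real k + 1) \<le> pdist Y (\<phi> P) (\<phi> Q)"
    and C: "0 < C" "(1 - \<epsilon>) ^ (4 * k) \<le> 1 / (2 * real C)" "2 * C * op_rank (\<phi> P) \<le> n"
  shows "C * op_rank (\<phi> P) \<le> op_rank (\<phi> (nbhd X r P))"
proof -
  let ?S = "{Q \<in> projections (alg X). ennreal r \<le> pdist X P Q}"
  define p e where "p = real (op_rank (\<phi> P))" and "e = real (op_rank (\<phi> (nbhd X r P)))"
  note \<phi>P = \<phi>_projection[OF P]
  have "\<phi> (nbhd X r P) (adj A (\<phi> P x)) = adj A (\<phi> P x)"
    if A: "A \<in> span_power n (cvec.span generators) k" for A x
  proof -
    have Am: "A \<in> mats n" using A span_power_subset_mats[OF span_generators_mats] by blast
    have "\<phi> Q (adj A (\<phi> P x)) = 0" if Q: "Q \<in> ?S" for Q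
    proof -
      have \<phi>Q: "\<phi> Q \<in> projections (mats n)" using Q \<phi>_projection by blast
      note b = mats_bops_id[OF projection_mats[OF \<phi>P]] mats_bops_id[OF projection_mats[OF \<phi>Q]]
        mats_bops_id[OF Am]
      \<comment> \<open>A nonzero product would put the images within distance \<open>k\<close>, one
        less than \<open>far\<close> guarantees.\<close>
      have "\<phi> P o\<^sub>L A o\<^sub>L \<phi> Q = 0"
      proof (rule ccontr)
        assume "\<phi> P o\<^sub>L A o\<^sub>L \<phi> Q \<noteq> 0"
        then have "pdist Y (\<phi> P) (\<phi> Q) \<le> ennreal (real k)"
          using A b by (intro pdist_le[of _ _ A]) (simp_all add: met_Y)
        then have "ennreal (real k + 1) \<le> ennreal (real k)"
          using far Q by (blast intro: order_trans)
        then show False by simp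
      qed
      then have "adj (\<phi> P o\<^sub>L A o\<^sub>L \<phi> Q) = 0" by simp
      then have "\<phi> Q o\<^sub>L (adj A o\<^sub>L \<phi> P) = 0"
        using b \<phi>P \<phi>Q by (simp add: adj_compose bops_id_compose projections_def)
      then have "(\<phi> Q o\<^sub>L (adj A o\<^sub>L \<phi> P)) x = 0" by simp
      then show ?thesis by simp
    qed
    then have G: "proj_sup ?S \<in> alg X" "\<phi> (proj_sup ?S) (adj A (\<phi> P x)) = 0"
      by (intro \<phi>_proj_sup_kernel; blast)+
    have "\<phi> (nbhd X r P) = one_mat n - \<phi> (proj_sup ?S)"
      by (simp add: nbhd_def \<phi>_diff[OF alg_idn G(1)] unit)
    then show ?thesis
      using G(2) mats_apply(1)[OF mats_adj[OF Am]] by (simp add: blinfun.diff_left)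
  qed
  from expansion[OF \<phi>P \<phi>_nbhd_projection this]
  have *: "p\<^sup>2 \<le> e * ((1 - \<epsilon>) ^ (4 * k) * p + p\<^sup>2 / real n)" by (simp add: p_def e_def)
  have "real C * p \<le> e"
  \<comment> \<open>Rank zero is separated because a factor \<open>p\<close> is cancelled in the
    other case.\<close>
  proof (cases "p = 0")
    case False
    then have p: "0 < p" by (simp add: p_def)
    have "2 * real C * p \<le> real n" using C(3) unfolding p_def by (metis of_nat_le_iff of_nat_mult of_nat_numeral)
    then have "p / real n \<le> 1 / (2 * real C)" using n C(1) by (simp add: field_simps)
    then have "p\<^sup>2 / real n \<le> 1 / (2 * real C) * p"
      using mult_right_mono[of "p / real n" "1 / (2 * real C)" p] p by (simp add: power2_eq_square)
    moreover have "(1 - \<epsilon>) ^ (4 * k) * p \<le> 1 / (2 * real C) * p"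
      using C(2) p by (intro mult_right_mono) simp_all
    ultimately have "(1 - \<epsilon>) ^ (4 * k) * p + p\<^sup>2 / real n \<le> 1 / (2 * real C) * p + 1 / (2 * real C) * p"
      by linarith
    also have "\<dots> = p / real C" by simp
    finally have "(1 - \<epsilon>) ^ (4 * k) * p + p\<^sup>2 / real n \<le> p / real C" .
    then have "p\<^sup>2 \<le> e * (p / real C)"
      using * mult_left_mono[of _ "p / real C" e] by (fastforce simp: e_def)
    then have "p * (real C * p) \<le> p * e" using C(1) by (simp add: field_simps power2_eq_square)
    then show ?thesis using p by simp
  qed (simp add: e_def)
  then show ?thesis unfolding p_def e_def by (metis of_nat_le_iff of_nat_mult)
qed

text \<open>Distinct members have orthogonal neighbourhoods, and the homomorphism preserves this.
  The sum runs over a finite part because the family itself may be infinite.\<close>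

lemma sum_rank_r_disjoint:
  assumes F: "finite F" "F \<subseteq> \<P>" and \<P>: "\<P> \<subseteq> projections (alg X)" "r_disjoint X r \<P>"
    and C: "\<And>P. P \<in> \<P> \<Longrightarrow> C * op_rank (\<phi> P) \<le> op_rank (\<phi> (nbhd X r P))"
  shows "C * (\<Sum>P\<in>F. op_rank (\<phi> P)) \<le> n"
proof -
  have "C * (\<Sum>P\<in>F. op_rank (\<phi> P)) \<le> (\<Sum>P\<in>F. op_rank (\<phi> (nbhd X r P)))"
    unfolding sum_distrib_left using F C by (intro sum_mono) blast
  also have "\<dots> \<le> n"
  proof (rule sum_rank_le_of_orthogonal[OF F(1) \<phi>_nbhd_projection])
    fix P Q assume "P \<in> F" "Q \<in> F" "P \<noteq> Q"
    then have "nbhd X r P o\<^sub>L nbhd X r Q = 0" using \<P>(2) F by (auto simp: r_disjoint_def)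
    then show "\<phi> (nbhd X r P) o\<^sub>L \<phi> (nbhd X r Q) = 0"
      using \<phi>_compose[OF nbhd_in_alg nbhd_in_alg, of r P r Q] by (simp add: \<phi>_zero)
  qed
  finally show ?thesis .
qed

text \<open>Every finite part of the union has total rank at most
  \<open>(N + 1) n / (N + 2)\<close>. Since only finitely many members have nonzero image, one
  finite part accounts for the whole cover and would need total rank \<open>n\<close>.\<close>

lemma no_small_cover:
  assumes \<P>: "\<And>i. i \<le> N \<Longrightarrow> \<P> i \<subseteq> projections (alg X)" "\<And>i. i \<le> N \<Longrightarrow> r_disjoint X r (\<P> i)"
    and cover: "is_cover X (\<Union>i\<le>N. \<P> i)"
    and C: "\<And>i P. i \<le> N \<Longrightarrow> P \<in> \<P> i \<Longrightarrow> (N + 2) * op_rank (\<phi> P) \<le> op_rank (\<phi> (nbhd X r P))"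
  shows False
proof -
  define U where "U = (\<Union>i\<le>N. \<P> i)"
  have U: "U \<subseteq> projections (alg X)" using \<P>(1) by (auto simp: U_def)
  have fin: "(N + 2) * (\<Sum>P\<in>F. op_rank (\<phi> P)) \<le> (N + 1) * n" if F: "finite F" "F \<subseteq> U" for F
  proof -
    \<comment> \<open>A projection may belong to several of the families; counting it in each only
      increases the right-hand side.\<close>
    have "op_rank (\<phi> P) \<le> (\<Sum>i\<le>N. if P \<in> \<P> i then op_rank (\<phi> P) else 0)" if "P \<in> F" for P
    proof -
      from that F(2) have "P \<in> U" by blast
      then obtain i where i: "i \<le> N" "P \<in> \<P> i" by (auto simp: U_def)
      then show ?thesis
        using member_le_sum[of i "{..N}" "\<lambda>i. if P \<in> \<P> i then op_rank (\<phi> P) else 0"] by simp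
    qed
    then have "(\<Sum>P\<in>F. op_rank (\<phi> P)) \<le> (\<Sum>P\<in>F. \<Sum>i\<le>N. if P \<in> \<P> i then op_rank (\<phi> P) else 0)"
      by (rule sum_mono)
    also have "\<dots> = (\<Sum>i\<le>N. \<Sum>P\<in>F. if P \<in> \<P> i then op_rank (\<phi> P) else 0)" by (rule sum.swap)
    also have "\<dots> = (\<Sum>i\<le>N. \<Sum>P\<in>F \<inter> \<P> i. op_rank (\<phi> P))"
      using F(1) by (simp add: sum.inter_restrict)
    finally have "(N + 2) * (\<Sum>P\<in>F. op_rank (\<phi> P)) \<le> (\<Sum>i\<le>N. (N + 2) * (\<Sum>P\<in>F \<inter> \<P> i. op_rank (\<phi> P)))"
      by (metis mult_le_mono2 sum_distrib_left)
    also have "\<dots> \<le> (\<Sum>i\<le>N. n)"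
    proof (rule sum_mono)
      fix i assume "i \<in> {..N}"
      then show "(N + 2) * (\<Sum>P\<in>F \<inter> \<P> i. op_rank (\<phi> P)) \<le> n"
        using F(1) \<P> C by (intro sum_rank_r_disjoint[of _ "\<P> i" r]) auto
    qed
    finally show ?thesis by simp
  qed
  define F where "F = {P \<in> U. \<phi> P \<noteq> 0}"
  have "finite F"
  proof (rule ccontr)
    \<comment> \<open>A set of \<open>Suc n\<close> members with nonzero image has total rank above
      \<open>n\<close>, which the bound on finite parts forbids.\<close>
    assume "infinite F"
    then obtain G where G: "finite G" "card G = Suc n" "G \<subseteq> F"
      using infinite_arbitrarily_large by blast
    have "card G = (\<Sum>P\<in>G. 1)" by simp
    also have "\<dots> \<le> (\<Sum>P\<in>G. op_rank (\<phi> P))"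
    proof (rule sum_mono)
      fix P assume "P \<in> G"
      then have "0 < op_rank (\<phi> P)" using G(3) U by (intro rank_pos[OF \<phi>_projection]) (auto simp: F_def)
      then show "1 \<le> op_rank (\<phi> P)" by simp
    qed
    finally have "(N + 2) * Suc n \<le> (N + 2) * (\<Sum>P\<in>G. op_rank (\<phi> P))"
      unfolding G(2) by (rule mult_le_mono2)
    also have "\<dots> \<le> (N + 1) * n" using G by (intro fin) (auto simp: F_def)
    finally show False by simp
  qed
  have "n \<le> (\<Sum>P\<in>F. op_rank (\<phi> P))"
  proof (rule le_sum_rank_of_joint_kernel[OF \<open>finite F\<close>])
    show "\<phi> P \<in> projections (mats n)" if "P \<in> F" for P using that U \<phi>_projection by (auto simp: F_def)
    fix x assume x: "one_mat n x = x" "\<And>P. P \<in> F \<Longrightarrow> \<phi> P x = 0"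
    have "\<phi> P x = 0" if "P \<in> U" for P using x(2)[of P] that by (cases "\<phi> P = 0") (auto simp: F_def)
    \<comment> \<open>A vector killed by all images is killed by the image of the supremum, and for
      a cover that image is the identity.\<close>
    from \<phi>_proj_sup_kernel(2)[OF U this] show "x = 0"
      using cover x(1) by (simp add: is_cover_def U_def unit)
  qed
  then have "(N + 2) * n \<le> (N + 2) * (\<Sum>P\<in>F. op_rank (\<phi> P))" by (rule mult_le_mono2)
  also have "\<dots> \<le> (N + 1) * n" using \<open>finite F\<close> by (intro fin) (auto simp: F_def)
  finally show False using n by simp
qed

end

section \<open>Asymptotic dimension and coarse embeddings\<close>

text \<open>Two hypotheses, both uniform in \<open>m\<close>, isolate the coarse geometry. By
  \<open>far\<close>, distant projections have images at a prescribed distance; by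
  \<open>diam\<close>, compressions by the image of a bounded projection connect only projections of
  the matrix algebra at bounded distance, which is the input of
  \<open>rank_le_of_diam\<close>.\<close>

lemma asdim_infinite:
  fixes X :: "'h::chilbert qspace" and n :: "nat \<Rightarrow> nat"
  assumes hom: "\<And>m. expander_hom (n m) d (L m) \<epsilon> X (\<phi> m)"
    and lim: "filterlim n at_top sequentially"
    and refl: "\<And>m. reflexive_qspace (kraus_qspace (n m) d (L m))"
    and far: "\<And>s. \<exists>r>0. \<forall>m. \<forall>P\<in>projections (alg X). \<forall>Q\<in>projections (alg X).
      ennreal r \<le> pdist X P Q \<longrightarrow> ennreal s \<le> pdist (kraus_qspace (n m) d (L m)) (\<phi> m P) (\<phi> m Q)"
    and diam: "\<And>R. \<exists>T\<ge>0. \<forall>m. \<forall>P\<in>projections (alg X). qdiam X P \<le> ennreal R \<longrightarrow>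
      (\<forall>Q\<in>projections (mats (n m)). \<forall>Q'\<in>projections (mats (n m)). \<forall>A\<in>mats (n m).
        Q o\<^sub>L (\<phi> m P o\<^sub>L A o\<^sub>L \<phi> m P) o\<^sub>L Q' \<noteq> 0 \<longrightarrow>
        pdist (kraus_qspace (n m) d (L m)) Q Q' \<le> ennreal T)"
  shows "asdim X = \<infinity>"
proof -
  have "\<not> asdim_le X N" for N
  proof
    assume asdim: "asdim_le X N"
    define C where "C = N + 2"
    interpret e0: expander_hom "n 0" d "L 0" \<epsilon> X "\<phi> 0" by (rule hom)
    \<comment> \<open>\<open>k\<close> is fixed by \<open>N\<close> and \<open>\<epsilon>\<close>
      alone, before any cover is chosen.\<close>
    obtain k where k: "(1 - \<epsilon>) ^ k < 1 / (2 * real C)"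
      using real_arch_pow_inv[of "1 / (2 * real C)" "1 - \<epsilon>"] e0.\<epsilon> by (auto simp: C_def)
    have k4: "(1 - \<epsilon>) ^ (4 * k) \<le> 1 / (2 * real C)"
    proof -
      have "(1 - \<epsilon>) ^ (4 * k) \<le> (1 - \<epsilon>) ^ k" using e0.\<epsilon> by (intro power_decreasing) auto
      with k show ?thesis by linarith
    qed
    \<comment> \<open>The extra 1 excludes distance exactly \<open>k\<close>, which products of
      length \<open>k\<close> may realise.\<close>
    obtain r where r: "0 < r" and far_r: "\<And>m P Q. P \<in> projections (alg X) \<Longrightarrow> Q \<in> projections (alg X) \<Longrightarrow>
      ennreal r \<le> pdist X P Q \<Longrightarrow>
      ennreal (real k + 1) \<le> pdist (kraus_qspace (n m) d (L m)) (\<phi> m P) (\<phi> m Q)"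
      using far[of "real k + 1"] by blast
    have "\<exists>\<P> :: nat \<Rightarrow> 'h op set. (\<forall>i\<le>N. \<P> i \<subseteq> projections (alg X) \<and>
        uniformly_bounded X (\<P> i) \<and> r_disjoint X r (\<P> i)) \<and> is_cover X (\<Union>i\<le>N. \<P> i)"
      using asdim r unfolding asdim_le_def by (elim allE[of _ r] impE)
    then obtain \<P> where \<P>_all: "\<forall>i\<le>N. \<P> i \<subseteq> projections (alg X) \<and>
        uniformly_bounded X (\<P> i) \<and> r_disjoint X r (\<P> i)" and cover: "is_cover X (\<Union>i\<le>N. \<P> i)"
      by blast
    then have \<P>: "\<And>i. i \<le> N \<Longrightarrow> \<P> i \<subseteq> projections (alg X)"
        "\<And>i. i \<le> N \<Longrightarrow> uniformly_bounded X (\<P> i)" "\<And>i. i \<le> N \<Longrightarrow> r_disjoint X r (\<P> i)"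
      by simp_all
    have "\<exists>R>0. i \<le> N \<longrightarrow> (\<forall>P\<in>\<P> i. qdiam X P \<le> ennreal R)" for i
    proof (cases "i \<le> N")
      case True
      then obtain R where "R > 0" "(SUP P\<in>\<P> i. qdiam X P) \<le> ennreal R"
        using \<P>(2) by (auto simp: uniformly_bounded_def)
      then show ?thesis by (auto simp: SUP_le_iff)
    qed (auto intro: exI[of _ 1])
    then obtain \<rho> where \<rho>: "\<And>i. 0 < \<rho> i" "\<And>i P. i \<le> N \<Longrightarrow> P \<in> \<P> i \<Longrightarrow> qdiam X P \<le> ennreal (\<rho> i)"
      by metis
    \<comment> \<open>The sum of the positive constants is a common bound for the finitely many
      families.\<close>
    define R where "R = (\<Sum>i\<le>N. \<rho> i)"
    have R: "qdiam X P \<le> ennreal R" if "i \<le> N" "P \<in> \<P> i" for i P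
    proof -
      have "\<rho> i \<le> R" unfolding R_def using that(1) \<rho>(1) by (intro member_le_sum) (auto intro: less_imp_le)
      then show ?thesis using \<rho>(2)[OF that] by (meson ennreal_leI order_trans)
    qed
    obtain T where T: "0 \<le> T" and diam_T: "\<And>m P Q Q' A. P \<in> projections (alg X) \<Longrightarrow> qdiam X P \<le> ennreal R \<Longrightarrow>
        Q \<in> projections (mats (n m)) \<Longrightarrow> Q' \<in> projections (mats (n m)) \<Longrightarrow> A \<in> mats (n m) \<Longrightarrow>
        Q o\<^sub>L (\<phi> m P o\<^sub>L A o\<^sub>L \<phi> m P) o\<^sub>L Q' \<noteq> 0 \<Longrightarrow>
        pdist (kraus_qspace (n m) d (L m)) Q Q' \<le> ennreal T"
      using diam[of R] by blast
    define D where "D = (d\<^sup>2) ^ nat \<lfloor>T + 1\<rfloor>"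
    \<comment> \<open>\<open>D\<close> involves only \<open>d\<close> and \<open>T\<close>, so the
      dimension can still be taken large compared with it.\<close>
    obtain m where m: "2 * C * D \<le> n m"
      using lim unfolding filterlim_at_top eventually_sequentially by blast
    interpret e: expander_hom "n m" d "L m" \<epsilon> X "\<phi> m" by (rule hom)
    show False
    proof (rule e.no_small_cover[OF \<P>(1,3) cover])
      fix i P assume iP: "i \<le> N" "P \<in> \<P> i"
      then have P: "P \<in> projections (alg X)" using \<P>(1) by blast
      have "op_rank (\<phi> m P) \<le> D"
        unfolding D_def
        by (rule e.rank_le_of_diam[OF refl e.\<phi>_projection[OF P] T]) (rule diam_T[OF P R[OF iP]])
      then have "2 * C * op_rank (\<phi> m P) \<le> 2 * C * D" by (rule mult_le_mono2)
      then have "2 * C * op_rank (\<phi> m P) \<le> n m" using m by (rule order_trans)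
      from e.nbhd_expansion[OF P far_r[OF P] _ k4 this]
      show "(N + 2) * op_rank (\<phi> m P) \<le> op_rank (\<phi> m (nbhd X r P))" by (simp add: C_def)
    qed
  qed
  then have "{enat n | n. asdim_le X n} = {}" by simp
  then show ?thesis by (simp add: asdim_def Inf_enat_def)
qed

text \<open>Annihilating \<open>x\<close> is an intersection of closed coefficient conditions. Its
  preimage is closed relative to \<open>M\<close>, hence closed because \<open>M\<close> is.\<close>

lemma closedin_weak_star_kernel:
  assumes M: "closedin weak_star M"
    and \<phi>: "continuous_map (subtopology weak_star M) (subtopology weak_star N) \<phi>"
  shows "closedin weak_star {A \<in> M. blinfun_apply (\<phi> A) x = 0}"
proof -
  have "{B. blinfun_apply B x = 0} = (\<Inter>y. {B. cinner y (blinfun_apply B x) \<in> {0}})"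
    by (auto simp: cinner.zero_right) (metis cinner_self_eq_0_iff)
  also have "closedin weak_star \<dots>"
    by (intro closedin_INT closedin_weak_star_functional) auto
  finally have c: "closedin weak_star {B. blinfun_apply B x = 0}" .
  have "continuous_map (subtopology weak_star M) weak_star \<phi>"
    using \<phi> continuous_map_in_subtopology by blast
  from closedin_continuous_map_preimage[OF this c]
  have "closedin (subtopology weak_star M) {A \<in> M. blinfun_apply (\<phi> A) x = 0}"
    by (simp add: topspace_weak_star)
  then show ?thesis using closedin_closed_subtopology[OF M] by blast
qed

text \<open>Moving the amplified \<open>R\<close> to the left vector as its adjoint turns a
  generating functional composed with left multiplication into another generating
  functional.\<close>

lemma continuous_map_compose_left:
  fixes R :: "'a::chilbert op"
  assumes R: "R \<in> bops id_blinfun"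
  shows "continuous_map weak_star weak_star (\<lambda>A. R o\<^sub>L A)"
  unfolding weak_star_def
proof (rule continuous_on_generated_topo, fold weak_star_def)
  fix U assume "U \<in> {{A :: 'a op. (\<Sum>k. cinner (x k) (A (y k))) \<in> U} | x y U.
        summable (\<lambda>k. (norm (x k))\<^sup>2) \<and> summable (\<lambda>k. (norm (y k))\<^sup>2) \<and> open U}"
  then obtain x y V where U: "U = {A :: 'a op. (\<Sum>k. cinner (x k) (A (y k))) \<in> V}" and "open V"
    and xy: "summable (\<lambda>k. (norm (x k))\<^sup>2)" "summable (\<lambda>k. (norm (y k))\<^sup>2)"
    by blast
  define f g where "f = Abs_ell2 x" and "g = Abs_ell2 y"
  have "seq f = x" "seq g = y" by (simp_all add: f_def g_def Abs_ell2_inverse xy)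
  then have "(\<Sum>k. cinner (x k) (R (A (y k)))) = cinner (adj (amp R) f) (amp A g)"
    for A :: "'a op"
    using cinner_adj(2)[OF amp_in_bops_id[OF R], of f "amp A g"] by (simp add: cinner_ell2_def seq_amp)
  then have "(\<lambda>A. R o\<^sub>L A) -` U = {A :: 'a op. cinner (adj (amp R) f) (amp A g) \<in> V}" by (simp add: U vimage_def)
  then show "openin weak_star ((\<lambda>A. R o\<^sub>L A) -` U \<inter> topspace weak_star)"
    using openin_weak_star_functional[OF \<open>open V\<close>] by (simp add: topspace_weak_star)
next
  show "(\<lambda>A. R o\<^sub>L A) ` topspace weak_star
    \<subseteq> \<Union> {{A :: 'a op. (\<Sum>k. cinner (x k) (A (y k))) \<in> U} | x y U.
        summable (\<lambda>k. (norm (x k))\<^sup>2) \<and> summable (\<lambda>k. (norm (y k))\<^sup>2) \<and> open U}"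
    using topspace_weak_star[where 'a='a] unfolding weak_star_def topology_generated_by_topspace
    by (simp only: subset_UNIV)
qed

lemma tensor_id_projection:
  assumes M: "M \<subseteq> bops id_blinfun" and P: "P \<in> projections M"
  shows "P \<otimes>\<^sub>o id_blinfun \<in> projections (vn_tensor M)"
proof -
  have Pb: "P \<in> bops id_blinfun" using M P by (auto simp: projections_def)
  then have P': "P \<in> projections (bops id_blinfun)" using P by (simp add: projections_def)
  have "P \<in> M" "id_blinfun \<in> bops id_blinfun" using P by (auto simp: projections_def bops_id_iff)
  then have "P \<otimes>\<^sub>o id_blinfun \<in> cvec.span {A \<otimes>\<^sub>o B | A B. A \<in> M \<and> B \<in> bops id_blinfun}"
    by (intro cvec.span_base) blast
  also have "\<dots> \<subseteq> vn_tensor M"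
    unfolding vn_tensor_def by (rule closure_of_subset) (simp add: topspace_weak_star)
  finally show ?thesis
    using amp_projection[OF P'] by (simp add: tensor_op_id[OF Pb])
qed

text \<open>Pairs of the form \<open>Q \<otimes> Id\<close> are among those over which the diameter
  is a supremum, and they correspond to the pairs with which reflexivity tests a subspace.\<close>

lemma pdist_le_qdiam:
  assumes X: "alg X \<subseteq> bops id_blinfun" and Q: "Q \<in> projections (alg X)" "Q' \<in> projections (alg X)"
    and A: "A \<in> bops (idn X)" and P: "P \<in> bops id_blinfun"
    and ne: "Q o\<^sub>L (P o\<^sub>L A o\<^sub>L P) o\<^sub>L Q' \<noteq> 0"
  shows "pdist X Q Q' \<le> qdiam X P"
proof -
  have "P \<noteq> 0" using ne by auto
  have b: "Q \<in> bops id_blinfun" "Q' \<in> bops id_blinfun" "P o\<^sub>L A o\<^sub>L P \<in> bops id_blinfun"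
    using X Q A P by (auto simp: projections_def intro!: bops_id_compose dest: bops_imp_bops_id)
  have "(Q \<otimes>\<^sub>o id_blinfun) o\<^sub>L ((P o\<^sub>L A o\<^sub>L P) \<otimes>\<^sub>o id_blinfun) o\<^sub>L (Q' \<otimes>\<^sub>o id_blinfun) \<noteq> 0"
    using ne by (simp only: tensor_op_id b amp_eq_0_iff not_False_eq_True simp_thms flip: amp_compose)
  moreover have "Q \<otimes>\<^sub>o id_blinfun \<in> projections (vn_tensor (alg X))"
    "Q' \<otimes>\<^sub>o id_blinfun \<in> projections (vn_tensor (alg X))"
    using tensor_id_projection[OF X] Q by blast+
  ultimately have "pdist X Q Q' \<le> Sup {qdist X Q R | Q R.
            Q \<in> projections (vn_tensor (alg X)) \<and> R \<in> projections (vn_tensor (alg X)) \<and>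
            (\<exists>A\<in>bops (idn X). Q o\<^sub>L ((P o\<^sub>L A o\<^sub>L P) \<otimes>\<^sub>o id_blinfun) o\<^sub>L R \<noteq> 0)}"
    unfolding pdist_def using A by (intro Sup_upper CollectI) blast
  then show ?thesis using \<open>P \<noteq> 0\<close> by (simp only: qdiam_def if_False)
qed

lemma expander_sequence_kraus:
  assumes seq: "expander_sequence d \<epsilon> n \<Phi>" and "1 \<le> d" "0 < \<epsilon>" "\<epsilon> < 1"
    and Y: "\<forall>m. induced_qspace (n m) (\<Phi> m) (Y m) \<and> reflexive_qspace (Y m)"
  obtains L where "\<And>m. kraus_expander (n m) d (L m) \<epsilon>" "\<And>m. Y m = kraus_qspace (n m) d (L m)"
    "filterlim n at_top sequentially"
proof -
  have "\<exists>L. kraus_rep (n m) d L (\<Phi> m) \<and> kraus_expander (n m) d L \<epsilon>" for m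
  proof -
    have "quantum_expander d \<epsilon> (n m) (\<Phi> m)" using seq by (simp add: expander_sequence_def)
    from expander_kraus[OF this assms(2-4)] show ?thesis by metis
  qed
  then obtain L where L: "\<And>m. kraus_rep (n m) d (L m) (\<Phi> m)" "\<And>m. kraus_expander (n m) d (L m) \<epsilon>"
    by metis
  moreover have "Y m = kraus_qspace (n m) d (L m)" for m
    using Y L(1) by (intro induced_qspace_eq) auto
  ultimately show ?thesis using seq by (intro that[of L]) (simp_all add: expander_sequence_def)
qed

lemma alg_kraus_qspace [simp]: "alg (kraus_qspace n d L) = mats n"
  and idn_kraus_qspace [simp]: "idn (kraus_qspace n d L) = one_mat n"
  by (simp_all add: kraus_qspace_def)

text \<open>That \<open>f\<close> tends to infinity yields the distance hypothesis of
  \<open>asdim_infinite\<close>, and finiteness of \<open>g\<close> the diameter hypothesis. Since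
  \<open>f\<close> and \<open>g\<close> are common to all embeddings, both hold uniformly in
  \<open>m\<close>.\<close>

lemma asdim_infinite_of_equi_coarse:
  fixes X :: "'h::chilbert qspace"
  assumes X: "quantum_metric_space X" and L: "\<And>m. kraus_expander (n m) d (L m) \<epsilon>"
    and lim: "filterlim n at_top sequentially"
    and refl: "\<And>m. reflexive_qspace (kraus_qspace (n m) d (L m))"
    and coarse: "equi_coarse X (\<lambda>m. kraus_qspace (n m) d (L m)) \<phi>"
  shows "asdim X = \<infinity>"
proof (rule asdim_infinite[OF _ lim refl])
  let ?Y = "\<lambda>m. kraus_qspace (n m) d (L m)"
  obtain f :: "real \<Rightarrow> ennreal" where f: "(f \<longlongrightarrow> \<infinity>) at_top"
    and fo: "\<And>m t. 0 \<le> t \<Longrightarrow> f t \<le> omega X (?Y m) (\<phi> m) t"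
    using coarse unfolding equi_coarse_def by blast
  have qf: "quantum_function X (?Y m) (\<phi> m)" for m
    using coarse by (simp add: equi_coarse_def quantum_coarse_embedding_def)
  show hom: "expander_hom (n m) d (L m) \<epsilon> X (\<phi> m)" for m
  proof -
    interpret quantum_metric X by unfold_locales (rule X)
    have "closedin weak_star {A \<in> alg X. \<phi> m A x = 0}" for x
      using qf[of m] by (intro closedin_weak_star_kernel[OF alg_closed, of "mats (n m)"]) (simp add: quantum_function_def)
    then show ?thesis
      using L[of m] X qf[of m]
      by (intro expander_hom.intro quantum_metric.intro expander_hom_axioms.intro) (simp_all add: quantum_function_def)
  qed
  fix s :: real
  have "\<forall>\<^sub>F t in at_top. ennreal s < f t"
    using order_tendstoD(1)[OF f, of "ennreal s"] by simp
  then obtain t0 where t0: "\<And>t. t \<ge> t0 \<Longrightarrow> ennreal s < f t" by (auto simp: eventually_at_top_linorder)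
  \<comment> \<open>The maximum makes \<open>r\<close> positive; \<open>f\<close> is compared with
    \<open>omega\<close> at nonnegative arguments only.\<close>
  define r where "r = max t0 1"
  show "\<exists>r>0. \<forall>m. \<forall>P\<in>projections (alg X). \<forall>Q\<in>projections (alg X).
      ennreal r \<le> pdist X P Q \<longrightarrow> ennreal s \<le> pdist (?Y m) (\<phi> m P) (\<phi> m Q)"
  proof (intro exI[of _ r] conjI allI ballI impI)
    show "0 < r" by (simp add: r_def)
    fix m P Q assume PQ: "P \<in> projections (alg X)" "Q \<in> projections (alg X)" "ennreal r \<le> pdist X P Q"
    have "ennreal s \<le> f r" using t0[of r] by (simp add: r_def)
    also have "\<dots> \<le> omega X (?Y m) (\<phi> m) r" by (rule fo) (simp add: r_def)
    also have "\<dots> \<le> pdist (?Y m) (\<phi> m P) (\<phi> m Q)"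
      unfolding omega_def using PQ by (intro Inf_lower) blast
    finally show "ennreal s \<le> pdist (?Y m) (\<phi> m P) (\<phi> m Q)" .
  qed
next
  let ?Y = "\<lambda>m. kraus_qspace (n m) d (L m)"
  fix R :: real
  obtain g :: "real \<Rightarrow> ennreal" where g: "\<And>t. 0 \<le> t \<Longrightarrow> g t < \<infinity>"
    and gr: "\<And>m t. 0 \<le> t \<Longrightarrow> rho X (?Y m) (\<phi> m) t \<le> g t"
    using coarse unfolding equi_coarse_def by blast
  \<comment> \<open>A negative \<open>R\<close> behaves like 0 because \<open>ennreal\<close>
    truncates, while \<open>g\<close> is controlled at nonnegative arguments only.\<close>
  define R' where "R' = max R 0"
  have R': "0 \<le> R'" "ennreal R \<le> ennreal R'" by (auto simp: R'_def intro: ennreal_leI)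
  show "\<exists>T\<ge>0. \<forall>m. \<forall>P\<in>projections (alg X). qdiam X P \<le> ennreal R \<longrightarrow>
      (\<forall>Q\<in>projections (mats (n m)). \<forall>Q'\<in>projections (mats (n m)). \<forall>A\<in>mats (n m).
        Q o\<^sub>L (\<phi> m P o\<^sub>L A o\<^sub>L \<phi> m P) o\<^sub>L Q' \<noteq> 0 \<longrightarrow> pdist (?Y m) Q Q' \<le> ennreal T)"
  proof (intro exI[of _ "enn2real (g R')"] conjI allI ballI impI)
    fix m P Q Q' A
    assume P: "P \<in> projections (alg X)" "qdiam X P \<le> ennreal R"
      and Q: "Q \<in> projections (mats (n m))" "Q' \<in> projections (mats (n m))" and A: "A \<in> mats (n m)"
      and ne: "Q o\<^sub>L (\<phi> m P o\<^sub>L A o\<^sub>L \<phi> m P) o\<^sub>L Q' \<noteq> 0"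
    have "star_hom (alg X) (mats (n m)) (\<phi> m)"
      using coarse by (simp add: equi_coarse_def quantum_coarse_embedding_def quantum_function_def)
    then have "\<phi> m P \<in> mats (n m)" using P(1) by (simp add: star_hom_def projections_def)
    then have "pdist (?Y m) Q Q' \<le> qdiam (?Y m) (\<phi> m P)"
      using Q A ne by (intro pdist_le_qdiam) (auto simp: mats_bops_id simp flip: mats_def)
    also have "\<dots> \<le> rho X (?Y m) (\<phi> m) R'"
      unfolding rho_def using P R'(2) by (intro Sup_upper) (blast intro: order_trans)
    also have "\<dots> \<le> g R'" by (rule gr[OF R'(1)])
    also have "\<dots> = ennreal (enn2real (g R'))" using g[OF R'(1)] by simp
    finally show "pdist (?Y m) Q Q' \<le> ennreal (enn2real (g R'))" .
  qed simp
qed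

section \<open>Metric quotients\<close>

locale central_quotient = quantum_metric X
  for X :: "'h::chilbert qspace" +
  fixes R :: "'h op"
  assumes R: "central_projection X R"
begin

abbreviation "W \<equiv> metric_quotient X R"

lemma R_alg: "R \<in> alg X" and R_adj: "adj R = R"
  using R by (auto simp: central_projection_def projections_def)

lemma R_idem: "R (R x) = R x"
  using R by (auto simp: central_projection_def projections_def simp flip: blinfun_apply_blinfun_compose)

lemma R_commute: "A \<in> alg X \<Longrightarrow> A (R x) = R (A x)"
  using R by (auto simp: central_projection_def simp flip: blinfun_apply_blinfun_compose)

lemma R_idn: "R o\<^sub>L idn X = R"
  using R_alg alg_bops by (auto simp: bops_def)

lemma alg_W: "alg W = (\<lambda>A. R o\<^sub>L A) ` alg X"
  by (simp add: metric_quotient_def)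

lemma met_W: "met W t = (\<lambda>A. R o\<^sub>L A o\<^sub>L R) ` met X t"
  by (simp add: metric_quotient_def)

lemma alg_W_subset: "alg W \<subseteq> alg X"
  unfolding alg_W using R_alg alg_compose by blast

lemma alg_W_R: "A \<in> alg W \<Longrightarrow> R (A x) = A x" "A \<in> alg W \<Longrightarrow> A (R x) = A x"
  using R_commute by (auto simp: alg_W R_idem)

lemma compose_R_alg_W: "A \<in> alg X \<Longrightarrow> R o\<^sub>L A \<in> alg W"
  by (simp add: alg_W)

lemma alg_W_bops_id: "alg W \<subseteq> bops id_blinfun"
  using alg_W_subset alg_bops_id by blast

lemma met_W_bops_id: "0 \<le> t \<Longrightarrow> met W t \<subseteq> bops id_blinfun"
  unfolding met_W using met_bops_id alg_bops_id[OF R_alg] by (blast intro: bops_id_compose)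

lemma compose_R_projection:
  assumes P: "P \<in> projections (alg X)"
  shows "R o\<^sub>L P \<in> projections (alg W)"
proof (rule projectionI)
  have Pa: "P \<in> alg X" using P by (simp add: projections_def)
  have P': "P \<in> projections (bops id_blinfun)" and R': "R \<in> projections (bops id_blinfun)"
    using P R alg_bops_id by (auto simp: projections_def central_projection_def)
  show "R o\<^sub>L P \<in> alg W" by (rule compose_R_alg_W[OF Pa])
  show "(R o\<^sub>L P) ((R o\<^sub>L P) x) = (R o\<^sub>L P) x" for x
    by (simp add: R_commute[OF Pa] R_idem projection_apply(1)[OF P'])
  show "cinner ((R o\<^sub>L P) x) y = cinner x ((R o\<^sub>L P) y)" for x y
    by (simp add: projection_apply(2)[OF P'] projection_apply(2)[OF R'] R_commute[OF Pa])
qed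

text \<open>Centrality lets \<open>R\<close> be pulled out of \<open>(R P) (R A R) (R Q)\<close>,
  leaving \<open>R (P A Q) R\<close>. A witness for a distance in the quotient therefore comes from
  a witness in the original metric.\<close>

lemma pdist_le_pdist_W:
  assumes P: "P \<in> alg X" and Q: "Q \<in> alg X"
  shows "pdist X P Q \<le> pdist W (R o\<^sub>L P) (R o\<^sub>L Q)"
proof (rule le_pdist)
  show "R o\<^sub>L P \<in> bops id_blinfun" "R o\<^sub>L Q \<in> bops id_blinfun"
    using P Q R_alg alg_bops_id by (blast intro: bops_id_compose)+
  show "met W t \<subseteq> bops id_blinfun" if "0 \<le> t" for t by (rule met_W_bops_id[OF that])
  fix t B assume t: "0 \<le> t" and "B \<in> met W t" and ne: "(R o\<^sub>L P) o\<^sub>L B o\<^sub>L (R o\<^sub>L Q) \<noteq> 0"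
  then obtain A where A: "A \<in> met X t" "B = R o\<^sub>L A o\<^sub>L R" by (auto simp: met_W)
  have "(R o\<^sub>L P) o\<^sub>L B o\<^sub>L (R o\<^sub>L Q) = R o\<^sub>L (P o\<^sub>L A o\<^sub>L Q) o\<^sub>L R"
    by (rule blinfun_eqI) (simp add: A(2) R_commute[OF P] R_commute[OF Q] R_idem)
  then have "P o\<^sub>L A o\<^sub>L Q \<noteq> 0" using ne by auto
  then show "pdist X P Q \<le> ennreal t"
    using A(1) t alg_bops_id[OF P] alg_bops_id[OF Q] met_bops_id by (intro pdist_le[of _ _ A]) auto
qed

text \<open>Elements of the quotient absorb \<open>R\<close>, so compressing a witness by
  \<open>R\<close> leaves the product unchanged.\<close>

lemma pdist_W_le_pdist:
  assumes P: "P \<in> alg W" and Q: "Q \<in> alg W"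
  shows "pdist W P Q \<le> pdist X P Q"
proof (rule le_pdist)
  show "P \<in> bops id_blinfun" "Q \<in> bops id_blinfun" using P Q alg_W_bops_id by blast+
  show "met X t \<subseteq> bops id_blinfun" if "0 \<le> t" for t by (rule met_bops_id[OF that])
  fix t A assume t: "0 \<le> t" and A: "A \<in> met X t" and ne: "P o\<^sub>L A o\<^sub>L Q \<noteq> 0"
  have B: "R o\<^sub>L A o\<^sub>L R \<in> met W t" using A by (auto simp: met_W)
  have "P o\<^sub>L (R o\<^sub>L A o\<^sub>L R) o\<^sub>L Q = P o\<^sub>L A o\<^sub>L Q"
    by (rule blinfun_eqI) (simp add: alg_W_R[OF P] alg_W_R[OF Q])
  then show "pdist W P Q \<le> ennreal t"
    using B t P Q ne alg_W_bops_id met_W_bops_id[OF t] by (intro pdist_le[of _ _ "R o\<^sub>L A o\<^sub>L R"]) auto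
qed

end

section \<open>Quotients isomorphic to expanders\<close>

lemma bij_star_iso:
  assumes "star_iso M N \<theta>"
  shows "inj_on \<theta> M" "\<theta> ` M = N"
  using homeomorphic_imp_injective_map homeomorphic_imp_surjective_map assms
  unfolding star_iso_def by (fastforce simp: topspace_weak_star)+

text \<open>\<open>\<Theta>\<close> enters through its values on elementary tensors and its
  preservation of distances, which together determine the distances between images of projections
  \<open>P \<otimes> Id\<close>.\<close>

locale quotient_iso = central_quotient X R + kraus_expander n d L \<epsilon>
  for X :: "'h::chilbert qspace" and R :: "'h op" and n d :: nat
    and L :: "nat \<Rightarrow> complex ell2 op" and \<epsilon> :: real +
  fixes \<theta> :: "'h op \<Rightarrow> complex ell2 op" and \<Theta> :: "'h ell2 op \<Rightarrow> complex ell2 ell2 op"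
  assumes \<theta>: "star_iso (alg W) (mats n) \<theta>"
    and \<Theta>: "A \<in> alg W \<Longrightarrow> B \<in> bops id_blinfun \<Longrightarrow> \<Theta> (A \<otimes>\<^sub>o B) = \<theta> A \<otimes>\<^sub>o B"
    and dist_\<Theta>: "S \<in> projections (vn_tensor (alg W)) \<Longrightarrow> T \<in> projections (vn_tensor (alg W)) \<Longrightarrow>
      qdist Y (\<Theta> S) (\<Theta> T) = qdist W S T"
begin

definition \<phi> :: "'h op \<Rightarrow> complex ell2 op" where "\<phi> A = \<theta> (R o\<^sub>L A)"

lemma \<theta>_hom: "star_hom (alg W) (mats n) \<theta>"
  using \<theta> by (simp add: star_iso_def)

lemma \<theta>_compose: "A \<in> alg W \<Longrightarrow> B \<in> alg W \<Longrightarrow> \<theta> (A o\<^sub>L B) = \<theta> A o\<^sub>L \<theta> B"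
  using \<theta>_hom by (simp add: star_hom_def)

lemma alg_W_closed:
  assumes A: "A \<in> alg W" and B: "B \<in> alg W"
  shows "A o\<^sub>L B \<in> alg W" "adj A \<in> alg W"
proof -
  have a: "A \<in> alg X" and b: "B \<in> alg X" using A B alg_W_subset by auto
  have "A o\<^sub>L B = R o\<^sub>L (A o\<^sub>L B)" by (rule blinfun_eqI) (simp add: alg_W_R[OF A])
  then show "A o\<^sub>L B \<in> alg W" using compose_R_alg_W[OF alg_compose[OF a b]] by simp
  have "adj (A o\<^sub>L R) = R o\<^sub>L adj A"
    using adj_compose[OF alg_bops_id[OF a] alg_bops_id[OF R_alg]] by (simp add: R_adj)
  moreover have "A o\<^sub>L R = A" by (rule blinfun_eqI) (simp add: alg_W_R[OF A])
  ultimately show "adj A \<in> alg W" using compose_R_alg_W[OF alg_adj[OF a]] by simp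
qed

lemma R_alg_W: "R \<in> alg W"
  using compose_R_alg_W[OF alg_idn] by (simp add: R_idn)

text \<open>\<open>star_hom\<close> says nothing about units. Surjectivity supplies a preimage of
  the identity, and \<open>R\<close> acts on it as a unit.\<close>

lemma \<theta>_R: "\<theta> R = one_mat n"
proof -
  have "one_mat n \<in> \<theta> ` alg W" using bij_star_iso(2)[OF \<theta>] one_mat_in_mats by simp
  then obtain A where A: "A \<in> alg W" "one_mat n = \<theta> A" by blast
  have "\<theta> R \<in> mats n" using bij_star_iso(2)[OF \<theta>] R_alg_W by blast
  then have "\<theta> R = \<theta> R o\<^sub>L \<theta> A" by (simp add: A(2)[symmetric] mats_compose_one_mat)
  also have "\<dots> = \<theta> (R o\<^sub>L A)" by (rule \<theta>_compose[OF R_alg_W A(1), symmetric])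
  also have "R o\<^sub>L A = A" by (rule blinfun_eqI) (simp add: alg_W_R[OF A(1)])
  finally show ?thesis by (simp add: A(2))
qed

text \<open>Injectivity reflects the equations that define a projection.\<close>

lemma \<theta>_projection_preimage:
  assumes Q: "Q \<in> projections (mats n)"
  obtains S where "S \<in> projections (alg W)" "\<theta> S = Q"
proof -
  note inj = inj_onD[OF bij_star_iso(1)[OF \<theta>]]
  obtain S where S: "S \<in> alg W" "\<theta> S = Q"
    using projection_mats[OF Q] unfolding bij_star_iso(2)[OF \<theta>, symmetric] by blast
  have "\<theta> (S o\<^sub>L S) = \<theta> S" using Q by (simp add: \<theta>_compose S projections_def)
  then have "S o\<^sub>L S = S" using inj alg_W_closed S(1) by blast
  moreover have "\<theta> (adj S) = \<theta> S" using \<theta>_hom Q S by (simp add: star_hom_def projections_def)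
  then have "adj S = S" using inj alg_W_closed S(1) by blast
  ultimately show ?thesis using that S by (simp add: projections_def)
qed

lemma pdist_\<theta>:
  assumes "P \<in> projections (alg W)" "Q \<in> projections (alg W)"
  shows "pdist Y (\<theta> P) (\<theta> Q) = pdist W P Q"
proof -
  have i: "(id_blinfun :: complex ell2 op) \<in> bops id_blinfun" by (simp add: bops_id_iff)
  have "\<theta> P \<otimes>\<^sub>o id_blinfun = \<Theta> (P \<otimes>\<^sub>o id_blinfun)" "\<theta> Q \<otimes>\<^sub>o id_blinfun = \<Theta> (Q \<otimes>\<^sub>o id_blinfun)"
    using assms \<Theta>[OF _ i] by (simp_all add: projections_def)
  then show ?thesis
    using dist_\<Theta>[OF tensor_id_projection[OF alg_W_bops_id assms(1)] tensor_id_projection[OF alg_W_bops_id assms(2)]]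
    by (simp add: pdist_def)
qed

lemma expander_hom_\<phi>: "expander_hom n d L \<epsilon> X \<phi>"
proof
  show "\<phi> (idn X) = one_mat n" by (simp add: \<phi>_def R_idn \<theta>_R)
  show "star_hom (alg X) (mats n) \<phi>"
    unfolding star_hom_def
  proof (intro conjI ballI allI)
    have h: "(\<forall>A\<in>alg W. \<theta> A \<in> mats n) \<and> (\<forall>A\<in>alg W. \<forall>B\<in>alg W. \<theta> (A + B) = \<theta> A + \<theta> B)
      \<and> (\<forall>c. \<forall>A\<in>alg W. \<theta> (c *\<^sub>C A) = c *\<^sub>C \<theta> A) \<and> (\<forall>A\<in>alg W. \<theta> (adj A) = adj (\<theta> A))"
      using \<theta>_hom by (simp add: star_hom_def)
    fix A assume A: "A \<in> alg X"
    note w = compose_R_alg_W[OF A]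
    show "\<phi> A \<in> mats n" using h w by (simp add: \<phi>_def)
    show "\<phi> (c *\<^sub>C A) = c *\<^sub>C \<phi> A" for c
      using h w by (simp add: \<phi>_def compose_scaleC_right alg_bops_id[OF R_alg])
    have "R o\<^sub>L adj A = adj (A o\<^sub>L R)"
      by (simp add: adj_compose alg_bops_id A R_alg R_adj)
    also have "A o\<^sub>L R = R o\<^sub>L A" by (rule blinfun_eqI) (simp add: R_commute[OF A])
    finally show "\<phi> (adj A) = adj (\<phi> A)" using h w by (simp add: \<phi>_def)
    fix B assume B: "B \<in> alg X"
    note w' = compose_R_alg_W[OF B]
    show "\<phi> (A + B) = \<phi> A + \<phi> B" using h w w' by (simp add: \<phi>_def compose_add_right)
    \<comment> \<open>Centrality of \<open>R\<close> makes the cut-down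
      \<open>A \<mapsto> R A\<close> multiplicative.\<close>
    have "R o\<^sub>L (A o\<^sub>L B) = (R o\<^sub>L A) o\<^sub>L (R o\<^sub>L B)"
      by (rule blinfun_eqI) (simp add: R_commute[OF A] R_idem)
    then show "\<phi> (A o\<^sub>L B) = \<phi> A o\<^sub>L \<phi> B" by (simp add: \<phi>_def \<theta>_compose w w')
  qed
  show "closedin weak_star {A \<in> alg X. \<phi> A x = 0}" for x
  proof (rule closedin_weak_star_kernel)
    show "closedin weak_star (alg X)" by (rule alg_closed)
    have "continuous_map (subtopology weak_star (alg X)) (subtopology weak_star (alg W)) (\<lambda>A. R o\<^sub>L A)"
      using continuous_map_compose_left[OF alg_bops_id[OF R_alg]] compose_R_alg_W
      by (auto simp: continuous_map_in_subtopology continuous_map_from_subtopology)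
    moreover have "continuous_map (subtopology weak_star (alg W)) (subtopology weak_star (mats n)) \<theta>"
      using \<theta> by (simp add: star_iso_def homeomorphic_imp_continuous_map)
    ultimately have "continuous_map (subtopology weak_star (alg X)) (subtopology weak_star (mats n)) (\<theta> \<circ> (\<lambda>A. R o\<^sub>L A))"
      by (rule continuous_map_compose)
    then show "continuous_map (subtopology weak_star (alg X)) (subtopology weak_star (mats n)) \<phi>"
      by (simp add: comp_def \<phi>_def[abs_def])
  qed
qed

lemma pdist_\<phi>:
  assumes P: "P \<in> projections (alg X)" and Q: "Q \<in> projections (alg X)"
  shows "pdist X P Q \<le> pdist Y (\<phi> P) (\<phi> Q)"
  unfolding \<phi>_def pdist_\<theta>[OF compose_R_projection[OF P] compose_R_projection[OF Q]]
  using P Q by (intro pdist_le_pdist_W) (simp_all add: projections_def)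

text \<open>Pulled back along the isomorphism, \<open>Q\<close>, \<open>Q'\<close> and
  \<open>A\<close> become elements of the quotient and hence of the algebra of \<open>X\<close>,
  where they witness the diameter of \<open>P\<close> itself.\<close>

lemma pdist_le_qdiam_\<phi>:
  assumes P: "P \<in> projections (alg X)" and Q: "Q \<in> projections (mats n)" "Q' \<in> projections (mats n)"
    and A: "A \<in> mats n" and ne: "Q o\<^sub>L (\<phi> P o\<^sub>L A o\<^sub>L \<phi> P) o\<^sub>L Q' \<noteq> 0"
  shows "pdist Y Q Q' \<le> qdiam X P"
proof -
  have Pa: "P \<in> alg X" using P by (simp add: projections_def)
  obtain S where S: "S \<in> projections (alg W)" "\<theta> S = Q"
    by (rule \<theta>_projection_preimage[OF Q(1)], rule that) assumption+
  obtain S' where S': "S' \<in> projections (alg W)" "\<theta> S' = Q'"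
    by (rule \<theta>_projection_preimage[OF Q(2)], rule that) assumption+
  obtain B where B: "B \<in> alg W" "\<theta> B = A"
    using A unfolding bij_star_iso(2)[OF \<theta>, symmetric] by blast
  have Sa: "S \<in> alg W" "S' \<in> alg W" using S S' by (simp_all add: projections_def)
  note RP = compose_R_alg_W[OF Pa]
  have "Q o\<^sub>L (\<phi> P o\<^sub>L A o\<^sub>L \<phi> P) o\<^sub>L Q' = \<theta> (S o\<^sub>L ((R o\<^sub>L P) o\<^sub>L B o\<^sub>L (R o\<^sub>L P)) o\<^sub>L S')"
    by (simp add: S(2)[symmetric] S'(2)[symmetric] B(2)[symmetric] \<phi>_def \<theta>_compose RP Sa B(1) alg_W_closed)
  \<comment> \<open>\<open>S\<close> and \<open>B\<close> each absorb the copy of \<open>R\<close>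
    standing to their right.\<close>
  also have "S o\<^sub>L ((R o\<^sub>L P) o\<^sub>L B o\<^sub>L (R o\<^sub>L P)) o\<^sub>L S' = S o\<^sub>L (P o\<^sub>L B o\<^sub>L P) o\<^sub>L S'"
    by (rule blinfun_eqI) (simp add: alg_W_R[OF Sa(1)] alg_W_R[OF B(1)])
  finally have *: "Q o\<^sub>L (\<phi> P o\<^sub>L A o\<^sub>L \<phi> P) o\<^sub>L Q' = \<theta> (S o\<^sub>L (P o\<^sub>L B o\<^sub>L P) o\<^sub>L S')" .
  have "\<theta> (0 *\<^sub>C R) = 0 *\<^sub>C \<theta> R" using \<theta>_hom R_alg_W unfolding star_hom_def by blast
  then have "\<theta> 0 = 0" by simp
  then have ne': "S o\<^sub>L (P o\<^sub>L B o\<^sub>L P) o\<^sub>L S' \<noteq> 0" using ne * by auto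
  have "pdist Y Q Q' = pdist W S S'" using pdist_\<theta>[OF S(1) S'(1)] S(2) S'(2) by simp
  also have "\<dots> \<le> pdist X S S'" by (rule pdist_W_le_pdist[OF Sa])
  also have "\<dots> \<le> qdiam X P"
  proof (rule pdist_le_qdiam[OF _ _ _ _ _ ne'])
    show "alg X \<subseteq> bops id_blinfun" using alg_bops_id by blast
    show "S \<in> projections (alg X)" "S' \<in> projections (alg X)"
      using S(1) S'(1) alg_W_subset by (auto simp: projections_def)
    show "B \<in> bops (idn X)" using B(1) alg_W_subset alg_bops by blast
  qed (rule alg_bops_id[OF Pa])
  finally show ?thesis .
qed

end

lemma asdim_infinite_of_quotients:
  fixes X :: "'h::chilbert qspace"
  assumes X: "quantum_metric_space X" and L: "\<And>m. kraus_expander (n m) d (L m) \<epsilon>"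
    and lim: "filterlim n at_top sequentially"
    and refl: "\<And>m. reflexive_qspace (kraus_qspace (n m) d (L m))"
    and R: "\<And>m. central_projection X (R m)"
    and iso: "\<And>m. qspace_iso (metric_quotient X (R m)) (kraus_qspace (n m) d (L m))"
  shows "asdim X = \<infinity>"
proof -
  have "\<exists>\<theta> \<Theta>. quotient_iso X (R m) (n m) d (L m) \<epsilon> \<theta> \<Theta>" for m
  proof -
    obtain \<theta> :: "'h op \<Rightarrow> complex ell2 op" and \<Theta> :: "'h ell2 op \<Rightarrow> complex ell2 ell2 op"
      where "star_iso (alg (metric_quotient X (R m))) (alg (kraus_qspace (n m) d (L m))) \<theta>"
      "\<forall>A\<in>alg (metric_quotient X (R m)). \<forall>B\<in>bops id_blinfun. \<Theta> (A \<otimes>\<^sub>o B) = \<theta> A \<otimes>\<^sub>o B"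
      "\<forall>P\<in>projections (vn_tensor (alg (metric_quotient X (R m)))).
        \<forall>Q\<in>projections (vn_tensor (alg (metric_quotient X (R m)))).
           qdist (kraus_qspace (n m) d (L m)) (\<Theta> P) (\<Theta> Q) = qdist (metric_quotient X (R m)) P Q"
      using iso[of m] unfolding qspace_iso_def by blast
    then have "quotient_iso X (R m) (n m) d (L m) \<epsilon> \<theta> \<Theta>"
      using X R[of m] L[of m]
      by (intro quotient_iso.intro central_quotient.intro quantum_metric.intro
          central_quotient_axioms.intro quotient_iso_axioms.intro) simp_all
    then show ?thesis by blast
  qed
  then obtain \<theta> \<Theta> where q: "\<And>m. quotient_iso X (R m) (n m) d (L m) \<epsilon> (\<theta> m) (\<Theta> m)" by metis
  show ?thesis
  proof (rule asdim_infinite[OF quotient_iso.expander_hom_\<phi>[OF q] lim refl])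
    fix s :: real
    let ?\<phi> = "\<lambda>m. quotient_iso.\<phi> (R m) (\<theta> m)"
    show "\<exists>r>0. \<forall>m. \<forall>P\<in>projections (alg X). \<forall>Q\<in>projections (alg X). ennreal r \<le> pdist X P Q \<longrightarrow>
      ennreal s \<le> pdist (kraus_qspace (n m) d (L m)) (?\<phi> m P) (?\<phi> m Q)"
    \<comment> \<open>Distances do not shrink, so \<open>s\<close> itself would serve as
      \<open>r\<close> if it were positive.\<close>
    proof (intro exI[of _ "max s 1"] conjI allI ballI impI)
      fix m P Q assume PQ: "P \<in> projections (alg X)" "Q \<in> projections (alg X)" "ennreal (max s 1) \<le> pdist X P Q"
      have "ennreal s \<le> ennreal (max s 1)" by (rule ennreal_leI) simp
      also note PQ(3)
      also note quotient_iso.pdist_\<phi>[OF q PQ(1,2)]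
      finally show "ennreal s \<le> pdist (kraus_qspace (n m) d (L m)) (?\<phi> m P) (?\<phi> m Q)" .
    qed simp
    fix r :: real
    show "\<exists>T\<ge>0. \<forall>m. \<forall>P\<in>projections (alg X). qdiam X P \<le> ennreal r \<longrightarrow>
      (\<forall>Q\<in>projections (mats (n m)). \<forall>Q'\<in>projections (mats (n m)). \<forall>A\<in>mats (n m).
        Q o\<^sub>L (?\<phi> m P o\<^sub>L A o\<^sub>L ?\<phi> m P) o\<^sub>L Q' \<noteq> 0 \<longrightarrow>
        pdist (kraus_qspace (n m) d (L m)) Q Q' \<le> ennreal T)"
    proof (intro exI[of _ "max r 0"] conjI allI ballI impI)
      fix m P Q Q' A
      assume a: "P \<in> projections (alg X)" "qdiam X P \<le> ennreal r" "Q \<in> projections (mats (n m))"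
        "Q' \<in> projections (mats (n m))" "A \<in> mats (n m)" "Q o\<^sub>L (?\<phi> m P o\<^sub>L A o\<^sub>L ?\<phi> m P) o\<^sub>L Q' \<noteq> 0"
      note quotient_iso.pdist_le_qdiam_\<phi>[OF q a(1,3-6)]
      also note a(2)
      also have "ennreal r \<le> ennreal (max r 0)" by (rule ennreal_leI) simp
      finally show "pdist (kraus_qspace (n m) d (L m)) Q Q' \<le> ennreal (max r 0)" .
    qed simp
  qed
qed

theorem theorem5p13:
  fixes X :: "'h::chilbert qspace" and d :: nat and \<epsilon> :: real
  assumes "quantum_metric_space X" and "1 \<le> d" and "0 < \<epsilon>" and "\<epsilon> < 1"
  shows
    "(\<forall>n \<Phi> Y \<phi>.
        expander_sequence d \<epsilon> n \<Phi> \<longrightarrow>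
        (\<forall>m. induced_qspace (n m) (\<Phi> m) (Y m) \<and> reflexive_qspace (Y m)) \<longrightarrow>
        equi_coarse X Y \<phi> \<longrightarrow>
        asdim X = \<infinity>) \<and>
     (\<forall>n \<Phi> Y R.
        expander_sequence d \<epsilon> n \<Phi> \<longrightarrow>
        (\<forall>m. induced_qspace (n m) (\<Phi> m) (Y m) \<and> reflexive_qspace (Y m)) \<longrightarrow>
        (\<forall>m. central_projection X (R m) \<and> qspace_iso (metric_quotient X (R m)) (Y m)) \<longrightarrow>
        asdim X = \<infinity>)"
proof (intro conjI allI impI)
  fix n \<Phi> Y \<phi>
  assume seq: "expander_sequence d \<epsilon> n \<Phi>"
    and Y: "\<forall>m. induced_qspace (n m) (\<Phi> m) (Y m) \<and> reflexive_qspace (Y m)"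
    and coarse: "equi_coarse X Y \<phi>"
  obtain L where L: "\<And>m. kraus_expander (n m) d (L m) \<epsilon>" "\<And>m. Y m = kraus_qspace (n m) d (L m)"
    and lim: "filterlim n at_top sequentially"
    using expander_sequence_kraus[OF seq assms(2-4) Y] by metis
  have "Y = (\<lambda>m. kraus_qspace (n m) d (L m))" using L(2) by (rule ext)
  with coarse Y L(1) lim show "asdim X = \<infinity>"
    by (intro asdim_infinite_of_equi_coarse[OF assms(1)]) auto
next
  fix n \<Phi> Y R
  assume seq: "expander_sequence d \<epsilon> n \<Phi>"
    and Y: "\<forall>m. induced_qspace (n m) (\<Phi> m) (Y m) \<and> reflexive_qspace (Y m)"
    and R: "\<forall>m. central_projection X (R m) \<and> qspace_iso (metric_quotient X (R m)) (Y m)"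
  obtain L where L: "\<And>m. kraus_expander (n m) d (L m) \<epsilon>" "\<And>m. Y m = kraus_qspace (n m) d (L m)"
    and lim: "filterlim n at_top sequentially"
    using expander_sequence_kraus[OF seq assms(2-4) Y] by metis
  show "asdim X = \<infinity>"
    by (rule asdim_infinite_of_quotients[OF assms(1) L(1) lim, of R]) (use Y R L(2) in \<open>metis+\<close>)
qed

end
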